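(* Let $\widetilde w(s)$ be the Laplace transform of the queueing delay in the replace base model, written as $\widetilde w(s)=\mathbf u\boldsymbol\omega\prod_{j=1}^{rM}(s+y_j)/\prod_{j=1}^{rM}(s+x_j)$. Let $-y_1,\dots,-y_\sigma$ denote the distinct numbers among $-y_1,\dots,-y_{rM}$, with multiplicities $r_1,\dots,r_\sigma$, $\sum_{j=1}^\sigma r_j=rM$. Then there exist unique coefficients $\beta$, $\gamma$, $\alpha_k,\beta_k,\gamma_k$ ($k=2,\dots,N$), and $\alpha''_{j,l},\beta''_{j,l},\gamma''_{j,l}$ ($j=1,\dots,\sigma$, $l=1,\dots,r_j$), such that the Laplace transform $\widetilde w_\epsilon(s)$ of the queueing delay of the mixture model satisfies $$\begin{aligned}\widetilde w_\epsilon(s)=\widetilde w(s)+\epsilon\frac{1}{\mathbf u\boldsymbol\omega}\,\widetilde w(s)\Bigg[&\Big(\mathbf z\boldsymbol\omega+\sum_{k=2}^N\frac{\alpha_k}{s-s_k}+\sum_{j=1}^{\sigma}\sum_{l=1}^{r_j}\frac{\alpha''_{j,l}\,y_j^{\,r_j-l+1}}{(s+y_j)^{r_j-l+1}}\Big)\\ &+\big(\mu_p\widetilde F^e_p(s)-\mu_h\widetilde F^e_h(s)\big)\Big(\beta+\sum_{k=2}^N\frac{\beta_k}{s-s_k}+\sum_{j=1}^{\sigma}\sum_{l=1}^{r_j}\frac{\beta''_{j,l}\,y_j^{\,r_j-l+1}}{(s+y_j)^{r_j-l+1}}\Big)\\ &-\big(\mu_p\widetilde F^e_p(s)-\mu_h\widetilde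 F^e_h(s)\big)\widetilde w(s)\Big(\gamma+\sum_{k=2}^N\frac{\gamma_k}{s-s_k}+\sum_{j=1}^{\sigma}\sum_{l=1}^{r_j}\frac{\gamma''_{j,l}\,y_j^{\,r_j-l+1}}{(s+y_j)^{r_j-l+1}}\Big)\Bigg]+O(\epsilon^2).\end{aligned}$$
   Context: Arrivals. Single-server FIFO queue with arrivals governed by a Markov process on $\mathcal N=\{1,\dots,N\}$ with intensity matrix $\mathbf D=\mathbf D^{(1)}+\mathbf D^{(2)}$. Entries $d^{(2)}_{ij}\ge0$ are rates of transitions accompanied by a real customer; off-diagonal entries $d^{(1)}_{ij}\ge0$ are rates of transitions without a real customer (a "dummy" customer with zero service time is said to arrive); $d^{(1)}_{ii}=-\sum_{k\ne i}d^{(1)}_{ik}-\sum_kd^{(2)}_{ik}$. Put $\lambda_i=\sum_{k\neq i}d^{(1)}_{ik}+\sum_{k}d^{(2)}_{ik}$, $p_{ij}=\big(d^{(1)}_{ij}(1-\delta_{ij})+d^{(2)}_{ij}\big)/\lambda_i$ ($\delta_{ij}$ Kronecker), and, if $p_{ij}>0$, $q^{(1)}_{ij}=d^{(1)}_{ij}(1-\delta_{ij})/(\lambda_ip_{ij})$, $q^{(2)}_{ij}=d^{(2)}_{ij}/(\lambda_ip_{ij})$ (both $0$ if $p_{ij}=0$). $\mathbf P=[p_{ij}]$ (transition matrix of the Markov chain embedded at arrivals of real and dummy customers) is irreducible with stationary row vector $\boldsymbol\pi$; $\mathbf\Lambda=\mathrm{diag}(\lambda_1,\dots,\lambda_N)$,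 $\mathbf Q^{(i)}=[q^{(i)}_{kl}]$; $\circ$ is the Hadamard product, and $\mathbf Q\circ\mathbf P\mathbf\Lambda$ means $\mathbf Q\circ(\mathbf P\mathbf\Lambda)$; $\mathbf e$ is the all-ones column vector, $\mathbf I$ the identity. An arriving customer at a transition from $i$ to $j$ is tagged $i$. Service times of real customers are i.i.d., independent of the arrival process. Replace base model: phase-type distribution $F_p$ with mean $\mu_p$ and Laplace–Stieltjes transform (LST) $\widetilde F_p=q/p$, with $q,p$ polynomials without common roots, $p$ monic of degree $M$, $\deg q\le M-1$. Mixture model: $G_\epsilon=(1-\epsilon)F_p+\epsilon F_h$, with $F_h$ heavy-tailed of finite mean $\mu_h$ and LST $\widetilde F_h$. Stationary-excess LSTs: $\widetilde F^e_p(s)=(1-\widetilde F_p(s))/(\mu_ps)$, $\widetilde F^e_h(s)=(1-\widetilde F_h(s))/(\mu_hs)$. Both models are assumed stable: $\boldsymbol\pi(\mathbf\Lambda^{-1}-\mathbf M)\mathbf e>0$ with $\mathbf M=\mu_p\mathbf Q^{(2)}\circ\mathbf P$, and $\boldsymbol\pi(\mathbf\Lambda^{-1}-\mathbf M_\epsilon)\mathbf e>0$ with $\mathbf M_\epsilon=\mathbf M+\epsilon(\mu_h-\mu_p)\mathbf Q^{(2)}\circ\mathbf P$. Delay. In each model, let $V$ be the steady-state workload just before an arrival (real or dummy), $Z$ the steady-state tag, $\widetilde\phi_i(s)=\mathbb E(e^{-sV};Z=i)$, $\widetilde{\mathbf\Phi}=[\widetilde\phi_1,\dots,\widetilde\phi_N]$.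 The Laplace transform of the queueing delay of real customers is $\widetilde{\mathbf\Phi}(s)\boldsymbol\omega$, where $\boldsymbol\omega=\mathbf\Lambda^{-1}\mathbf D^{(2)}\mathbf e/(\boldsymbol\pi\mathbf\Lambda^{-1}\mathbf D^{(2)}\mathbf e)$; it is denoted $\widetilde w(s)$ in the base model and $\widetilde w_\epsilon(s)$ in the mixture model. Base-model quantities. $\mathbf E(s)=(\mathbf Q^{(1)}+\widetilde F_p(s)\mathbf Q^{(2)})\circ\mathbf P\mathbf\Lambda+s\mathbf I-\mathbf\Lambda$, and $\mathrm{adj}$ is the adjugate. $\det\mathbf E(s)=0$ has exactly $N$ solutions with non-negative real part, $s_1=0$ and $s_2,\dots,s_N$ with $\Re s_i>0$, assumed simple. For $i\ge2$ choose $m=m_i$ such that the $m$-th column of $\mathrm{adj}\,\mathbf E(s_i)$ is nonzero; $\mathbf a_i$ is that column and $\mathbf a_i^{(1)}$ is the derivative at $s=s_i$ of the $m$-th column of $\mathrm{adj}\,\mathbf E(s)$. The row vector $\mathbf u$ is the unique solution of $\mathbf u\mathbf\Lambda^{-1}\mathbf e=\boldsymbol\pi(\mathbf\Lambda^{-1}-\mathbf M)\mathbf e$, $\mathbf u\mathbf a_i=0$ ($i=2,\dots,N$); one has $\widetilde w(s)=s\mathbf u\,\mathrm{adj}(\mathbf E(s))\boldsymbol\omega/\det\mathbf E(s)$. Here $r$ is the highest power of $p$ occurring in the denominators of $\det\mathbf E(s)$ and $s\mathbf u\,\mathrm{adj}(\mathbf E(s))\boldsymbol\omega$, and $x_j,y_j$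 ($\Re x_j,\Re y_j>0$, $j=1,\dots,rM$) are defined by $p^r\det\mathbf E(s)=s\prod_{k=2}^N(s-s_k)\prod_{j=1}^{rM}(s+x_j)$ and $p^rs\mathbf u\,\mathrm{adj}(\mathbf E(s))\boldsymbol\omega=\mathbf u\boldsymbol\omega\,s\prod_{k=2}^N(s-s_k)\prod_{j=1}^{rM}(s+y_j)$. The vector $\mathbf z$. $\mathbf K(s)=s(\mu_p\widetilde F_p^e(s)-\mu_h\widetilde F_h^e(s))\mathbf Q^{(2)}\circ\mathbf P\mathbf\Lambda$. Write $\mathbf X_{\bullet j}$ for the $j$-th column of $\mathbf X$, and $\mathbf X^{W}_{U}$ for the submatrix with rows $U$, columns $W$. For $i=2,\dots,N$, $$\delta_i=\frac{\sum_{j=1}^N\det(\mathbf E(s_i)_{\bullet1},\dots,\mathbf K(s_i)_{\bullet j},\dots,\mathbf E(s_i)_{\bullet N})}{\sum_{j=1}^N\det(\mathbf E(s_i)_{\bullet1},\dots,\mathbf E^{(1)}(s_i)_{\bullet j},\dots,\mathbf E(s_i)_{\bullet N})},\quad \mathbf E^{(1)}=\tfrac{d}{ds}\mathbf E,$$ and $\mathbf k_i$ is the column vector with entries $k_{i,j}=(-1)^{m+j}\sum_{k=1}^{N-1}\det\big((\mathbf E(s_i)^{\mathcal N\setminus\{j\}}_{\mathcal N\setminus\{m\}})_{\bullet1},\dots,(\mathbf K(s_i)^{\mathcal N\setminus\{j\}}_{\mathcal N\setminus\{m\}})_{\bullet k},\dots,(\mathbf E(s_i)^{\mathcal N\setminus\{j\}}_{\mathcal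 N\setminus\{m\}})_{\bullet N-1}\big)$. With $\mathbf A=(\mathbf\Lambda^{-1}\mathbf e,\mathbf a_2,\dots,\mathbf a_N)$, $\mathbf c=(\boldsymbol\pi(\mathbf\Lambda^{-1}-\mathbf M)\mathbf e,0,\dots,0)$, $\mathbf B=(\mathbf0,\delta_2\mathbf a_2^{(1)}-\mathbf k_2,\dots,\delta_N\mathbf a_N^{(1)}-\mathbf k_N)$, $\mathbf d=((\mu_p-\mu_h)\boldsymbol\pi(\mathbf Q^{(2)}\circ\mathbf P)\mathbf e,0,\dots,0)$, put $\mathbf z=(\mathbf c\mathbf A^{-1}\mathbf B+\mathbf d)\mathbf A^{-1}$.
   Formalization: Uniqueness as stated fails: any constant c can be added to the second sum and c/w to the third. Proved: existence; the α's are unique; β's and γ's determine each other; all are unique once the third sum is required to give the relative first-order change of det E. *)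

theory Defs
  imports
    "HOL-Probability.Probability"
    "HOL-Library.Landau_Symbols"
    "Jordan_Normal_Form.Determinant"
    "Jordan_Normal_Form.Gauss_Jordan_Elimination"
begin

hide_const (open) Finite_Cartesian_Product.mat Finite_Cartesian_Product.vec
  Finite_Cartesian_Product.row Finite_Cartesian_Product.column
  Determinants.det Finite_Cartesian_Product.transpose
  Finite_Cartesian_Product.matrix_matrix_mult Finite_Cartesian_Product.vector_matrix_mult
unbundle no vec_syntax
no_notation inner (infix "\<bullet>" 70)

text \<open>
  All matrices and vectors are those of \<^typ>\<open>'a mat\<close> and \<^typ>\<open>'a vec\<close>, hence indices run over
  \<open>0, \<dots>, N - 1\<close> instead of \<open>1, \<dots>, N\<close>.  Row vectors are ordinary vectors;
  the product of a row vector \<open>v\<close> with a matrix \<open>X\<close> is \<open>X\<^sup>T *\<^sub>v v\<close>.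
\<close>

definition hadamard :: "'a::times mat \<Rightarrow> 'a mat \<Rightarrow> 'a mat" where
  "hadamard X Y = mat (dim_row X) (dim_col X) (\<lambda>(i,j). X $$ (i,j) * Y $$ (i,j))"

definition ones :: "nat \<Rightarrow> 'a::one vec" where
  "ones n = vec n (\<lambda>_. 1)"

abbreviation cmat :: "real mat \<Rightarrow> complex mat" where
  "cmat \<equiv> map_mat complex_of_real"

abbreviation cvec :: "real vec \<Rightarrow> complex vec" where
  "cvec \<equiv> map_vec complex_of_real"


section \<open>The Markovian arrival process\<close>

text \<open>\<open>D1\<close> and \<open>D2\<close> collect the rates of the transitions without and with a real customer.\<close>

definition arrival_process :: "nat \<Rightarrow> real mat \<Rightarrow> real mat \<Rightarrow> bool" where
  "arrival_process N D1 D2 \<longleftrightarrow>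
     N \<ge> 1 \<and> D1 \<in> carrier_mat N N \<and> D2 \<in> carrier_mat N N \<and>
     (\<forall>i<N. \<forall>j<N. 0 \<le> D2 $$ (i,j)) \<and>
     (\<forall>i<N. \<forall>j<N. i \<noteq> j \<longrightarrow> 0 \<le> D1 $$ (i,j)) \<and>
     (\<forall>i<N. D1 $$ (i,i) = - (\<Sum>k\<in>{..<N} - {i}. D1 $$ (i,k)) - (\<Sum>k<N. D2 $$ (i,k)))"

definition rate :: "real mat \<Rightarrow> real mat \<Rightarrow> nat \<Rightarrow> real" where
  "rate D1 D2 i = (\<Sum>k\<in>{..<dim_row D1} - {i}. D1 $$ (i,k)) + (\<Sum>k<dim_row D1. D2 $$ (i,k))"

definition Lam :: "real mat \<Rightarrow> real mat \<Rightarrow> real mat" where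
  "Lam D1 D2 = mat_diag (dim_row D1) (rate D1 D2)"

definition Lam_inv :: "real mat \<Rightarrow> real mat \<Rightarrow> real mat" where
  "Lam_inv D1 D2 = mat_diag (dim_row D1) (\<lambda>i. 1 / rate D1 D2 i)"

definition trans_mat :: "real mat \<Rightarrow> real mat \<Rightarrow> real mat" where
  "trans_mat D1 D2 = mat (dim_row D1) (dim_row D1)
     (\<lambda>(i,j). (D1 $$ (i,j) * (if i = j then 0 else 1) + D2 $$ (i,j)) / rate D1 D2 i)"

definition Q1 :: "real mat \<Rightarrow> real mat \<Rightarrow> real mat" where
  "Q1 D1 D2 = mat (dim_row D1) (dim_row D1)
     (\<lambda>(i,j). if trans_mat D1 D2 $$ (i,j) > 0
              then D1 $$ (i,j) * (if i = j then 0 else 1) / (rate D1 D2 i * trans_mat D1 D2 $$ (i,j))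
              else 0)"

definition Q2 :: "real mat \<Rightarrow> real mat \<Rightarrow> real mat" where
  "Q2 D1 D2 = mat (dim_row D1) (dim_row D1)
     (\<lambda>(i,j). if trans_mat D1 D2 $$ (i,j) > 0
              then D2 $$ (i,j) / (rate D1 D2 i * trans_mat D1 D2 $$ (i,j))
              else 0)"

definition irreducible_mat :: "real mat \<Rightarrow> bool" where
  "irreducible_mat X \<longleftrightarrow> (\<forall>i<dim_row X. \<forall>j<dim_row X. \<exists>n. (X ^\<^sub>m n) $$ (i,j) > 0)"

definition stationary_vec :: "real mat \<Rightarrow> real vec \<Rightarrow> bool" where
  "stationary_vec X v \<longleftrightarrow> v \<in> carrier_vec (dim_row X) \<and> (\<forall>i<dim_row X. 0 \<le> v $ i) \<and>
     (\<Sum>i<dim_row X. v $ i) = 1 \<and> transpose_mat X *\<^sub>v v = v"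

text \<open>\<open>drift D1 D2 v M\<close> is \<open>v (\<Lambda>\<^sup>-\<^sup>1 - M) e\<close>; stability of a model means that it is positive.\<close>

definition drift :: "real mat \<Rightarrow> real mat \<Rightarrow> real vec \<Rightarrow> real mat \<Rightarrow> real" where
  "drift D1 D2 v M = v \<bullet> ((Lam_inv D1 D2 - M) *\<^sub>v ones (dim_row D1))"

definition omega :: "real mat \<Rightarrow> real mat \<Rightarrow> real vec \<Rightarrow> real vec" where
  "omega D1 D2 v =
     (1 / (v \<bullet> (Lam_inv D1 D2 *\<^sub>v (D2 *\<^sub>v ones (dim_row D1))))) \<cdot>\<^sub>v
       (Lam_inv D1 D2 *\<^sub>v (D2 *\<^sub>v ones (dim_row D1)))"


section \<open>Service time distributions\<close>

definition service_dist :: "real measure \<Rightarrow> bool" where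
  "service_dist F \<longleftrightarrow> prob_space F \<and> sets F = sets borel \<and> (AE x in F. 0 \<le> x) \<and>
     integrable F (\<lambda>x. x)"

definition mean :: "real measure \<Rightarrow> real" where
  "mean F = (\<integral>x. x \<partial>F)"

definition lst :: "real measure \<Rightarrow> complex \<Rightarrow> complex" where
  "lst F t = (\<integral>x. exp (- t * complex_of_real x) \<partial>F)"

text \<open>The removable singularity at \<open>0\<close> is filled in, as it must be for the transform of a
  probability distribution.\<close>

definition excess_lst :: "real measure \<Rightarrow> complex \<Rightarrow> complex" where
  "excess_lst F t = (if t = 0 then 1 else (1 - lst F t) / (complex_of_real (mean F) * t))"

definition mat_exp :: "real mat \<Rightarrow> real mat" where
  "mat_exp X = mat (dim_row X) (dim_row X) (\<lambda>ij. \<Sum>k. (X ^\<^sub>m k) $$ ij / fact k)"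

text \<open>Law of the absorption time of a Markov process with transient generator \<open>T\<close> and initial
  distribution \<open>a\<close> on the transient phases (the missing mass starts in the absorbing phase).\<close>

definition phase_type :: "real measure \<Rightarrow> bool" where
  "phase_type F \<longleftrightarrow> (\<exists>n a T. a \<in> carrier_vec n \<and> T \<in> carrier_mat n n \<and>
     (\<forall>i<n. 0 \<le> a $ i) \<and> (\<Sum>i<n. a $ i) \<le> 1 \<and>
     (\<forall>i<n. \<forall>j<n. i \<noteq> j \<longrightarrow> 0 \<le> T $$ (i,j)) \<and> (\<forall>i<n. (\<Sum>j<n. T $$ (i,j)) \<le> 0) \<and> det T \<noteq> 0 \<and>
     (\<forall>x\<ge>0. measure F {x<..} = a \<bullet> (mat_exp (x \<cdot>\<^sub>m T) *\<^sub>v ones n)))"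

definition heavy_tailed :: "real measure \<Rightarrow> bool" where
  "heavy_tailed F \<longleftrightarrow> (\<forall>\<theta>>0. (\<integral>\<^sup>+x. ennreal (exp (\<theta> * x)) \<partial>F) = \<infinity>)"

text \<open>The mixture \<open>(1 - \<epsilon>) F + \<epsilon> H\<close>, for \<open>0 \<le> \<epsilon> \<le> 1\<close>.\<close>

definition mixture :: "real \<Rightarrow> real measure \<Rightarrow> real measure \<Rightarrow> real measure" where
  "mixture \<epsilon> F H = measure_pmf (bernoulli_pmf \<epsilon>) \<bind> (\<lambda>b. if b then H else F)"


section \<open>Workload and delay\<close>

text \<open>
  The state \<open>(v, i)\<close> is the workload just before an arrival together with the tag of that arrival,
  i.e. the state of the arrival process just before it.  With probability \<open>p\<^sub>i\<^sub>j\<close> the arrival moves the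
  process to \<open>j\<close>, and then it is real (\<open>b = True\<close>) with probability \<open>q\<^sup>(\<^sup>2\<^sup>)\<^sub>i\<^sub>j\<close> and dummy
  with probability \<open>q\<^sup>(\<^sup>1\<^sup>)\<^sub>i\<^sub>j\<close>.  The next arrival is then tagged \<open>j\<close> and takes an
  exponential time of rate \<open>\<lambda>\<^sub>j\<close>, so that the workload evolves by Lindley's recursion.
\<close>

definition jump :: "real mat \<Rightarrow> real mat \<Rightarrow> nat \<Rightarrow> (nat \<times> bool) measure" where
  "jump D1 D2 i = point_measure ({..<dim_row D1} \<times> UNIV)
     (\<lambda>(j,b). ennreal (trans_mat D1 D2 $$ (i,j) * (if b then Q2 D1 D2 $$ (i,j) else Q1 D1 D2 $$ (i,j))))"

definition step ::
    "real mat \<Rightarrow> real mat \<Rightarrow> real measure \<Rightarrow> real \<times> nat \<Rightarrow> (real \<times> nat) measure" where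
  "step D1 D2 G = (\<lambda>(v,i).
     jump D1 D2 i \<bind> (\<lambda>(j,b).
     (if b then G else return borel 0) \<bind> (\<lambda>x.
     density lborel (exponential_density (rate D1 D2 j)) \<bind> (\<lambda>y.
     return (borel \<Otimes>\<^sub>M count_space {..<dim_row D1}) (max 0 (v + x - y), j)))))"

text \<open>\<open>L\<close> is the joint law of the steady-state workload \<open>V\<close> and tag \<open>Z\<close> for service time
  distribution \<open>G\<close>: the stationary law of the chain above.  The embedded chain may be periodic,
  so a steady state cannot be defined as a limit in distribution.\<close>

definition steady_state ::
    "real mat \<Rightarrow> real mat \<Rightarrow> real measure \<Rightarrow> (real \<times> nat) measure \<Rightarrow> bool" where
  "steady_state D1 D2 G L \<longleftrightarrow> prob_space L \<and>
     sets L = sets (borel \<Otimes>\<^sub>M count_space {..<dim_row D1}) \<and> L \<bind> step D1 D2 G = L"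

definition workload_lt :: "nat \<Rightarrow> (real \<times> nat) measure \<Rightarrow> complex \<Rightarrow> complex vec" where
  "workload_lt N L t =
     vec N (\<lambda>i. \<integral>(v,j). (if j = i then exp (- t * complex_of_real v) else 0) \<partial>L)"

definition delay_lt ::
    "real mat \<Rightarrow> real mat \<Rightarrow> real vec \<Rightarrow> (real \<times> nat) measure \<Rightarrow> complex \<Rightarrow> complex" where
  "delay_lt D1 D2 v L t = workload_lt (dim_row D1) L t \<bullet> cvec (omega D1 D2 v)"


section \<open>Matrix functions of the transform argument\<close>

text \<open>\<open>E_mat D1 D2 f t\<close> is \<open>E(t)\<close> with \<open>f\<close> in place of the value at \<open>t\<close> of the service time transform.\<close>

definition E_mat :: "real mat \<Rightarrow> real mat \<Rightarrow> complex \<Rightarrow> complex \<Rightarrow> complex mat" where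
  "E_mat D1 D2 f t =
     hadamard (cmat (Q1 D1 D2) + f \<cdot>\<^sub>m cmat (Q2 D1 D2)) (cmat (trans_mat D1 D2 * Lam D1 D2))
     + t \<cdot>\<^sub>m 1\<^sub>m (dim_row D1) - cmat (Lam D1 D2)"

definition R_mat :: "real mat \<Rightarrow> real mat \<Rightarrow> complex mat" where
  "R_mat D1 D2 = cmat (hadamard (Q2 D1 D2) (trans_mat D1 D2 * Lam D1 D2))"

text \<open>\<open>E(t)\<close> with the service time transform replaced by an indeterminate, the outer one; the inner
  indeterminate is \<open>t\<close>.  Since the transform is \<open>q / p\<close> in lowest terms, the degree in the outer
  indeterminate counts the powers of \<open>p\<close> in denominators.\<close>

definition E_formal :: "real mat \<Rightarrow> real mat \<Rightarrow> complex poly poly mat" where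
  "E_formal D1 D2 = mat (dim_row D1) (dim_row D1)
     (\<lambda>ij. [: [: E_mat D1 D2 0 0 $$ ij, 1\<^sub>m (dim_row D1) $$ ij :], [: R_mat D1 D2 $$ ij :] :])"

definition p_power :: "real mat \<Rightarrow> real mat \<Rightarrow> complex vec \<Rightarrow> complex vec \<Rightarrow> nat" where
  "p_power D1 D2 u w = Max (insert (degree (det (E_formal D1 D2)))
     {degree (adj_mat (E_formal D1 D2) $$ (i,j)) | i j.
        i < dim_row D1 \<and> j < dim_row D1 \<and> u $ i \<noteq> 0 \<and> w $ j \<noteq> 0})"

text \<open>The sum of the determinants of \<open>X\<close> with one column replaced by that of \<open>Y\<close>.\<close>

definition det_dir :: "'a::comm_ring_1 mat \<Rightarrow> 'a mat \<Rightarrow> 'a" where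
  "det_dir X Y = (\<Sum>j<dim_col X. det (replace_col X (col Y j) j))"

definition mat_deriv :: "(complex \<Rightarrow> complex mat) \<Rightarrow> complex \<Rightarrow> complex mat" where
  "mat_deriv X t = mat (dim_row (X t)) (dim_col (X t)) (\<lambda>ij. deriv (\<lambda>z. X z $$ ij) t)"

abbreviation mat_inv :: "complex mat \<Rightarrow> complex mat" where
  "mat_inv X \<equiv> the (mat_inverse X)"

definition simple_fractions ::
    "nat \<Rightarrow> (nat \<Rightarrow> complex) \<Rightarrow> nat \<Rightarrow> (nat \<Rightarrow> complex) \<Rightarrow> (nat \<Rightarrow> nat) \<Rightarrow>
     complex \<Rightarrow> (nat \<Rightarrow> complex) \<Rightarrow> (nat \<times> nat \<Rightarrow> complex) \<Rightarrow> complex \<Rightarrow> complex" where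
  "simple_fractions N s \<sigma> y \<rho> c0 c c'' t =
     c0 + (\<Sum>k\<in>{1..<N}. c k / (t - s k))
        + (\<Sum>j<\<sigma>. \<Sum>l\<in>{1..\<rho> j}. c'' (j,l) * y j ^ (\<rho> j - l + 1) / (t + y j) ^ (\<rho> j - l + 1))"

text \<open>Coefficients \<open>(\<alpha>\<^sub>k), (\<alpha>''\<^sub>j\<^sub>l)\<close>, then \<open>\<beta>, (\<beta>\<^sub>k), (\<beta>''\<^sub>j\<^sub>l)\<close>, then \<open>\<gamma>, (\<gamma>\<^sub>k), (\<gamma>''\<^sub>j\<^sub>l)\<close>; families are
  \<^term>\<open>undefined\<close> outside their index sets, so that equality of families is meaningful.

  The first-order expansion alone cannot determine \<open>\<beta>\<close> and \<open>\<gamma>\<close> families separately: for any \<open>T\<close> in the span of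
  \<open>1\<close> and the \<open>1 / (t - s\<^sub>k)\<close>, the quotient \<open>T / w\<close> has the shape of \<^const>\<open>simple_fractions\<close>, so \<open>T\<close> can be
  added to the second sum and \<open>T / w\<close> to the third.  Uniqueness is therefore stated for the splitting whose
  third sum is the relative first-order change of \<open>det E\<close>, and besides that up to this exchange.\<close>

type_synonym coeffs =
  "((nat \<Rightarrow> complex) \<times> (nat \<times> nat \<Rightarrow> complex)) \<times>
   (complex \<times> (nat \<Rightarrow> complex) \<times> (nat \<times> nat \<Rightarrow> complex)) \<times>
   (complex \<times> (nat \<Rightarrow> complex) \<times> (nat \<times> nat \<Rightarrow> complex))"

definition coefficients :: "nat \<Rightarrow> nat \<Rightarrow> (nat \<Rightarrow> nat) \<Rightarrow> coeffs set" where
  "coefficients N \<sigma> \<rho> =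
     (let I = extensional {1..<N}; J = extensional (SIGMA j:{..<\<sigma>}. {1..\<rho> j})
      in (I \<times> J) \<times> (UNIV \<times> I \<times> J) \<times> (UNIV \<times> I \<times> J))"

end

theory Submission
  imports Defs "HOL-Complex_Analysis.Complex_Analysis"
begin

hide_const (open) Finite_Cartesian_Product.mat Finite_Cartesian_Product.vec
  Finite_Cartesian_Product.row Finite_Cartesian_Product.column
  Determinants.det Finite_Cartesian_Product.transpose
  Finite_Cartesian_Product.matrix_matrix_mult Finite_Cartesian_Product.vector_matrix_mult
unbundle no vec_syntax
no_notation inner (infix "\<bullet>" 70)

text \<open>
  Write \<open>\<Phi>\<^sub>\<epsilon>(t)\<close> for the row vector of workload transforms of the mixture model and \<open>\<nu>\<^sub>\<epsilon>\<close> for its vector of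
  probabilities of an empty system, with \<open>\<Phi>\<^sub>0\<close> and \<open>\<nu>\<^sub>0 = u\<close> in the base model.  Stationarity under
  Lindley's recursion with exponential interarrival times says that, for \<open>Re t \<ge> 0\<close>,

    \<open>\<Phi>\<^sub>\<epsilon>(t) (E(t) + \<epsilon> k(t) R) = t \<nu>\<^sub>\<epsilon>\<close>,

  where \<open>k(t) = t h(t)\<close> is the difference of the two service time transforms and \<open>k R\<close> is the matrix \<open>K\<close>
  (lemma \<open>stationary_equation\<close>).  Multiplication by the adjugate of the \<^emph>\<open>unperturbed\<close> matrix gives

    \<open>\<Phi>\<^sub>\<epsilon>(t) det E(t) = t \<nu>\<^sub>\<epsilon> adj E(t) - \<epsilon> k(t) \<Phi>\<^sub>\<epsilon>(t) R adj E(t)\<close>.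

  This makes it unnecessary to follow the roots of the perturbed determinant.  At a root \<open>s\<^sub>i\<close> of \<open>det E\<close> the
  left side vanishes and \<open>\<Phi>\<^sub>\<epsilon>\<close> is bounded, so \<open>\<nu>\<^sub>\<epsilon> a\<^sub>i = O(\<epsilon>)\<close>; the derivative of \<open>1 - lst\<close> at the origin
  supplies the remaining equation, for \<open>\<nu>\<^sub>\<epsilon> \<Lambda>\<^sup>-\<^sup>1 e\<close>.  Inverting \<open>A\<close> yields \<open>\<nu>\<^sub>\<epsilon> = u + O(\<epsilon>)\<close>.  Since \<open>s\<^sub>i\<close> is a
  simple root, the derivative of the displayed identity at \<open>s\<^sub>i\<close> determines \<open>\<Phi>\<^sub>\<epsilon>(s\<^sub>i)\<close> up to \<open>O(\<epsilon>)\<close>, which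
  improves the expansion to \<open>\<nu>\<^sub>\<epsilon> = u + \<epsilon> z + O(\<epsilon>\<^sup>2)\<close> (\<open>nu_expansion\<close>).  That this \<open>z\<close> is the vector built from
  \<open>B\<close> and \<open>d\<close> follows from the derivative of \<open>E adj E = (det E) I\<close> (\<open>kappa_0_eq\<close>).  Away from the roots,
  division by \<open>det E\<close> expands \<open>\<Phi>\<^sub>\<epsilon>\<close> itself (\<open>Phi_expansion\<close>).

  The first-order term is then rewritten.  Put \<open>Z\<^sub>v = v adj(E) \<omega>\<close>, let \<open>T\<close> be the derivative of \<open>det E\<close> in the
  direction \<open>R\<close>, and \<open>V\<close> that of \<open>u adj(E) \<omega>\<close>.  The identity \<open>adj(E) R adj(E) = T adj(E) - det(E) adj'(E)\<close>,
  with \<open>adj'\<close> the derivative in the direction \<open>R\<close>, removes one power of \<open>det E\<close> from the quadratic term, and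
  with \<open>w det E = t Z\<^sub>u\<close> the first-order term becomes

    \<open>(w / Z\<^sub>u) (Z\<^sub>z + h t V - h w T)\<close>.

  By hypothesis \<open>p\<^sup>r Z\<^sub>u = u\<omega> \<Prod>(t - s\<^sub>k) \<Prod>(t + y\<^sub>j)\<close>.  The products of \<open>p\<^sup>r\<close> with \<open>Z\<^sub>z\<close>, \<open>t V\<close> and \<open>T\<close> are
  polynomials, because \<open>T\<close> and \<open>V\<close> are derivatives with respect to the service time transform \<open>q/p\<close>, and their
  degrees are at most \<open>N - 1 + r M\<close>, because \<open>E(t)/t\<close> tends to the identity at infinity; the same limit shows
  that the leading coefficient belonging to \<open>Z\<^sub>z\<close> is \<open>z\<omega>\<close>.  Hence the three quotients have partial fraction
  decompositions of the required shape (\<open>coefficients_exist\<close>).  The origin, a root of \<open>det E\<close> within the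
  domain, is treated apart: both delay transforms equal \<open>1\<close> there, and the bracket vanishes (\<open>Z_T_0\<close>).

  Uniqueness rests on the heavy tail.  If the transform of \<open>F\<^sub>h\<close> were rational, it would continue
  holomorphically across the origin, which gives a finite exponential moment; so \<open>h\<close> is not
  rational (\<open>h_not_rational\<close>).  The difference of two expansions is a relation \<open>a + h (b - w g) = 0\<close> with rational
  \<open>a, b, g\<close>, whence \<open>a = 0\<close> and \<open>b = w g\<close>.
\<close>

section \<open>Laplace transforms of weighted nonnegative variables\<close>

text \<open>
  Both the service time transforms (\<open>g = 1\<close>) and the entries of the vector of workload transforms
  (\<open>g\<close> the indicator of a tag) are of the form \<open>E(g e\<^bsup>-tX\<^esup>)\<close>.
\<close>

locale weighted_variable = finite_measure M for M :: "'a measure" +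
  fixes X g :: "'a \<Rightarrow> real"
  assumes X_meas [measurable]: "X \<in> borel_measurable M"
    and g_meas [measurable]: "g \<in> borel_measurable M"
    and X_nonneg: "AE x in M. 0 \<le> X x"
    and g_nonneg: "\<And>x. 0 \<le> g x" and g_le1: "\<And>x. g x \<le> 1"
begin

definition transform :: "complex \<Rightarrow> complex" where
  "transform t = (\<integral>x. complex_of_real (g x) * exp (- t * complex_of_real (X x)) \<partial>M)"

lemma integrable_g [simp]: "integrable M g"
  by (rule integrable_const_bound[where B=1]) (use g_nonneg g_le1 in auto)

lemma norm_kernel_le:
  "Re t \<ge> 0 \<Longrightarrow> AE x in M. norm (complex_of_real (g x) * exp (- t * complex_of_real (X x))) \<le> g x"
  using X_nonneg by eventually_elim (use g_nonneg in \<open>simp add: norm_mult mult_left_le\<close>)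

lemma integrable_kernel:
  "Re t \<ge> 0 \<Longrightarrow> integrable M (\<lambda>x. complex_of_real (g x) * exp (- t * complex_of_real (X x)))"
  by (rule Bochner_Integration.integrable_bound[OF integrable_g])
     (use norm_kernel_le[of t] g_nonneg in auto)

lemma norm_transform_le: "Re t \<ge> 0 \<Longrightarrow> norm (transform t) \<le> (\<integral>x. g x \<partial>M)"
  unfolding transform_def
  by (rule order.trans[OF integral_norm_bound])
     (rule integral_mono_AE[OF integrable_norm[OF integrable_kernel] integrable_g norm_kernel_le])

lemma transform_0: "transform 0 = complex_of_real (\<integral>x. g x \<partial>M)"
  by (simp add: transform_def)

lemma transform_of_real:
  "transform (complex_of_real c) = complex_of_real (\<integral>x. g x * exp (- c * X x) \<partial>M)"
proof -
  have "transform (complex_of_real c) = (\<integral>x. complex_of_real (g x * exp (- c * X x)) \<partial>M)"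
    unfolding transform_def by (intro Bochner_Integration.integral_cong)
      (auto simp: exp_of_real[symmetric])
  then show ?thesis by (simp only: integral_complex_of_real)
qed

lemma transform_tendsto:
  assumes "\<And>n. Re (T n) \<ge> 0" "T \<longlonglongrightarrow> t"
  shows "(\<lambda>n. transform (T n)) \<longlonglongrightarrow> transform t"
  unfolding transform_def
proof (rule integral_dominated_convergence[where w = g])
  show "AE x in M. (\<lambda>i. complex_of_real (g x) * exp (- T i * complex_of_real (X x)))
          \<longlonglongrightarrow> complex_of_real (g x) * exp (- t * complex_of_real (X x))"
    by (intro always_eventually allI tendsto_intros assms)
qed (use norm_kernel_le assms in auto)

definition moment :: "real \<Rightarrow> nat \<Rightarrow> real" where
  "moment c n = (\<integral>x. g x * (X x ^ n / fact n * exp (- c * X x)) \<partial>M)"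

lemma exp_sums: "(\<lambda>n. (z * b) ^ n / fact n * exp a) sums exp (a + z * b)"
  for a b z :: "'b::{real_normed_field,banach}"
proof -
  have "(\<lambda>n. (z * b) ^ n /\<^sub>R fact n * exp a) sums (exp (z * b) * exp a)"
    by (intro sums_mult2 exp_converges)
  then show ?thesis
    by (simp add: exp_add scaleR_conv_of_real divide_inverse mult.commute)
qed

lemma term_le: "0 < d \<Longrightarrow> d \<le> c \<Longrightarrow> 0 \<le> v \<Longrightarrow> v ^ n / fact n * exp (- c * v) * d ^ n \<le> (1::real)"
proof -
  assume *: "0 < d" "d \<le> c" "0 \<le> v"
  have s: "(\<lambda>n. (d * v) ^ n / fact n * exp (- c * v)) sums exp (- c * v + d * v)"
    by (rule exp_sums)
  have "(\<Sum>k\<in>{n}. (d * v) ^ k / fact k * exp (- c * v)) \<le> (\<Sum>k. (d * v) ^ k / fact k * exp (- c * v))"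
    by (rule sum_le_suminf) (use s * in \<open>auto simp: sums_iff\<close>)
  also have "\<dots> = exp (- c * v + d * v)" using s by (simp add: sums_iff)
  also have "\<dots> \<le> 1" using * by (simp add: mult_right_mono)
  finally show ?thesis by (simp add: power_mult_distrib mult_ac)
qed

lemma moment_kernel_integrable:
  assumes "c > 0" shows "integrable M (\<lambda>x. g x * (X x ^ n / fact n * exp (- c * X x)))"
proof (rule integrable_const_bound[where B = "1 / c ^ n"])
  show "AE x in M. norm (g x * (X x ^ n / fact n * exp (- c * X x))) \<le> 1 / c ^ n"
    using X_nonneg
  proof eventually_elim
    case (elim x)
    have "X x ^ n / fact n * exp (- c * X x) * c ^ n \<le> 1"
      by (rule term_le) (use assms elim in auto)
    then have "X x ^ n / fact n * exp (- c * X x) \<le> 1 / c ^ n"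
      using assms by (simp add: pos_le_divide_eq)
    then have "g x * (X x ^ n / fact n * exp (- c * X x)) \<le> 1 * (1 / c ^ n)"
      by (intro mult_mono) (use g_nonneg g_le1 elim in auto)
    then show ?case using elim g_nonneg by simp
  qed
qed simp

text \<open>
  Expanding \<open>e\<^bsup>-tX\<^esup> = e\<^bsup>-cX\<^esup> e\<^bsup>(c-t)X\<^esup>\<close>; the series converges absolutely up to the distance of \<open>c\<close> from
  the imaginary axis.
\<close>

lemma transform_power_series:
  assumes c: "c > 0" and t: "norm (t - complex_of_real c) < c"
  shows "(\<lambda>n. complex_of_real (moment c n) * (complex_of_real c - t) ^ n) sums transform t"
proof -
  let ?f = "\<lambda>n x. complex_of_real (g x * (X x ^ n / fact n * exp (- c * X x))) * (complex_of_real c - t) ^ n"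
  define d where "d = norm (complex_of_real c - t)"
  have d: "0 \<le> d" "d < c" using t by (auto simp: d_def norm_minus_commute)
  have s: "(\<lambda>n. ?f n x) sums (complex_of_real (g x) * exp (- t * complex_of_real (X x)))" for x
  proof -
    have "(\<lambda>n. ((complex_of_real c - t) * complex_of_real (X x)) ^ n / fact n * exp (- complex_of_real c * complex_of_real (X x)))
       sums exp (- complex_of_real c * complex_of_real (X x) + (complex_of_real c - t) * complex_of_real (X x))"
      by (rule exp_sums)
    from sums_mult[OF this, of "complex_of_real (g x)"]
    moreover have "- complex_of_real c * complex_of_real (X x) + (complex_of_real c - t) * complex_of_real (X x)
        = - t * complex_of_real (X x)" by (simp add: algebra_simps)
    ultimately show ?thesis by (simp add: exp_of_real[symmetric] power_mult_distrib mult_ac)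
  qed
  have sn: "(\<lambda>n. norm (?f n x)) sums (g x * exp (- (c - d) * X x))" if "0 \<le> X x" for x
  proof -
    have "(\<lambda>n. (d * X x) ^ n / fact n * exp (- c * X x)) sums exp (- c * X x + d * X x)"
      by (rule exp_sums)
    from sums_mult[OF this, of "g x"] show ?thesis using that g_nonneg[of x]
      by (simp add: norm_mult norm_power norm_divide d_def[symmetric] power_mult_distrib algebra_simps)
  qed
  have int: "integrable M (?f n)" for n
    by (intro integrable_mult_left integrable_of_real moment_kernel_integrable c)
  have "(\<lambda>n. integral\<^sup>L M (?f n)) sums (\<integral>x. (\<Sum>n. ?f n x) \<partial>M)"
  proof (rule sums_integral)
    show "AE x in M. summable (\<lambda>n. norm (?f n x))"
      using X_nonneg by eventually_elim (use sn in \<open>auto simp: sums_iff\<close>)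
    show "summable (\<lambda>n. \<integral>x. norm (?f n x) \<partial>M)"
    proof (rule summableI_nonneg_bounded)
      fix m
      have "(\<Sum>n<m. \<integral>x. norm (?f n x) \<partial>M) = (\<integral>x. (\<Sum>n<m. norm (?f n x)) \<partial>M)"
        by (rule Bochner_Integration.integral_sum[symmetric]) (rule integrable_norm[OF int])
      also have "\<dots> \<le> (\<integral>x. g x \<partial>M)"
      proof (rule integral_mono_AE)
        show "AE x in M. (\<Sum>n<m. norm (?f n x)) \<le> g x"
          using X_nonneg
        proof eventually_elim
          case (elim x)
          have "(\<Sum>n<m. norm (?f n x)) \<le> (\<Sum>n. norm (?f n x))"
            by (rule sum_le_suminf) (use sn[OF elim] in \<open>auto simp: sums_iff\<close>)
          also have "\<dots> = g x * exp (- (c - d) * X x)" using sn[OF elim] by (simp add: sums_iff)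
          also have "\<dots> \<le> g x * 1" using d elim g_nonneg[of x] by (intro mult_left_mono) (auto simp: mult_nonpos_nonneg)
          finally show ?case by simp
        qed
      qed (intro Bochner_Integration.integrable_sum integrable_norm int, simp)
      finally show "(\<Sum>n<m. \<integral>x. norm (?f n x) \<partial>M) \<le> (\<integral>x. g x \<partial>M)" .
    qed (auto intro!: integral_nonneg_AE)
  qed (rule int)
  also have "(\<integral>x. (\<Sum>n. ?f n x) \<partial>M) = transform t"
    unfolding transform_def using s by (intro Bochner_Integration.integral_cong) (auto simp: sums_iff)
  also have "(\<lambda>n. integral\<^sup>L M (?f n)) = (\<lambda>n. complex_of_real (moment c n) * (complex_of_real c - t) ^ n)"
    by (simp only: moment_def integral_mult_left_zero integral_complex_of_real)
  finally show ?thesis .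
qed

text \<open>The discs of radius \<open>c\<close> around the points \<open>c > 0\<close> exhaust the right half-plane.\<close>

lemma transform_holomorphic: "transform holomorphic_on {t. Re t > 0}"
proof -
  have "transform field_differentiable (at t within {t. Re t > 0})" if t: "Re t > 0" for t
  proof -
    \<comment> \<open>Any \<open>c > \<bar>t\<bar>\<^sup>2 / (2 Re t)\<close> puts \<open>t\<close> inside the disc of radius \<open>c\<close> around \<open>c\<close>.\<close>
    define c where "c = (cmod t)\<^sup>2 / Re t"
    have t0: "t \<noteq> 0" using t by auto
    have c: "c > 0" using t t0 by (simp add: c_def)
    have "(cmod (t - complex_of_real c))\<^sup>2 = (cmod t)\<^sup>2 - 2 * c * Re t + c\<^sup>2"
      unfolding cmod_power2 by (simp add: power2_eq_square algebra_simps)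
    also have "\<dots> = c\<^sup>2 - (cmod t)\<^sup>2" using t by (simp add: c_def)
    also have "\<dots> < c\<^sup>2" using t0 by simp
    finally have tc: "cmod (t - complex_of_real c) < c" using c by (simp add: power2_less_imp_less)
    have "transform holomorphic_on ball (complex_of_real c) c"
    proof (rule power_series_holomorphic)
      fix w assume "w \<in> ball (complex_of_real c) c"
      then have "norm (w - complex_of_real c) < c" by (simp add: dist_norm norm_minus_commute)
      from transform_power_series[OF c this]
      show "(\<lambda>n. complex_of_real (moment c n) * (- 1) ^ n * (w - complex_of_real c) ^ n) sums transform w"
        by (simp add: mult.assoc flip: power_mult_distrib)
    qed
    moreover have "t \<in> ball (complex_of_real c) c" using tc by (simp add: dist_norm norm_minus_commute)
    ultimately have "transform field_differentiable (at t)"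
      by (auto intro: holomorphic_on_imp_differentiable_at)
    then show ?thesis by (rule field_differentiable_at_within)
  qed
  then show ?thesis by (simp add: holomorphic_on_def)
qed

end

section \<open>Service time distributions\<close>

lemma service_dist_weighted_variable:
  assumes "service_dist F" shows "weighted_variable F (\<lambda>x. x) (\<lambda>_. 1)"
proof -
  interpret prob_space F using assms by (simp add: service_dist_def)
  have [measurable_cong]: "sets F = sets borel" using assms by (simp add: service_dist_def)
  show ?thesis by unfold_locales (use assms in \<open>auto simp: service_dist_def\<close>)
qed

lemma lst_eq_transform:
  assumes "service_dist F" shows "lst F = weighted_variable.transform F (\<lambda>x. x) (\<lambda>_. 1)"
  by (rule ext) (simp add: weighted_variable.transform_def[OF service_dist_weighted_variable[OF assms]] lst_def)

lemma lst_0: "service_dist F \<Longrightarrow> lst F 0 = 1"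
  by (simp add: lst_def service_dist_def prob_space.prob_space)

lemma norm_lst_le: "service_dist F \<Longrightarrow> Re t \<ge> 0 \<Longrightarrow> norm (lst F t) \<le> 1"
  using weighted_variable.norm_transform_le[OF service_dist_weighted_variable, of F t]
  by (simp add: lst_eq_transform service_dist_def prob_space.prob_space)

lemma lst_holomorphic: "service_dist F \<Longrightarrow> lst F holomorphic_on {t. Re t > 0}"
  by (simp add: lst_eq_transform weighted_variable.transform_holomorphic[OF service_dist_weighted_variable])

lemma lst_of_real:
  "service_dist F \<Longrightarrow> lst F (complex_of_real c) = complex_of_real (\<integral>x. exp (- c * x) \<partial>F)"
  using weighted_variable.transform_of_real[OF service_dist_weighted_variable, of F c]
  by (simp add: lst_eq_transform)

lemma lst_pos:
  assumes "service_dist F" "c > 0" shows "(\<integral>x. exp (- c * x) \<partial>F) > 0"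
proof -
  interpret prob_space F using assms by (simp add: service_dist_def)
  interpret weighted_variable F "\<lambda>x. x" "\<lambda>_. 1" by (rule service_dist_weighted_variable[OF assms(1)])
  have [simp]: "integrable F (\<lambda>x. exp (- (c * x)))"
    using moment_kernel_integrable[OF assms(2), of 0] by simp
  have "(\<integral>x. exp (- c * x) \<partial>F) \<noteq> 0"
  proof
    assume "(\<integral>x. exp (- c * x) \<partial>F) = 0"
    then have "AE x in F. exp (- c * x) = 0"
      by (subst (asm) integral_nonneg_eq_0_iff_AE) auto
    then have "AE x in F. False" by simp
    then show False using AE_False by simp
  qed
  moreover have "(\<integral>x. exp (- c * x) \<partial>F) \<ge> 0" by simp
  ultimately show ?thesis by linarith
qed

text \<open>For \<open>mean F = 0\<close> the quotient defining the excess transform is not meaningful, but then \<open>F\<close> is the point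
  mass at \<open>0\<close> and both sides vanish.\<close>

lemma mean_excess_lst:
  assumes "service_dist F" "Re t \<ge> 0"
  shows "t * (complex_of_real (mean F) * excess_lst F t) = 1 - lst F t"
proof (cases "t = 0")
  case True then show ?thesis using assms by (simp add: lst_0)
next
  case False
  show ?thesis
  proof (cases "mean F = 0")
    case True
    have "AE x in F. x = 0"
      using True assms integral_nonneg_eq_0_iff_AE[of F "\<lambda>x. x"] by (simp add: mean_def service_dist_def)
    have [measurable_cong]: "sets F = sets borel" using assms by (simp add: service_dist_def)
    have "lst F t = (\<integral>x. 1 \<partial>F)"
      unfolding lst_def
    proof (rule integral_cong_AE)
      show "AE x in F. exp (- t * complex_of_real x) = 1"
        using \<open>AE x in F. x = 0\<close> by eventually_elim simp
    qed measurable
    then show ?thesis using assms True by (simp add: service_dist_def prob_space.prob_space)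
  next
    case mu: False
    show ?thesis using False mu by (simp add: excess_lst_def)
  qed
qed

lemma norm_one_minus_exp_le:
  assumes "Re z \<ge> 0" shows "norm (1 - exp (- z)) \<le> norm z"
proof -
  have "norm (exp 0 - exp (- z)) \<le> 1 * norm (0 - (- z))"
  proof (rule field_differentiable_bound)
    show "convex {z. Re z \<le> 0}" by (rule convex_halfspace_Re_le)
  qed (use assms in \<open>auto intro!: DERIV_subset[OF DERIV_exp]\<close>)
  then show ?thesis by simp
qed

lemma lst_difference_quotient:
  assumes F: "service_dist F" and T: "\<And>n. Re (T n) \<ge> 0" "\<And>n. T n \<noteq> 0" "T \<longlonglongrightarrow> 0"
  shows "(\<lambda>n. (1 - lst F (T n)) / T n) \<longlonglongrightarrow> complex_of_real (mean F)"
proof -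
  interpret weighted_variable F "\<lambda>x. x" "\<lambda>_. 1" by (rule service_dist_weighted_variable[OF F])
  interpret prob_space F using F by (simp add: service_dist_def)
  have 1: "(1 - lst F (T n)) / T n = (\<integral>x. (1 - exp (- T n * complex_of_real x)) / T n \<partial>F)" for n
    using integrable_kernel[OF T(1), of n] by (simp add: lst_def prob_space)
  have "(\<lambda>n. \<integral>x. (1 - exp (- T n * complex_of_real x)) / T n \<partial>F) \<longlonglongrightarrow> (\<integral>x. complex_of_real x \<partial>F)"
  proof (rule integral_dominated_convergence[where w = "\<lambda>x. x"])
    show "AE x in F. (\<lambda>n. (1 - exp (- T n * complex_of_real x)) / T n) \<longlonglongrightarrow> complex_of_real x"
    proof (intro always_eventually allI)
      fix x
      have "((\<lambda>z. exp (- z * complex_of_real x)) has_field_derivative - complex_of_real x) (at 0)"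
        by (auto intro!: derivative_eq_intros)
      then have "((\<lambda>z. (exp (- z * complex_of_real x) - 1) / z) \<longlongrightarrow> - complex_of_real x) (at 0)"
        by (simp add: has_field_derivative_iff)
      then have "((\<lambda>z. - ((exp (- z * complex_of_real x) - 1) / z)) \<longlongrightarrow> complex_of_real x) (at 0)"
        using tendsto_minus by fastforce
      moreover have "filterlim T (at 0) sequentially"
        using T by (auto simp: filterlim_at)
      ultimately have "((\<lambda>n. - ((exp (- T n * complex_of_real x) - 1) / T n)) \<longlongrightarrow> complex_of_real x) sequentially"
        by (rule filterlim_compose)
      then show "(\<lambda>n. (1 - exp (- T n * complex_of_real x)) / T n) \<longlonglongrightarrow> complex_of_real x"
        by (simp add: minus_divide_left)
    qed
    show "AE x in F. norm ((1 - exp (- T n * complex_of_real x)) / T n) \<le> x" for n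
      using X_nonneg
    proof eventually_elim
      case (elim x)
      have "norm (1 - exp (- (T n * complex_of_real x))) \<le> norm (T n * complex_of_real x)"
        by (rule norm_one_minus_exp_le) (use T elim in simp)
      then show ?case using T elim by (simp add: norm_divide norm_mult divide_simps mult.commute)
    qed
  qed (use F in \<open>auto simp: service_dist_def\<close>)
  then show ?thesis by (simp only: 1) (simp add: mean_def)
qed

text \<open>
  A Landau argument: were \<open>lst F\<close> rational, its poles would lie to the left of the imaginary axis, so
  its Taylor series at \<open>1\<close> would converge at some point \<open>- \<theta> < 0\<close>.  The coefficients of that
  series are, up to alternating signs, the nonnegative numbers \<open>\<integral>x\<^sup>n e\<^sup>-\<^sup>x/n! dF\<close>, so by monotone
  convergence its value at \<open>- \<theta>\<close> is the exponential moment \<open>\<integral>e\<^bsup>\<theta>x\<^esup> dF\<close>.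
\<close>

lemma heavy_tailed_no_holomorphic_extension:
  assumes F: "service_dist F" "heavy_tailed F" and r: "r > 1"
    and R: "R holomorphic_on ball 1 r" "\<And>t. t \<in> ball 1 1 \<Longrightarrow> R t = lst F t"
  shows False
proof -
  interpret weighted_variable F "\<lambda>x. x" "\<lambda>_. 1" by (rule service_dist_weighted_variable[OF F(1)])
  have [measurable_cong]: "sets F = sets borel" using F(1) by (simp add: service_dist_def)
  define f where "f = Abs_fps (\<lambda>n. (deriv ^^ n) R 1 / fact n)"
  define g where "g = Abs_fps (\<lambda>n. complex_of_real (moment 1 n) * (- 1) ^ n)"
  have fs: "(\<lambda>n. fps_nth f n * z ^ n) sums R (1 + z)" if "norm z < r" for z
    using holomorphic_power_series[OF R(1), of "1 + z"] that by (simp add: f_def dist_norm)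
  have gs: "(\<lambda>n. fps_nth g n * z ^ n) sums lst F (1 + z)" if "norm z < 1" for z
    using transform_power_series[of 1 "1 + z"] that
    by (simp add: g_def lst_eq_transform[OF F(1)] mult.assoc flip: power_mult_distrib)
  have cf: "fps_conv_radius f \<ge> ereal (1/2)"
    unfolding fps_conv_radius_def
    by (rule conv_radius_geI_ex') (use fs r in \<open>auto simp: sums_iff\<close>)
  have cg: "fps_conv_radius g \<ge> ereal (1/2)"
    unfolding fps_conv_radius_def
    by (rule conv_radius_geI_ex') (use gs in \<open>auto simp: sums_iff\<close>)
  have ev: "eventually (\<lambda>z. eval_fps f z = eval_fps g z) (nhds 0)"
  proof -
    have "eventually (\<lambda>z::complex. z \<in> ball 0 1) (nhds 0)" by (intro eventually_nhds_in_open) auto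
    then show ?thesis
    proof eventually_elim
      case (elim z)
      then have "norm z < 1" by simp
      then show ?case using fs[of z] gs[of z] R(2)[of "1 + z"] r
        by (simp add: eval_fps_def sums_iff dist_norm)
    qed
  qed
  have fg: "f = g"
    using ev by (rule eval_fps_eqD[rotated 2]) (rule less_le_trans[OF _ cf] less_le_trans[OF _ cg], simp)+
  define d where "d = (1 + r) / 2"
  have d: "1 < d" "d < r" using r by (auto simp: d_def)
  have "(\<lambda>n. fps_nth f n * (- complex_of_real d) ^ n) sums R (1 - complex_of_real d)"
    using fs[of "- complex_of_real d"] d by simp
  then have "summable (\<lambda>n. complex_of_real (moment 1 n) * (- 1) ^ n * (- complex_of_real d) ^ n)"
    unfolding fg g_def by (simp add: sums_iff)
  then have "summable (\<lambda>n. complex_of_real (moment 1 n * d ^ n))"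
    by (simp add: mult.assoc flip: power_mult_distrib)
  then have sm: "summable (\<lambda>n. moment 1 n * d ^ n)"
    by (rule summable_of_real_iff[THEN iffD1])
  have m0: "moment 1 n \<ge> 0" for n
    unfolding moment_def by (rule integral_nonneg_AE) (rule eventually_mono[OF X_nonneg], simp)
  have "(\<integral>\<^sup>+x. ennreal (exp ((d - 1) * x)) \<partial>F)
      = (\<integral>\<^sup>+x. (\<Sum>n. ennreal (x ^ n / fact n * exp (- x) * d ^ n)) \<partial>F)"
  proof (rule nn_integral_cong_AE)
    show "AE x in F. ennreal (exp ((d - 1) * x)) = (\<Sum>n. ennreal (x ^ n / fact n * exp (- x) * d ^ n))"
      using X_nonneg
    proof eventually_elim
      case (elim x)
      have "(\<lambda>n. (d * x) ^ n / fact n * exp (- x)) sums exp (- x + d * x)" by (rule exp_sums)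
      then have "(\<lambda>n. x ^ n / fact n * exp (- x) * d ^ n) sums exp ((d - 1) * x)"
        by (simp add: power_mult_distrib algebra_simps)
      then show ?case using elim d by (subst suminf_ennreal2) (auto simp: sums_iff)
    qed
  qed
  also have "\<dots> = (\<Sum>n. \<integral>\<^sup>+x. ennreal (x ^ n / fact n * exp (- x) * d ^ n) \<partial>F)"
    by (rule nn_integral_suminf) measurable
  also have "\<dots> = (\<Sum>n. ennreal (moment 1 n * d ^ n))"
  proof (intro suminf_cong)
    fix n
    have "(\<integral>\<^sup>+x. ennreal (x ^ n / fact n * exp (- x) * d ^ n) \<partial>F)
        = ennreal (\<integral>x. x ^ n / fact n * exp (- x) * d ^ n \<partial>F)"
    proof (rule nn_integral_eq_integral)
      show "integrable F (\<lambda>x. x ^ n / fact n * exp (- x) * d ^ n)"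
        using moment_kernel_integrable[of 1 n] by (intro integrable_mult_left) simp
      show "AE x in F. 0 \<le> x ^ n / fact n * exp (- x) * d ^ n"
        using X_nonneg by eventually_elim (use d in auto)
    qed
    then show "(\<integral>\<^sup>+x. ennreal (x ^ n / fact n * exp (- x) * d ^ n) \<partial>F) = ennreal (moment 1 n * d ^ n)"
      by (simp add: moment_def)
  qed
  also have "\<dots> = ennreal (\<Sum>n. moment 1 n * d ^ n)"
    by (rule suminf_ennreal2) (use m0 d sm in auto)
  also have "\<dots> < \<infinity>" by simp
  finally show False using F(2) d unfolding heavy_tailed_def by auto
qed

text \<open>
  A quotient of polynomials has only finitely many poles.  Those in the closed right half-plane cancel because the
  transform is bounded there; the others keep a positive distance from the closed unit disc around \<open>1\<close>, and the
  previous lemma applies.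
\<close>

lemma heavy_tailed_lst_not_rational_open:
  assumes F: "service_dist F" "heavy_tailed F"
  shows "Q \<noteq> 0 \<Longrightarrow> (\<And>t. Re t > 0 \<Longrightarrow> poly Q t * lst F t = poly P t) \<Longrightarrow> False"
proof (induction "degree Q" arbitrary: P Q rule: less_induct)
  case less
  note eq = less.prems(2)
  show False
  proof (cases "\<exists>a. Re a \<ge> 0 \<and> poly Q a = 0")
    case True
    then obtain a where a: "Re a \<ge> 0" "poly Q a = 0" by blast
    \<comment> \<open>On the right half-plane \<open>P\<close> is dominated by \<open>Q\<close>, so that the root \<open>a\<close> can be cancelled.\<close>
    have "poly P a = 0"
    proof -
      let ?T = "\<lambda>n. a + complex_of_real (inverse (real (Suc n)))"
      have T: "?T \<longlonglongrightarrow> a"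
        using tendsto_add[OF tendsto_const tendsto_of_real[OF LIMSEQ_inverse_real_of_nat], of a] by simp
      have "(\<lambda>n. norm (poly P (?T n))) \<longlonglongrightarrow> norm (poly P a)"
        by (intro tendsto_intros T)
      moreover have "(\<lambda>n. norm (poly Q (?T n))) \<longlonglongrightarrow> norm (poly Q a)"
        by (intro tendsto_intros T)
      moreover have "norm (poly P (?T n)) \<le> norm (poly Q (?T n))" for n
      proof -
        have "Re (?T n) > 0" using a(1) by (simp add: add_nonneg_pos)
        then have "norm (poly P (?T n)) = norm (poly Q (?T n)) * norm (lst F (?T n))"
          by (subst eq[symmetric]) (auto simp: norm_mult)
        also have "\<dots> \<le> norm (poly Q (?T n)) * 1"
          using \<open>Re (?T n) > 0\<close> by (intro mult_left_mono norm_lst_le F) auto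
        finally show ?thesis by simp
      qed
      ultimately have "norm (poly P a) \<le> norm (poly Q a)"
        by (intro LIMSEQ_le) auto
      then show ?thesis using a by simp
    qed
    then obtain P' where P': "P = [:- a, 1:] * P'" by (auto simp: poly_eq_0_iff_dvd)
    from a obtain Q' where Q': "Q = [:- a, 1:] * Q'" by (auto simp: poly_eq_0_iff_dvd)
    have [simp]: "Q' \<noteq> 0" using less.prems(1) Q' by auto
    have ne: "poly Q' t * lst F t = poly P' t" if "Re t > 0" "t \<noteq> a" for t
      using eq[OF that(1)] that(2) by (simp add: P' Q' ring_distribs[symmetric] mult.assoc)
    have "poly Q' t * lst F t = poly P' t" if t: "Re t > 0" for t
    proof (cases "t = a")
      case True
      have "isCont (lst F) t"
        by (rule field_differentiable_imp_continuous_at,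
            rule holomorphic_on_imp_differentiable_at[OF lst_holomorphic[OF F(1)]])
           (use t in \<open>auto simp: open_halfspace_Re_gt\<close>)
      then have "isCont (\<lambda>t. poly Q' t * lst F t - poly P' t) t" by (intro continuous_intros)
      then have "((\<lambda>t. poly Q' t * lst F t - poly P' t) \<longlongrightarrow> poly Q' t * lst F t - poly P' t) (at t)"
        by (simp add: isCont_def)
      moreover have "eventually (\<lambda>t. poly Q' t * lst F t - poly P' t = 0) (at t)"
      proof -
        have "eventually (\<lambda>t. t \<in> {t. Re t > 0} \<and> t \<noteq> a) (at t)"
          unfolding True using t True
          by (intro eventually_conj eventually_at_in_open' eventually_neq_at_within) (auto simp: open_halfspace_Re_gt)
        then show ?thesis by eventually_elim (use ne in auto)
      qed
      then have "((\<lambda>t. poly Q' t * lst F t - poly P' t) \<longlongrightarrow> 0) (at t)" by (rule tendsto_eventually)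
      ultimately have "poly Q' t * lst F t - poly P' t = 0" by (rule tendsto_unique[rotated]) simp
      then show ?thesis by simp
    qed (use ne t in auto)
    moreover have "degree Q' < degree Q" unfolding Q' by (subst degree_mult_eq) auto
    ultimately show False using less.hyps[of Q' P'] by auto
  next
    case False
    define Z where "Z = {z. poly Q z = 0}"
    have Z: "finite Z" unfolding Z_def using less.prems(1) by (rule poly_roots_finite)
    have Z1: "1 < norm (z - 1)" if "z \<in> Z" for z
    proof -
      have "Re z < 0" using that False by (force simp: Z_def not_le)
      then have "1 < \<bar>Re (z - 1)\<bar>" by simp
      also have "\<dots> \<le> norm (z - 1)" by (rule abs_Re_le_cmod)
      finally show ?thesis .
    qed
    define r where "r = Min (insert 2 ((\<lambda>z. norm (z - 1)) ` Z))"
    have r: "r > 1" unfolding r_def using Z Z1 by (subst Min_gr_iff) auto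
    have rZ: "r \<le> norm (z - 1)" if "z \<in> Z" for z
      unfolding r_def using Z that by (intro Min_le) auto
    have nz: "poly Q t \<noteq> 0" if "t \<in> ball 1 r" for t
      using rZ[of t] that by (auto simp: Z_def dist_norm norm_minus_commute)
    show False
    proof (rule heavy_tailed_no_holomorphic_extension[OF F r])
      show "(\<lambda>t. poly P t / poly Q t) holomorphic_on ball 1 r"
        using nz by (intro holomorphic_intros) auto
      fix t :: complex assume t: "t \<in> ball 1 1"
      then have "t \<in> ball 1 r" using r by auto
      moreover have "Re t > 0"
      proof -
        have "\<bar>Re (1 - t)\<bar> \<le> norm (1 - t)" by (rule abs_Re_le_cmod)
        then show ?thesis using t by (simp add: dist_norm)
      qed
      ultimately show "poly P t / poly Q t = lst F t" using eq[of t] nz by (simp add: field_simps)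
    qed
  qed
qed

lemma heavy_tailed_lst_not_rational:
  assumes F: "service_dist F" "heavy_tailed F" and T: "finite T" and Q: "Q \<noteq> 0"
    and eq: "\<And>t. Re t > 0 \<Longrightarrow> t \<notin> T \<Longrightarrow> poly Q t * lst F t = poly P t"
  shows False
proof -
  define W where "W = (\<Prod>a\<in>T. [:- a, 1:])"
  have W: "poly W t = 0 \<longleftrightarrow> t \<in> T" for t using T by (simp add: W_def poly_prod)
  have "W \<noteq> 0" using T by (simp add: W_def)
  then have "W * Q \<noteq> 0" using Q by simp
  moreover have "poly (W * Q) t * lst F t = poly (W * P) t" if "Re t > 0" for t
    using eq[OF that] W[of t] by (cases "t \<in> T") (auto simp: mult.assoc)
  ultimately show False by (rule heavy_tailed_lst_not_rational_open[OF F])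
qed

section \<open>Integration against iterated kernels\<close>

lemma integrable_bounded_subprob:
  fixes f :: "'a \<Rightarrow> complex"
  assumes "f \<in> borel_measurable K" "\<And>x. x \<in> space K \<Longrightarrow> norm (f x) \<le> B"
    and "M \<in> space (subprob_algebra K)"
  shows "integrable M f"
proof -
  interpret subprob_space M using assms(3) by (simp add: space_subprob_algebra)
  have [measurable_cong]: "sets M = sets K" and sp: "space M = space K"
    using assms(3) by (auto simp: space_subprob_algebra dest: sets_eq_imp_space_eq)
  note assms(1)[measurable]
  show ?thesis by (rule integrable_const_bound[where B=B]) (use assms(2) sp in auto)
qed

text \<open>Real and imaginary parts reduce this to real integrands.\<close>

lemma integral_bind_bounded:
  fixes f :: "'b \<Rightarrow> complex"
  assumes f[measurable]: "f \<in> borel_measurable K" and B: "\<And>x. x \<in> space K \<Longrightarrow> norm (f x) \<le> B"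
    and N[measurable]: "N \<in> M \<rightarrow>\<^sub>M subprob_algebra K" and M: "prob_space M"
  shows "(\<integral>x. f x \<partial>(M \<bind> N)) = (\<integral>x. (\<integral>y. f y \<partial>N x) \<partial>M)"
proof -
  interpret prob_space M by fact
  have Nx: "x \<in> space M \<Longrightarrow> N x \<in> space (subprob_algebra K)" for x
    using measurable_space[OF N] .
  have sb: "M \<bind> N \<in> space (subprob_algebra K)"
    using subprob_space_bind[OF _ N] sets_bind[OF _ not_empty, of N K] Nx
    by (simp add: space_subprob_algebra prob_space_imp_subprob_space M)
  have i1: "integrable (M \<bind> N) f" by (rule integrable_bounded_subprob[OF f B sb])
  have i2: "integrable (N x) f" if "x \<in> space M" for x
    by (rule integrable_bounded_subprob[OF f B Nx[OF that]])
  have B0: "0 \<le> B"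
  proof -
    obtain x where "x \<in> space M" using not_empty by auto
    then obtain y where "y \<in> space K"
      using Nx[of x] subprob_space.subprob_not_empty[of "N x"]
      by (auto simp: space_subprob_algebra dest: sets_eq_imp_space_eq)
    then show ?thesis using B[of y] norm_ge_zero order_trans by blast
  qed
  have em: "emeasure (N x) (space (N x)) \<le> 1" if "x \<in> space M" for x
    using Nx[OF that] by (simp add: space_subprob_algebra subprob_space.subprob_emeasure_le_1)
  have i3: "integrable M (\<lambda>x. \<integral>y. f y \<partial>N x)"
  proof (rule integrable_const_bound[where B=B])
    show "AE x in M. norm (\<integral>y. f y \<partial>N x) \<le> B"
    proof (rule AE_I2)
      fix x assume x: "x \<in> space M"
      interpret N: subprob_space "N x" using Nx[OF x] by (simp add: space_subprob_algebra)
      have "norm (\<integral>y. f y \<partial>N x) \<le> (\<integral>y. norm (f y) \<partial>N x)" by (rule integral_norm_bound)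
      also have "\<dots> \<le> (\<integral>y. B \<partial>N x)"
        by (rule integral_mono) (use B i2[OF x] Nx[OF x] in \<open>auto simp: space_subprob_algebra dest: sets_eq_imp_space_eq\<close>)
      also have "\<dots> \<le> B" using N.subprob_measure_le_1[of "space (N x)"] B0 by (simp add: mult_left_le_one_le)
      finally show "norm (\<integral>y. f y \<partial>N x) \<le> B" .
    qed
  qed (rule measurable_compose[OF N integral_measurable_subprob_algebra[OF f]])
  show ?thesis
  proof (rule complex_eqI)
    have "Re (\<integral>x. f x \<partial>(M \<bind> N)) = (\<integral>x. Re (f x) \<partial>(M \<bind> N))" using i1 by simp
    also have "\<dots> = (\<integral>x. (\<integral>y. Re (f y) \<partial>N x) \<partial>M)"
    proof (rule integral_bind[where B = B and K = K and B' = 1])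
      show "\<bar>Re (f x)\<bar> \<le> B" if "x \<in> space K" for x
        using B[OF that] abs_Re_le_cmod[of "f x"] by linarith
    qed (auto simp: em finite_measure_axioms)
    also have "\<dots> = (\<integral>x. Re (\<integral>y. f y \<partial>N x) \<partial>M)"
      by (rule Bochner_Integration.integral_cong) (auto simp: i2)
    also have "\<dots> = Re (\<integral>x. (\<integral>y. f y \<partial>N x) \<partial>M)" using i3 by simp
    finally show "Re (\<integral>x. f x \<partial>(M \<bind> N)) = Re (\<integral>x. (\<integral>y. f y \<partial>N x) \<partial>M)" .
    have "Im (\<integral>x. f x \<partial>(M \<bind> N)) = (\<integral>x. Im (f x) \<partial>(M \<bind> N))" using i1 by simp
    also have "\<dots> = (\<integral>x. (\<integral>y. Im (f y) \<partial>N x) \<partial>M)"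
    proof (rule integral_bind[where B = B and K = K and B' = 1])
      show "\<bar>Im (f x)\<bar> \<le> B" if "x \<in> space K" for x
        using B[OF that] abs_Im_le_cmod[of "f x"] by linarith
    qed (auto simp: em finite_measure_axioms)
    also have "\<dots> = (\<integral>x. Im (\<integral>y. f y \<partial>N x) \<partial>M)"
      by (rule Bochner_Integration.integral_cong) (auto simp: i2)
    also have "\<dots> = Im (\<integral>x. (\<integral>y. f y \<partial>N x) \<partial>M)" using i3 by simp
    finally show "Im (\<integral>x. f x \<partial>(M \<bind> N)) = Im (\<integral>x. (\<integral>y. f y \<partial>N x) \<partial>M)" .
  qed
qed

definition nonneg_dist :: "real measure \<Rightarrow> bool" where
  "nonneg_dist G \<longleftrightarrow> prob_space G \<and> sets G = sets borel \<and> (AE x in G. 0 \<le> x)"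

lemma service_dist_nonneg: "service_dist F \<Longrightarrow> nonneg_dist F"
  by (simp add: service_dist_def nonneg_dist_def)

lemma nonneg_dist_weighted_variable:
  assumes "nonneg_dist F" shows "weighted_variable F (\<lambda>x. x) (\<lambda>_. 1)"
proof -
  interpret prob_space F using assms by (simp add: nonneg_dist_def)
  have [measurable_cong]: "sets F = sets borel" using assms by (simp add: nonneg_dist_def)
  show ?thesis by unfold_locales (use assms in \<open>auto simp: nonneg_dist_def\<close>)
qed

lemma nonneg_dist_integrable_exp:
  assumes "nonneg_dist F" "Re t \<ge> 0" shows "integrable F (\<lambda>x. exp (- t * complex_of_real x))"
  using weighted_variable.integrable_kernel[OF nonneg_dist_weighted_variable[OF assms(1)] assms(2)] by simp

lemma nonneg_dist_lst_max:
  assumes "nonneg_dist F" shows "lst F t = (\<integral>x. exp (- t * complex_of_real (max 0 x)) \<partial>F)"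
proof -
  have [measurable_cong]: "sets F = sets borel" using assms by (simp add: nonneg_dist_def)
  have ae: "AE x in F. 0 \<le> x" using assms by (simp add: nonneg_dist_def)
  show ?thesis unfolding lst_def
  proof (rule integral_cong_AE)
    show "AE x in F. exp (- t * complex_of_real x) = exp (- t * complex_of_real (max 0 x))"
      using ae by eventually_elim simp
  qed measurable
qed

lemma nonneg_dist_return_0: "nonneg_dist (return borel 0)"
  by (auto simp: nonneg_dist_def prob_space_return AE_return)

lemma lst_return_0: "lst (return borel 0) t = 1"
  by (simp add: lst_def integral_return)

subsection \<open>Mixtures\<close>

lemma mixture_kernel_measurable:
  assumes "nonneg_dist F" "nonneg_dist H"
  shows "(\<lambda>b. if b then H else F) \<in> measure_pmf P \<rightarrow>\<^sub>M subprob_algebra borel"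
  using assms by (auto simp: measurable_pmf_measure1 space_subprob_algebra nonneg_dist_def
      prob_space_imp_subprob_space)

lemma nonneg_dist_mixture:
  assumes F: "nonneg_dist F" and H: "nonneg_dist H" shows "nonneg_dist (mixture \<epsilon> F H)"
  unfolding nonneg_dist_def
proof (intro conjI)
  note k = mixture_kernel_measurable[OF F H, of "bernoulli_pmf \<epsilon>"]
  show "prob_space (mixture \<epsilon> F H)" unfolding mixture_def
    by (rule measure_pmf.prob_space_bind[OF _ k]) (use F H in \<open>auto simp: nonneg_dist_def\<close>)
  show "sets (mixture \<epsilon> F H) = sets borel" unfolding mixture_def
    by (rule sets_bind[where N = borel]) (use F H in \<open>auto simp: nonneg_dist_def\<close>)
  show "AE x in mixture \<epsilon> F H. 0 \<le> x" unfolding mixture_def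
    by (subst AE_bind[OF k]) (use F H in \<open>auto simp: nonneg_dist_def\<close>)
qed

lemma lst_mixture:
  assumes F: "nonneg_dist F" and H: "nonneg_dist H" and e: "0 \<le> \<epsilon>" "\<epsilon> \<le> 1" and t: "Re t \<ge> 0"
  shows "lst (mixture \<epsilon> F H) t = (1 - complex_of_real \<epsilon>) * lst F t + complex_of_real \<epsilon> * lst H t"
proof -
  let ?f = "\<lambda>x. exp (- t * complex_of_real (max 0 x))"
  have "lst (mixture \<epsilon> F H) t = (\<integral>x. ?f x \<partial>mixture \<epsilon> F H)"
    by (rule nonneg_dist_lst_max[OF nonneg_dist_mixture[OF F H]])
  also have "\<dots> = (\<integral>b. (\<integral>x. ?f x \<partial>(if b then H else F)) \<partial>measure_pmf (bernoulli_pmf \<epsilon>))"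
    unfolding mixture_def
    by (rule integral_bind_bounded[where B = 1 and K = borel])
       (use t mixture_kernel_measurable[OF F H] in \<open>auto simp: prob_space_measure_pmf mult_nonneg_nonneg max_def\<close>)
  also have "\<dots> = (\<Sum>b\<in>UNIV. pmf (bernoulli_pmf \<epsilon>) b *\<^sub>R (\<integral>x. ?f x \<partial>(if b then H else F)))"
    by (rule integral_measure_pmf) auto
  also have "\<dots> = (1 - complex_of_real \<epsilon>) * lst F t + complex_of_real \<epsilon> * lst H t"
    using e by (simp add: UNIV_bool nonneg_dist_lst_max[OF F] nonneg_dist_lst_max[OF H] scaleR_conv_of_real)
  finally show ?thesis .
qed

section \<open>Exponential interarrival times\<close>

text \<open>
  The effect of one interarrival time on a workload \<open>a\<close>, as a transform.  The factor \<open>l - t\<close> is kept on the left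
  so that \<open>t = l\<close> is covered.
\<close>

lemma integral_exponential_truncated:
  assumes l: "l > 0" and a: "a \<ge> 0" and t: "Re t \<ge> 0"
  shows "(complex_of_real l - t) *
      (\<integral>y. exp (- t * complex_of_real (max 0 (a - y))) \<partial>density lborel (exponential_density l))
    = complex_of_real l * exp (- t * complex_of_real a) - t * exp (- complex_of_real l * complex_of_real a)"
proof -
  let ?M = "density lborel (exponential_density l)"
  interpret prob_space ?M using l by (rule prob_space_exponential_density)
  let ?f = "\<lambda>y. exp (- t * complex_of_real (max 0 (a - y)))"
  \<comment> \<open>The integrand minus \<open>1\<close> is supported on \<open>[0, a]\<close>, where it has an elementary primitive.\<close>
  let ?g = "\<lambda>y. complex_of_real l * exp (- complex_of_real l * complex_of_real y) * (exp (- t * complex_of_real (a - y)) - 1)"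
  let ?G = "\<lambda>y. complex_of_real l * exp (- t * complex_of_real a) * (exp ((t - complex_of_real l) * complex_of_real y))
      + (t - complex_of_real l) * exp (- complex_of_real l * complex_of_real y)"
  have intf: "integrable ?M ?f"
    by (rule integrable_const_bound[where B=1]) (use t in \<open>auto simp: max_def mult_nonneg_nonneg\<close>)
  have "(\<integral>y. ?f y \<partial>?M) - 1 = (\<integral>y. ?f y - 1 \<partial>?M)"
    using intf prob_space by simp
  also have "\<dots> = (\<integral>y. exponential_density l y *\<^sub>R (?f y - 1) \<partial>lborel)"
    by (subst integral_density) (use l in \<open>auto simp: exponential_density_nonneg\<close>)
  also have "\<dots> = (\<integral>y. indicator {0..a} y *\<^sub>R ?g y \<partial>lborel)"
    by (rule Bochner_Integration.integral_cong)
       (auto simp: exponential_density_def indicator_def scaleR_conv_of_real exp_of_real[symmetric] max_def mult_ac)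
  finally have 1: "(\<integral>y. ?f y \<partial>?M) - 1 = (\<integral>y. indicator {0..a} y *\<^sub>R ?g y \<partial>lborel)" .
  have "(\<integral>y. indicator {0..a} y *\<^sub>R ((t - complex_of_real l) * ?g y) \<partial>lborel) = ?G a - ?G 0"
  proof (rule integral_FTC_Icc[OF a])
    fix x assume "0 \<le> x" "x \<le> a"
    \<comment> \<open>The primitive, as a function of a complex argument.\<close>
    define h where "h z = complex_of_real l * exp (- t * complex_of_real a) * exp ((t - complex_of_real l) * z)
        + (t - complex_of_real l) * exp (- complex_of_real l * z)" for z
    have "(h has_field_derivative (t - complex_of_real l) * ?g x) (at (complex_of_real x))"
      unfolding h_def
      by (auto intro!: derivative_eq_intros simp: algebra_simps exp_add[symmetric])
    then have "((\<lambda>y. h (complex_of_real y)) has_vector_derivative (t - complex_of_real l) * ?g x) (at x within {0..a})"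
      by (rule has_vector_derivative_real_field)
    then show "(?G has_vector_derivative (t - complex_of_real l) * ?g x) (at x within {0..a})"
      by (simp add: h_def)
  next
    show "continuous_on {0..a} (\<lambda>x. (t - complex_of_real l) * ?g x)"
      by (intro continuous_intros)
  qed
  also have "(\<integral>y. indicator {0..a} y *\<^sub>R ((t - complex_of_real l) * ?g y) \<partial>lborel)
      = (t - complex_of_real l) * ((\<integral>y. ?f y \<partial>?M) - 1)"
    unfolding 1 by (subst integral_mult_right_zero[symmetric]) (simp add: mult.left_commute)
  finally have "(t - complex_of_real l) * ((\<integral>y. ?f y \<partial>?M) - 1) = ?G a - ?G 0" .
  then show ?thesis by (simp add: algebra_simps exp_add[symmetric] flip: exp_minus)
qed

section \<open>The stationary equation of the embedded chain\<close>

locale map_arrivals =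
  fixes N :: nat and D1 D2 :: "real mat"
  assumes arrivals: "arrival_process N D1 D2" and rate_pos: "\<And>i. i < N \<Longrightarrow> rate D1 D2 i > 0"
begin

abbreviation "lam \<equiv> rate D1 D2"

lemma N_pos: "N > 0" and dims [simp]: "dim_row D1 = N" "dim_col D1 = N" "dim_row D2 = N" "dim_col D2 = N"
  using arrivals by (auto simp: arrival_process_def)

lemma D2_nonneg: "i < N \<Longrightarrow> j < N \<Longrightarrow> 0 \<le> D2 $$ (i,j)"
  and D1_nonneg: "i < N \<Longrightarrow> j < N \<Longrightarrow> i \<noteq> j \<Longrightarrow> 0 \<le> D1 $$ (i,j)"
  using arrivals by (auto simp: arrival_process_def)

text \<open>\<open>jw i j b\<close> is the probability \<open>p\<^sub>i\<^sub>j q\<^sup>(\<^sup>b\<^sup>)\<^sub>i\<^sub>j\<close> of a transition from \<open>i\<close> to \<open>j\<close> of kind \<open>b\<close>; the quotient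
  defining \<open>q\<close> cancels, also where \<open>p\<^sub>i\<^sub>j = 0\<close>.\<close>

definition jw :: "nat \<Rightarrow> nat \<Rightarrow> bool \<Rightarrow> real" where
  "jw i j b = (if b then D2 $$ (i,j) else if i = j then 0 else D1 $$ (i,j)) / lam i"

lemma jw_nonneg: "i < N \<Longrightarrow> j < N \<Longrightarrow> 0 \<le> jw i j b"
  using rate_pos[of i] D1_nonneg[of i j] D2_nonneg[of i j] by (auto simp: jw_def)

lemma trans_mat_jw: "i < N \<Longrightarrow> j < N \<Longrightarrow> trans_mat D1 D2 $$ (i,j) = jw i j True + jw i j False"
  by (simp add: trans_mat_def jw_def add_divide_distrib)

lemma trans_mat_carrier [simp]: "trans_mat D1 D2 \<in> carrier_mat N N"
  "dim_row (trans_mat D1 D2) = N" "dim_col (trans_mat D1 D2) = N"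
  by (auto simp: trans_mat_def)

lemma trans_mat_Q:
  assumes "i < N" "j < N"
  shows "trans_mat D1 D2 $$ (i,j) * Q2 D1 D2 $$ (i,j) = jw i j True"
    and "trans_mat D1 D2 $$ (i,j) * Q1 D1 D2 $$ (i,j) = jw i j False"
proof -
  note t = trans_mat_jw[OF assms] and p = jw_nonneg[OF assms, of True] jw_nonneg[OF assms, of False]
  have z: "jw i j True = 0 \<and> jw i j False = 0" if "\<not> 0 < trans_mat D1 D2 $$ (i,j)"
    using t p that by linarith
  show "trans_mat D1 D2 $$ (i,j) * Q2 D1 D2 $$ (i,j) = jw i j True"
  proof (cases "0 < trans_mat D1 D2 $$ (i,j)")
    case True then show ?thesis using assms by (simp add: Q2_def jw_def)
  next
    case False
    then show ?thesis using z[OF False] t by simp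
  qed
  show "trans_mat D1 D2 $$ (i,j) * Q1 D1 D2 $$ (i,j) = jw i j False"
  proof (cases "0 < trans_mat D1 D2 $$ (i,j)")
    case True
    then have "trans_mat D1 D2 $$ (i,j) \<noteq> 0" by simp
    with True show ?thesis using assms by (cases "i = j") (simp_all add: Q1_def jw_def)
  next
    case False
    then show ?thesis using z[OF False] t by simp
  qed
qed

lemma jw_sum: assumes "i < N" shows "(\<Sum>j<N. jw i j True + jw i j False) = 1"
proof -
  have "(\<Sum>j<N. jw i j True + jw i j False) * lam i
      = (\<Sum>j<N. D2 $$ (i,j)) + (\<Sum>j<N. if i = j then 0 else D1 $$ (i,j))"
    using rate_pos[OF assms] by (simp add: jw_def sum_distrib_right sum.distrib ring_distribs)
  also have "(\<Sum>j<N. if i = j then 0 else D1 $$ (i,j)) = (\<Sum>j\<in>{..<N} - {i}. D1 $$ (i,j))"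
    by (rule sum.mono_neutral_cong_right) auto
  also have "(\<Sum>j<N. D2 $$ (i,j)) + \<dots> = lam i" by (simp add: rate_def)
  finally show ?thesis using rate_pos[OF assms] by simp
qed

abbreviation "S \<equiv> (borel :: real measure) \<Otimes>\<^sub>M count_space {..<N}"
abbreviation "J \<equiv> {..<N} \<times> (UNIV :: bool set)"

lemma jump_eq:
  "i < N \<Longrightarrow> jump D1 D2 i = point_measure J (\<lambda>y. ennreal (jw i (fst y) (snd y)))"
  unfolding jump_def point_measure_def
  by (simp, rule density_cong) (auto simp: trans_mat_Q AE_count_space)

lemma prob_space_jump: assumes "i < N" shows "prob_space (jump D1 D2 i)"
  unfolding jump_eq[OF assms]
proof (rule prob_space_point_measure)
  have "(\<Sum>s\<in>J. ennreal (jw i (fst s) (snd s))) = ennreal (\<Sum>s\<in>J. jw i (fst s) (snd s))"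
    using assms by (intro sum_ennreal) (auto simp: jw_nonneg)
  also have "(\<Sum>s\<in>J. jw i (fst s) (snd s)) = (\<Sum>j<N. \<Sum>b\<in>UNIV. jw i j b)"
    by (simp add: sum.cartesian_product split_def)
  also have "\<dots> = 1" using jw_sum[OF assms] by (simp add: UNIV_bool add.commute)
  finally show "(\<Sum>s\<in>J. ennreal (jw i (fst s) (snd s))) = 1" by simp
qed (use assms in \<open>auto simp: jw_nonneg\<close>)

lemma sets_jump: "sets (jump D1 D2 i) = sets (count_space J)"
  by (simp add: jump_def sets_point_measure)

lemma integral_jump:
  fixes f :: "nat \<times> bool \<Rightarrow> complex"
  assumes "i < N"
  shows "(\<integral>y. f y \<partial>jump D1 D2 i) = (\<Sum>j<N. \<Sum>b\<in>UNIV. complex_of_real (jw i j b) * f (j,b))"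
  unfolding jump_eq[OF assms]
  by (subst lebesgue_integral_point_measure_finite)
     (use assms in \<open>auto simp: jw_nonneg sum.cartesian_product split_def scaleR_conv_of_real\<close>)

lemma jump_measurable: "(\<lambda>x. jump D1 D2 (snd x)) \<in> S \<rightarrow>\<^sub>M subprob_algebra (count_space J)"
proof (rule measurable_compose[OF measurable_snd])
  show "jump D1 D2 \<in> count_space {..<N} \<rightarrow>\<^sub>M subprob_algebra (count_space J)"
    by (auto simp: space_subprob_algebra sets_jump prob_space_jump prob_space_imp_subprob_space)
qed

text \<open>The service requirement brought by an arrival, zero for a dummy one, and the time until the next arrival.\<close>

definition arrive :: "real measure \<Rightarrow> bool \<Rightarrow> real measure" where
  "arrive G b = (if b then G else return borel 0)"

definition gap :: "nat \<Rightarrow> real measure" where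
  "gap j = density lborel (exponential_density (lam j))"

lemma step_eq: "step D1 D2 G = (\<lambda>x. jump D1 D2 (snd x) \<bind> (\<lambda>y. arrive G (snd y) \<bind> (\<lambda>s.
    gap (fst y) \<bind> (\<lambda>e. return S (max 0 (fst x + s - e), fst y)))))"
  by (rule ext) (simp add: step_def arrive_def gap_def split_def)

lemma arrive_nonneg: "nonneg_dist G \<Longrightarrow> nonneg_dist (arrive G b)"
  by (simp add: arrive_def nonneg_dist_return_0)

lemma arrive_measurable: "nonneg_dist G \<Longrightarrow> arrive G \<in> count_space UNIV \<rightarrow>\<^sub>M subprob_algebra borel"
  using arrive_nonneg[of G]
  by (auto simp: space_subprob_algebra nonneg_dist_def prob_space_imp_subprob_space)

lemma prob_space_gap: "j < N \<Longrightarrow> prob_space (gap j)"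
  unfolding gap_def by (rule prob_space_exponential_density[OF rate_pos])

lemma sets_gap: "sets (gap j) = sets borel" by (simp add: gap_def)

lemma gap_measurable: "gap \<in> count_space {..<N} \<rightarrow>\<^sub>M subprob_algebra borel"
  by (auto simp: space_subprob_algebra prob_space_gap sets_gap prob_space_imp_subprob_space)

lemma fst_J [measurable]: "fst \<in> count_space J \<rightarrow>\<^sub>M count_space {..<N}"
  and snd_J [measurable]: "snd \<in> count_space J \<rightarrow>\<^sub>M count_space UNIV"
  by (auto simp: measurable_count_space_eq1)

lemma return_S_measurable:
  assumes [measurable]: "a \<in> borel_measurable M" "b \<in> M \<rightarrow>\<^sub>M count_space {..<N}"
  shows "(\<lambda>x. return S (a x, b x)) \<in> M \<rightarrow>\<^sub>M subprob_algebra S"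
  by (rule measurable_compose[OF _ return_measurable]) measurable

lemma gap_kernel:
  assumes [measurable]: "a \<in> borel_measurable M" and b[measurable]: "b \<in> M \<rightarrow>\<^sub>M count_space {..<N}"
  shows "(\<lambda>x. gap (b x) \<bind> (\<lambda>e. return S (max 0 (a x - e), b x))) \<in> M \<rightarrow>\<^sub>M subprob_algebra S"
proof (rule measurable_bind)
  show "(\<lambda>x. gap (b x)) \<in> M \<rightarrow>\<^sub>M subprob_algebra borel"
    by (rule measurable_compose[OF b gap_measurable])
  show "(\<lambda>x. return S (max 0 (a (fst x) - snd x), b (fst x))) \<in> M \<Otimes>\<^sub>M borel \<rightarrow>\<^sub>M subprob_algebra S"
    by (rule return_S_measurable) measurable
qed

lemma arrive_kernel:
  assumes G: "nonneg_dist G" and [measurable]: "a \<in> borel_measurable M"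
    and y[measurable]: "y \<in> M \<rightarrow>\<^sub>M count_space J"
  shows "(\<lambda>x. arrive G (snd (y x)) \<bind> (\<lambda>s. gap (fst (y x)) \<bind> (\<lambda>e. return S (max 0 (a x + s - e), fst (y x)))))
    \<in> M \<rightarrow>\<^sub>M subprob_algebra S"
proof (rule measurable_bind)
  show "(\<lambda>x. arrive G (snd (y x))) \<in> M \<rightarrow>\<^sub>M subprob_algebra borel"
    by (rule measurable_compose[OF _ arrive_measurable[OF G]]) measurable
  show "(\<lambda>x. gap (fst (y (fst x))) \<bind> (\<lambda>e. return S (max 0 (a (fst x) + snd x - e), fst (y (fst x)))))
      \<in> M \<Otimes>\<^sub>M borel \<rightarrow>\<^sub>M subprob_algebra S"
    by (rule gap_kernel) measurable
qed

lemma step_measurable: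
  assumes G: "nonneg_dist G" shows "step D1 D2 G \<in> S \<rightarrow>\<^sub>M subprob_algebra S"
  unfolding step_eq
proof (rule measurable_bind[OF jump_measurable])
  show "(\<lambda>x. arrive G (snd (snd x)) \<bind> (\<lambda>s. gap (fst (snd x)) \<bind>
      (\<lambda>e. return S (max 0 (fst (fst x) + s - e), fst (snd x))))) \<in> S \<Otimes>\<^sub>M count_space J \<rightarrow>\<^sub>M subprob_algebra S"
    by (rule arrive_kernel[OF G]) measurable
qed

lemma integral_step:
  fixes f :: "real \<times> nat \<Rightarrow> complex"
  assumes G: "nonneg_dist G" and f[measurable]: "f \<in> borel_measurable S" and B: "\<And>x. norm (f x) \<le> B" and i: "i < N"
  shows "(\<integral>x. f x \<partial>step D1 D2 G (v,i)) = (\<Sum>j<N. \<Sum>b\<in>UNIV. complex_of_real (jw i j b) *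
    (\<integral>s. (\<integral>e. f (max 0 (v + s - e), j) \<partial>gap j) \<partial>arrive G b))"
proof -
  have "(\<integral>x. f x \<partial>step D1 D2 G (v,i)) = (\<integral>y. (\<integral>x. f x \<partial>(arrive G (snd y) \<bind> (\<lambda>s.
    gap (fst y) \<bind> (\<lambda>e. return S (max 0 (v + s - e), fst y))))) \<partial>jump D1 D2 i)"
    unfolding step_eq fst_conv snd_conv
  proof (rule integral_bind_bounded[OF f B _ prob_space_jump[OF i]])
    show "(\<lambda>y. arrive G (snd y) \<bind> (\<lambda>s. gap (fst y) \<bind> (\<lambda>e. return S (max 0 (v + s - e), fst y))))
      \<in> jump D1 D2 i \<rightarrow>\<^sub>M subprob_algebra S"
      unfolding measurable_cong_sets[OF sets_jump refl]
      by (rule arrive_kernel[OF G]) measurable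
  qed
  also have "\<dots> = (\<Sum>j<N. \<Sum>b\<in>UNIV. complex_of_real (jw i j b) *
      (\<integral>x. f x \<partial>(arrive G b \<bind> (\<lambda>s. gap j \<bind> (\<lambda>e. return S (max 0 (v + s - e), j))))))"
    by (simp add: integral_jump[OF i])
  also have "\<dots> = (\<Sum>j<N. \<Sum>b\<in>UNIV. complex_of_real (jw i j b) *
    (\<integral>s. (\<integral>e. f (max 0 (v + s - e), j) \<partial>gap j) \<partial>arrive G b))"
  proof (intro sum.cong refl arg_cong2[of _ _ _ _ "(*)"])
    fix j b assume "j \<in> {..<N}"
    then have j: "j < N" by simp
    have sA: "sets (arrive G b) = sets borel" and pA: "prob_space (arrive G b)"
      using arrive_nonneg[OF G, of b] by (auto simp: nonneg_dist_def)
    have "(\<integral>x. f x \<partial>(arrive G b \<bind> (\<lambda>s. gap j \<bind> (\<lambda>e. return S (max 0 (v + s - e), j)))))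
       = (\<integral>s. (\<integral>x. f x \<partial>(gap j \<bind> (\<lambda>e. return S (max 0 (v + s - e), j)))) \<partial>arrive G b)"
    proof (rule integral_bind_bounded[OF f B _ pA])
      show "(\<lambda>s. gap j \<bind> (\<lambda>e. return S (max 0 (v + s - e), j))) \<in> arrive G b \<rightarrow>\<^sub>M subprob_algebra S"
        unfolding measurable_cong_sets[OF sA refl]
        by (rule gap_kernel) (use j in auto)
    qed
    also have "\<dots> = (\<integral>s. (\<integral>e. f (max 0 (v + s - e), j) \<partial>gap j) \<partial>arrive G b)"
    proof (rule Bochner_Integration.integral_cong[OF refl])
      fix s
      have "(\<integral>x. f x \<partial>(gap j \<bind> (\<lambda>e. return S (max 0 (v + s - e), j))))
        = (\<integral>e. (\<integral>x. f x \<partial>return S (max 0 (v + s - e), j)) \<partial>gap j)"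
      proof (rule integral_bind_bounded[OF f B _ prob_space_gap[OF j]])
        show "(\<lambda>e. return S (max 0 (v + s - e), j)) \<in> gap j \<rightarrow>\<^sub>M subprob_algebra S"
          unfolding measurable_cong_sets[OF sets_gap refl]
          by (rule return_S_measurable) (use j in auto)
      qed
      also have "\<dots> = (\<integral>e. f (max 0 (v + s - e), j) \<partial>gap j)"
        using j by (intro Bochner_Integration.integral_cong refl integral_return f) (auto simp: space_pair_measure)
      finally show "(\<integral>x. f x \<partial>(gap j \<bind> (\<lambda>e. return S (max 0 (v + s - e), j))))
        = (\<integral>e. f (max 0 (v + s - e), j) \<partial>gap j)" .
    qed
    finally show "(\<integral>x. f x \<partial>(arrive G b \<bind> (\<lambda>s. gap j \<bind> (\<lambda>e. return S (max 0 (v + s - e), j)))))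
      = (\<integral>s. (\<integral>e. f (max 0 (v + s - e), j) \<partial>gap j) \<partial>arrive G b)" .
  qed
  finally show ?thesis .
qed

lemma steady_state_step_measurable:
  assumes "nonneg_dist G" "steady_state D1 D2 G L"
  shows "step D1 D2 G \<in> L \<rightarrow>\<^sub>M subprob_algebra S"
proof -
  have "sets L = sets S" using assms(2) unfolding steady_state_def dims by blast
  from measurable_cong_sets[OF this refl] show ?thesis using step_measurable[OF assms(1)] by blast
qed

text \<open>
  How stationarity is used: the mean of \<open>f\<close> equals the mean of its one-step average.  The average is requested only
  almost everywhere, as it has a closed form only on nonnegative workloads.
\<close>

lemma integral_steady_state:
  fixes f k :: "real \<times> nat \<Rightarrow> complex"
  assumes G: "nonneg_dist G" and L: "steady_state D1 D2 G L"
    and f[measurable]: "f \<in> borel_measurable S" and B: "\<And>x. norm (f x) \<le> B"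
    and k: "k \<in> borel_measurable S"
    and ae: "AE x in L. snd x < N \<longrightarrow> (\<Sum>j<N. \<Sum>b\<in>UNIV. complex_of_real (jw (snd x) j b) *
      (\<integral>s. (\<integral>e. f (max 0 (fst x + s - e), j) \<partial>gap j) \<partial>arrive G b)) = k x"
  shows "(\<integral>x. f x \<partial>L) = (\<integral>x. k x \<partial>L)"
proof -
  have pL: "prob_space L" and sL: "sets L = sets S" and eL: "L \<bind> step D1 D2 G = L"
    using L unfolding steady_state_def dims by blast+
  note sm = steady_state_step_measurable[OF G L]
  have "(\<integral>x. f x \<partial>L) = (\<integral>x. f x \<partial>(L \<bind> step D1 D2 G))" by (simp only: eL)
  also have "\<dots> = (\<integral>x. (\<integral>y. f y \<partial>step D1 D2 G x) \<partial>L)"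
    by (rule integral_bind_bounded[OF f B sm pL])
  also have "\<dots> = (\<integral>x. k x \<partial>L)"
  proof (rule integral_cong_AE)
    show "(\<lambda>x. \<integral>y. f y \<partial>step D1 D2 G x) \<in> borel_measurable L"
      by (rule measurable_compose[OF sm integral_measurable_subprob_algebra[OF f]])
    show "k \<in> borel_measurable L" unfolding measurable_cong_sets[OF sL refl] by (rule k)
    show "AE x in L. (\<integral>y. f y \<partial>step D1 D2 G x) = k x"
      using ae AE_space
    proof eventually_elim
      case (elim x)
      then have "x \<in> space S" by (simp only: sets_eq_imp_space_eq[OF sL])
      then have "snd x < N" by (auto simp: space_pair_measure)
      with elim integral_step[OF G f B this, of "fst x"] show ?case by (simp only: prod.collapse simp_thms)
    qed
  qed
  finally show ?thesis .
qed

end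

context map_arrivals begin

text \<open>A steady state is by definition a law on all of \<open>\<real>\<close>; it lives on \<open>[0, \<infinity>)\<close> because every step ends there.\<close>

lemma steady_state_nonneg:
  assumes G: "nonneg_dist G" and L: "steady_state D1 D2 G L"
  shows "AE x in L. 0 \<le> fst x"
proof -
  have pL: "prob_space L" and sL: "sets L = sets S"
    using L unfolding steady_state_def dims by blast+
  interpret L: prob_space L by (rule pL)
  let ?A = "{x \<in> space S. fst x < 0}"
  have A: "?A \<in> sets S" by measurable
  have AL: "?A \<in> sets L" using A unfolding sL .
  have "(\<integral>x. complex_of_real (indicator ?A x) \<partial>L) = (\<integral>x. 0 \<partial>L)"
  proof (rule integral_steady_state[OF G L, where B = 1])
    show "(\<lambda>x. complex_of_real (indicator ?A x)) \<in> borel_measurable S" using A by measurable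
    show "norm (complex_of_real (indicator ?A x)) \<le> 1" for x by (simp add: indicator_def)
  qed (simp_all add: indicator_def)
  then have "complex_of_real (\<integral>x. indicator ?A x \<partial>L) = 0" by (simp add: integral_complex_of_real)
  then have "L.prob ?A = 0" using AL by simp
  then have "AE x in L. x \<notin> ?A" using AL by (simp add: L.prob_eq_0)
  then show ?thesis using AE_space
  proof eventually_elim
    case (elim x)
    then have "x \<in> space S" by (simp only: sets_eq_imp_space_eq[OF sL])
    with elim show ?case by auto
  qed
qed

lemma steady_state_weighted_variable:
  assumes G: "nonneg_dist G" and L: "steady_state D1 D2 G L"
  shows "weighted_variable L fst (\<lambda>x. if snd x = i then 1 else 0)"
proof -
  have pL: "prob_space L" and sL: "sets L = sets S"
    using L unfolding steady_state_def dims by blast+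
  interpret L: prob_space L by (rule pL)
  show ?thesis
  proof unfold_locales
    show "fst \<in> borel_measurable L" unfolding measurable_cong_sets[OF sL refl] by measurable
    show "(\<lambda>x. if snd x = i then 1 else 0) \<in> borel_measurable L" unfolding measurable_cong_sets[OF sL refl] by measurable
  qed (use steady_state_nonneg[OF G L] in auto)
qed

lemma workload_lt_eq_transform:
  assumes "nonneg_dist G" "steady_state D1 D2 G L" "i < N"
  shows "workload_lt N L t $ i = weighted_variable.transform L fst (\<lambda>x. if snd x = i then 1 else 0) t"
  using assms(3)
  by (auto simp: workload_lt_def weighted_variable.transform_def[OF steady_state_weighted_variable[OF assms(1,2)]]
      split_def intro!: Bochner_Integration.integral_cong)

text \<open>The probability that an arrival is tagged \<open>j\<close> and finds the system empty: the preceding exponential time of rate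
  \<open>\<lambda>\<^sub>j\<close> exceeds a workload \<open>v\<close> with probability \<open>e\<^bsup>-\<lambda>\<^sub>j v\<^esup>\<close>.\<close>

definition empty_vec :: "real measure \<Rightarrow> (real \<times> nat) measure \<Rightarrow> nat \<Rightarrow> complex" where
  "empty_vec G L j = (\<Sum>i<N. workload_lt N L (complex_of_real (lam j)) $ i *
     (complex_of_real (jw i j False) + complex_of_real (jw i j True) * lst G (complex_of_real (lam j))))"

lemma lst_arrive: "lst (arrive G b) t = (if b then lst G t else 1)"
  by (simp add: arrive_def lst_return_0)

lemma integral_arrive_gap:
  assumes G: "nonneg_dist G" and j: "j < N" and t: "Re t \<ge> 0" "t \<noteq> complex_of_real (lam j)" and v: "v \<ge> 0"
  shows "(\<integral>s. (\<integral>e. exp (- t * complex_of_real (max 0 (v + s - e))) \<partial>gap j) \<partial>arrive G b)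
    = (complex_of_real (lam j) * exp (- t * complex_of_real v) * lst (arrive G b) t
       - t * exp (- complex_of_real (lam j) * complex_of_real v) * lst (arrive G b) (complex_of_real (lam j)))
      / (complex_of_real (lam j) - t)"
proof -
  let ?l = "complex_of_real (lam j)"
  have A: "nonneg_dist (arrive G b)" by (rule arrive_nonneg[OF G])
  have sA: "sets (arrive G b) = sets borel" and ae: "AE s in arrive G b. 0 \<le> s"
    using A by (simp_all add: nonneg_dist_def)
  have lj: "lam j > 0" by (rule rate_pos[OF j])
  interpret gap: prob_space "gap j" by (rule prob_space_gap[OF j])
  have sg [measurable_cong]: "sets (gap j) = sets borel" by (rule sets_gap)
  have m: "(\<lambda>s. \<integral>e. exp (- t * complex_of_real (max 0 (v + s - e))) \<partial>gap j) \<in> borel_measurable (arrive G b)"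
    unfolding measurable_cong_sets[OF sA refl]
    by (rule gap.borel_measurable_lebesgue_integral) measurable
  let ?k = "\<lambda>s. (?l * exp (- t * complex_of_real v) * exp (- t * complex_of_real s)
       - t * exp (- ?l * complex_of_real v) * exp (- ?l * complex_of_real s)) / (?l - t)"
  have "(\<integral>s. (\<integral>e. exp (- t * complex_of_real (max 0 (v + s - e))) \<partial>gap j) \<partial>arrive G b) = (\<integral>s. ?k s \<partial>arrive G b)"
  proof (rule integral_cong_AE[OF m])
    show "?k \<in> borel_measurable (arrive G b)"
      unfolding measurable_cong_sets[OF sA refl] by measurable
    show "AE s in arrive G b. (\<integral>e. exp (- t * complex_of_real (max 0 (v + s - e))) \<partial>gap j) = ?k s"
      using ae
    proof eventually_elim
      case (elim s)
      have "v + s \<ge> 0" using elim v by simp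
      from integral_exponential_truncated[OF lj this t(1)]
      have "(?l - t) * (\<integral>e. exp (- t * complex_of_real (max 0 (v + s - e))) \<partial>gap j)
          = ?l * exp (- t * complex_of_real (v + s)) - t * exp (- ?l * complex_of_real (v + s))"
        by (simp only: gap_def)
      also have "\<dots> = (?l - t) * ?k s"
      proof -
        have e: "exp (- z * complex_of_real (v + s)) = exp (- z * complex_of_real v) * exp (- z * complex_of_real s)" for z
          by (simp add: algebra_simps flip: exp_add)
        show ?thesis unfolding e using t(2) by simp
      qed
      finally have "(?l - t) * (\<integral>e. exp (- t * complex_of_real (max 0 (v + s - e))) \<partial>gap j) = (?l - t) * ?k s" .
      then show ?case using t(2) by (simp only: mult_cancel_left) auto
    qed
  qed
  also have "\<dots> = (?l * exp (- t * complex_of_real v) * lst (arrive G b) t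
       - t * exp (- ?l * complex_of_real v) * lst (arrive G b) ?l) / (?l - t)"
    using nonneg_dist_integrable_exp[OF A t(1)] nonneg_dist_integrable_exp[OF A, of ?l] lj
    by (simp add: lst_def)
  finally show ?thesis .
qed

text \<open>
  Integrating \<open>e\<^bsup>-tV\<^esup>\<close> on the event of tag \<open>j\<close> over one step.  At \<open>t = \<lambda>\<^sub>j\<close> the equation is the definition of the
  probability of an empty system.
\<close>

lemma stationary_equation_kernel:
  assumes G: "nonneg_dist G" and L: "steady_state D1 D2 G L" and j: "j < N" and t: "Re t \<ge> 0"
  shows "(complex_of_real (lam j) - t) * workload_lt N L t $ j
    = complex_of_real (lam j) * (\<Sum>i<N. workload_lt N L t $ i *
        (complex_of_real (jw i j False) + complex_of_real (jw i j True) * lst G t)) - t * empty_vec G L j"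
proof (cases "t = complex_of_real (lam j)")
  case True then show ?thesis by (simp add: empty_vec_def)
next
  case t': False
  let ?l = "complex_of_real (lam j)"
  let ?f = "\<lambda>x::real \<times> nat. if snd x = j then exp (- t * complex_of_real (max 0 (fst x))) else 0"
  let ?w = "\<lambda>i (x::real \<times> nat). if snd x = i then 1 else (0::real)"
  define c where "c i z = complex_of_real (jw i j False) + complex_of_real (jw i j True) * lst G z" for i z
  let ?k = "\<lambda>x. (\<Sum>i<N. (?l * c i t * (complex_of_real (?w i x) * exp (- t * complex_of_real (fst x)))
      - t * c i ?l * (complex_of_real (?w i x) * exp (- ?l * complex_of_real (fst x)))) / (?l - t))"
  note W = steady_state_weighted_variable[OF G L]
  note phi = workload_lt_eq_transform[OF G L] weighted_variable.transform_def[OF W]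
  have lj: "lam j > 0" by (rule rate_pos[OF j])
  have sL: "sets L = sets S" using L unfolding steady_state_def dims by blast
  have fm: "?f \<in> borel_measurable S" by measurable
  have km: "?k \<in> borel_measurable S" by measurable
  have "workload_lt N L t $ j = (\<integral>x. ?f x \<partial>L)"
    unfolding phi(1)[OF j] phi(2)
  proof (rule integral_cong_AE)
    show "(\<lambda>x. complex_of_real (?w j x) * exp (- t * complex_of_real (fst x))) \<in> borel_measurable L"
      unfolding measurable_cong_sets[OF sL refl] by measurable
    show "?f \<in> borel_measurable L" unfolding measurable_cong_sets[OF sL refl] by (rule fm)
    show "AE x in L. complex_of_real (?w j x) * exp (- t * complex_of_real (fst x)) = ?f x"
      using steady_state_nonneg[OF G L] by eventually_elim auto
  qed
  also have "\<dots> = (\<integral>x. ?k x \<partial>L)"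
  proof (rule integral_steady_state[OF G L fm _ km])
    show "norm (?f x) \<le> 1" for x using t by (auto simp: max_def mult_nonneg_nonneg)
    show "AE x in L. snd x < N \<longrightarrow> (\<Sum>j'<N. \<Sum>b\<in>UNIV. complex_of_real (jw (snd x) j' b) *
      (\<integral>s. (\<integral>e. ?f (max 0 (fst x + s - e), j') \<partial>gap j') \<partial>arrive G b)) = ?k x"
      using steady_state_nonneg[OF G L]
    proof (eventually_elim, intro impI)
      fix x :: "real \<times> nat" assume x: "0 \<le> fst x" "snd x < N"
      have "(\<Sum>j'<N. \<Sum>b\<in>UNIV. complex_of_real (jw (snd x) j' b) *
          (\<integral>s. (\<integral>e. ?f (max 0 (fst x + s - e), j') \<partial>gap j') \<partial>arrive G b))
        = (\<Sum>j'<N. if j' = j then (\<Sum>b\<in>UNIV. complex_of_real (jw (snd x) j b) *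
          (\<integral>s. (\<integral>e. exp (- t * complex_of_real (max 0 (fst x + s - e))) \<partial>gap j) \<partial>arrive G b)) else 0)"
        by (intro sum.cong refl) auto
      also have "\<dots> = (\<Sum>b\<in>UNIV. complex_of_real (jw (snd x) j b) *
          (\<integral>s. (\<integral>e. exp (- t * complex_of_real (max 0 (fst x + s - e))) \<partial>gap j) \<partial>arrive G b))"
        using j by simp
      also have "\<dots> = (?l * c (snd x) t * exp (- t * complex_of_real (fst x))
          - t * c (snd x) ?l * exp (- ?l * complex_of_real (fst x))) / (?l - t)"
        unfolding integral_arrive_gap[OF G j t t' x(1)] lst_arrive
        by (simp add: UNIV_bool c_def flip: add_divide_distrib) (simp add: algebra_simps)
      also have "\<dots> = ?k x"
        using x(2) by (subst sum.remove[of _ "snd x"]) (auto intro!: sum.neutral)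
      finally show "(\<Sum>j'<N. \<Sum>b\<in>UNIV. complex_of_real (jw (snd x) j' b) *
          (\<integral>s. (\<integral>e. ?f (max 0 (fst x + s - e), j') \<partial>gap j') \<partial>arrive G b)) = ?k x" .
    qed
  qed
  also have "\<dots> = (\<Sum>i<N. (?l * c i t * workload_lt N L t $ i - t * c i ?l * workload_lt N L ?l $ i) / (?l - t))"
  proof -
    have int: "integrable L (\<lambda>x. complex_of_real (?w i x) * exp (- z * complex_of_real (fst x)))" if "Re z \<ge> 0" for i z
      by (rule weighted_variable.integrable_kernel[OF W that])
    have il: "Re ?l \<ge> 0" using lj by simp
    have "(\<integral>x. ?k x \<partial>L) = (\<Sum>i<N. (\<integral>x. (?l * c i t * (complex_of_real (?w i x) * exp (- t * complex_of_real (fst x)))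
      - t * c i ?l * (complex_of_real (?w i x) * exp (- ?l * complex_of_real (fst x)))) / (?l - t) \<partial>L))"
      by (rule Bochner_Integration.integral_sum)
         (intro integrable_divide Bochner_Integration.integrable_diff integrable_mult_right int t il)
    also have "\<dots> = (\<Sum>i<N. (?l * c i t * workload_lt N L t $ i - t * c i ?l * workload_lt N L ?l $ i) / (?l - t))"
    proof (intro sum.cong refl)
      fix i assume "i \<in> {..<N}"
      then have i: "i < N" by simp
      show "(\<integral>x. (?l * c i t * (complex_of_real (?w i x) * exp (- t * complex_of_real (fst x)))
        - t * c i ?l * (complex_of_real (?w i x) * exp (- ?l * complex_of_real (fst x)))) / (?l - t) \<partial>L)
        = (?l * c i t * workload_lt N L t $ i - t * c i ?l * workload_lt N L ?l $ i) / (?l - t)"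
        unfolding phi(1)[OF i] phi(2)
        by (simp only: integral_divide_zero Bochner_Integration.integral_diff[OF integrable_mult_right[OF int[OF t]] integrable_mult_right[OF int[OF il]]]
            integral_mult_right_zero)
    qed
    finally show ?thesis .
  qed
  also have "\<dots> = (?l * (\<Sum>i<N. workload_lt N L t $ i * c i t) - t * empty_vec G L j) / (?l - t)"
    by (simp add: empty_vec_def c_def sum_subtractf sum_distrib_left mult_ac flip: sum_divide_distrib)
  finally show ?thesis using t' by (simp add: c_def)
qed

end

section \<open>Uniqueness of stationary vectors\<close>

locale stochastic_matrix =
  fixes N :: nat and P :: "real mat"
  assumes P_carrier [simp]: "P \<in> carrier_mat N N"
    and P_nonneg: "\<And>i j. i < N \<Longrightarrow> j < N \<Longrightarrow> 0 \<le> P $$ (i,j)"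
    and P_rows: "\<And>i. i < N \<Longrightarrow> (\<Sum>j<N. P $$ (i,j)) = 1"
    and irred: "irreducible_mat P"
begin

lemma dims_P [simp]: "dim_row P = N" "dim_col P = N"
  using carrier_matD[OF P_carrier] by blast+

lemma pow_carrier [simp]: "P ^\<^sub>m n \<in> carrier_mat N N" by (simp add: pow_carrier_mat)

lemma mat_mult_index:
  assumes "A \<in> carrier_mat N N" "B \<in> carrier_mat N N" "i < N" "j < N"
  shows "(A * B) $$ (i,j) = (\<Sum>k<N. A $$ (i,k) * B $$ (k,j) :: 'a :: comm_ring_1)"
  using assms by (auto simp: scalar_prod_def lessThan_atLeast0 intro!: sum.cong)

lemma pow_nonneg: "i < N \<Longrightarrow> j < N \<Longrightarrow> 0 \<le> (P ^\<^sub>m n) $$ (i,j)"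
proof (induction n arbitrary: i j)
  case 0 then show ?case using P_carrier by (auto simp: one_mat_def)
next
  case (Suc n)
  have "(P ^\<^sub>m Suc n) $$ (i,j) = (\<Sum>k<N. (P ^\<^sub>m n) $$ (i,k) * P $$ (k,j))"
    by (simp add: mat_mult_index[OF pow_carrier P_carrier Suc.prems])
  then show ?case using Suc by (auto intro!: sum_nonneg mult_nonneg_nonneg P_nonneg)
qed

lemma left_pow:
  assumes v: "\<And>j. j < N \<Longrightarrow> (\<Sum>i<N. v i * P $$ (i,j)) = v j"
  shows "j < N \<Longrightarrow> (\<Sum>i<N. v i * (P ^\<^sub>m n) $$ (i,j)) = v j"
proof (induction n arbitrary: j)
  case 0
  have "(\<Sum>i<N. v i * (P ^\<^sub>m 0) $$ (i,j)) = (\<Sum>i<N. if i = j then v i else 0)"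
    using 0 P_carrier by (intro sum.cong) auto
  then show ?case using 0 by simp
next
  case (Suc n)
  have m: "(P ^\<^sub>m Suc n) $$ (i,j) = (\<Sum>k<N. (P ^\<^sub>m n) $$ (i,k) * P $$ (k,j))" if "i < N" for i
    using mat_mult_index[OF pow_carrier P_carrier that Suc.prems] by (simp only: pow_mat.simps)
  have "(\<Sum>i<N. v i * (P ^\<^sub>m Suc n) $$ (i,j)) = (\<Sum>i<N. \<Sum>k<N. v i * (P ^\<^sub>m n) $$ (i,k) * P $$ (k,j))"
    by (intro sum.cong refl) (simp only: lessThan_iff m sum_distrib_left mult.assoc)
  also have "\<dots> = (\<Sum>k<N. (\<Sum>i<N. v i * (P ^\<^sub>m n) $$ (i,k)) * P $$ (k,j))"
    by (subst sum.swap) (simp add: sum_distrib_right)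
  also have "\<dots> = (\<Sum>k<N. v k * P $$ (k,j))" by (intro sum.cong refl) (simp add: Suc.IH)
  finally show ?case using v[OF Suc.prems] by simp
qed

lemma right_pow:
  assumes g: "\<And>i. i < N \<Longrightarrow> (\<Sum>j<N. P $$ (i,j) * g j) = g i"
  shows "i < N \<Longrightarrow> (\<Sum>j<N. (P ^\<^sub>m n) $$ (i,j) * g j) = g i"
proof (induction n arbitrary: i)
  case 0
  have "(\<Sum>j<N. (P ^\<^sub>m 0) $$ (i,j) * g j) = (\<Sum>j<N. if j = i then g j else 0)"
    using 0 P_carrier by (intro sum.cong) auto
  then show ?case using 0 by simp
next
  case (Suc n)
  have m: "(P ^\<^sub>m Suc n) $$ (i,j) = (\<Sum>k<N. (P ^\<^sub>m n) $$ (i,k) * P $$ (k,j))" if "j < N" for j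
    using mat_mult_index[OF pow_carrier P_carrier Suc.prems that] by (simp only: pow_mat.simps)
  have "(\<Sum>j<N. (P ^\<^sub>m Suc n) $$ (i,j) * g j) = (\<Sum>j<N. \<Sum>k<N. (P ^\<^sub>m n) $$ (i,k) * (P $$ (k,j) * g j))"
    by (intro sum.cong refl) (simp only: lessThan_iff m sum_distrib_right mult.assoc)
  also have "\<dots> = (\<Sum>k<N. (P ^\<^sub>m n) $$ (i,k) * (\<Sum>j<N. P $$ (k,j) * g j))"
    by (subst sum.swap) (simp add: sum_distrib_left)
  also have "\<dots> = (\<Sum>k<N. (P ^\<^sub>m n) $$ (i,k) * g k)" by (intro sum.cong refl) (simp add: g)
  finally show ?case using Suc by simp
qed

lemma irredE: assumes "i < N" "j < N" obtains n where "(P ^\<^sub>m n) $$ (i,j) > 0"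
  using irred assms P_carrier unfolding irreducible_mat_def by fastforce

text \<open>Some power of \<open>P\<close> leads from \<open>i\<close> to \<open>k\<close> with positive probability, so mass at \<open>i\<close> would produce mass at \<open>k\<close>.\<close>

lemma left_nonneg_zero:
  assumes v: "\<And>j. j < N \<Longrightarrow> (\<Sum>i<N. v i * P $$ (i,j)) = v j"
    and nn: "\<And>i. i < N \<Longrightarrow> 0 \<le> v i" and k: "k < N" "v k = 0" and i: "i < N"
  shows "v i = 0"
proof -
  obtain n where n: "(P ^\<^sub>m n) $$ (i,k) > 0" using irredE i k by blast
  have "(\<Sum>i<N. v i * (P ^\<^sub>m n) $$ (i,k)) = 0" using left_pow[OF v k(1)] k by simp
  then have "v i * (P ^\<^sub>m n) $$ (i,k) = 0"
    by (subst (asm) sum_nonneg_eq_0_iff) (use nn pow_nonneg k i in auto)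
  then show ?thesis using n by simp
qed

text \<open>
  The maximum principle: at a maximum \<open>k\<close>, an average over states reached from \<open>k\<close> can attain the maximum only if
  all of them do.
\<close>

lemma right_const:
  assumes g: "\<And>i. i < N \<Longrightarrow> (\<Sum>j<N. P $$ (i,j) * g j) = g i" and N: "N > 0"
  shows "\<exists>c. \<forall>i<N. g i = c"
proof -
  define c where "c = Max (g ` {..<N})"
  have "c \<in> g ` {..<N}" unfolding c_def using N by (intro Max_in) auto
  then obtain k where k: "k < N" "g k = c" by auto
  have le: "g i \<le> c" if "i < N" for i unfolding c_def using that by (intro Max_ge) auto
  have "g i = c" if i: "i < N" for i
  proof -
    obtain n where n: "(P ^\<^sub>m n) $$ (k,i) > 0" using irredE i k by blast
    have "(\<Sum>j<N. (P ^\<^sub>m n) $$ (k,j) * g j) = c" using right_pow[OF g k(1)] k by simp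
    moreover have "(\<Sum>j<N. (P ^\<^sub>m n) $$ (k,j) * 1) = 1"
      by (rule right_pow) (use P_rows k in auto)
    ultimately have "(\<Sum>j<N. (P ^\<^sub>m n) $$ (k,j) * (c - g j)) = 0"
      by (simp add: right_diff_distrib sum_subtractf flip: sum_distrib_right)
    then have "(P ^\<^sub>m n) $$ (k,i) * (c - g i) = 0"
      by (subst (asm) sum_nonneg_eq_0_iff) (use le pow_nonneg k i in auto)
    then show ?thesis using n by simp
  qed
  then show ?thesis by blast
qed

context
  fixes \<pi> :: "nat \<Rightarrow> real"
  assumes pi: "\<And>j. j < N \<Longrightarrow> (\<Sum>i<N. \<pi> i * P $$ (i,j)) = \<pi> j"
    and pi_nn: "\<And>i. i < N \<Longrightarrow> 0 \<le> \<pi> i" and pi_sum: "(\<Sum>i<N. \<pi> i) = 1"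
begin

lemma stationary_pos: assumes "i < N" shows "\<pi> i > 0"
proof (rule ccontr)
  assume "\<not> \<pi> i > 0"
  then have "\<pi> i = 0" using pi_nn[OF assms] by simp
  then have "\<pi> k = 0" if "k < N" for k using left_nonneg_zero[OF pi pi_nn assms _ that] by simp
  then show False using pi_sum by simp
qed

text \<open>
  Subtract the largest multiple of \<open>\<pi>\<close> that stays below \<open>v\<close>; the difference is nonnegative, invariant, and vanishes
  somewhere.
\<close>

lemma left_multiple:
  assumes v: "\<And>j. j < N \<Longrightarrow> (\<Sum>i<N. v i * P $$ (i,j)) = v j"
  shows "\<exists>c. \<forall>i<N. v i = c * \<pi> i"
proof -
  have N: "N > 0" using pi_sum by (cases N) auto
  define c where "c = Min ((\<lambda>i. v i / \<pi> i) ` {..<N})"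
  have "c \<in> (\<lambda>i. v i / \<pi> i) ` {..<N}" unfolding c_def using N by (intro Min_in) auto
  then obtain k where "k < N" "c = v k / \<pi> k" by auto
  then have k: "k < N" "v k = c * \<pi> k" using stationary_pos[of k] by auto
  have le: "c * \<pi> i \<le> v i" if "i < N" for i
  proof -
    have "c \<le> v i / \<pi> i" unfolding c_def using that by (intro Min_le) auto
    then show ?thesis using stationary_pos[OF that] by (simp add: pos_le_divide_eq)
  qed
  have "v i - c * \<pi> i = 0" if i: "i < N" for i
  proof (rule left_nonneg_zero[of "\<lambda>i. v i - c * \<pi> i" k])
    fix j assume j: "j < N"
    have "(\<Sum>i<N. (v i - c * \<pi> i) * P $$ (i,j)) = (\<Sum>i<N. v i * P $$ (i,j)) - c * (\<Sum>i<N. \<pi> i * P $$ (i,j))"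
      by (simp add: left_diff_distrib sum_subtractf sum_distrib_left mult.assoc)
    then show "(\<Sum>i<N. (v i - c * \<pi> i) * P $$ (i,j)) = v j - c * \<pi> j" using v[OF j] pi[OF j] by simp
  qed (use k le i in auto)
  then show ?thesis by auto
qed

lemma left_multiple_complex:
  assumes v: "\<And>j. j < N \<Longrightarrow> (\<Sum>i<N. v i * complex_of_real (P $$ (i,j))) = v j"
  shows "\<exists>c. \<forall>i<N. v i = c * complex_of_real (\<pi> i)"
proof -
  have "\<exists>c. \<forall>i<N. Re (v i) = c * \<pi> i"
  proof (rule left_multiple)
    fix j assume "j < N" from arg_cong[OF v[OF this], of Re]
    show "(\<Sum>i<N. Re (v i) * P $$ (i,j)) = Re (v j)" by simp
  qed
  then obtain a where a: "\<forall>i<N. Re (v i) = a * \<pi> i" by blast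
  have "\<exists>c. \<forall>i<N. Im (v i) = c * \<pi> i"
  proof (rule left_multiple)
    fix j assume "j < N" from arg_cong[OF v[OF this], of Im]
    show "(\<Sum>i<N. Im (v i) * P $$ (i,j)) = Im (v j)" by simp
  qed
  then obtain b where b: "\<forall>i<N. Im (v i) = b * \<pi> i" by blast
  show ?thesis by (rule exI[of _ "Complex a b"]) (use a b in \<open>auto simp: complex_eq_iff\<close>)
qed

end

lemma right_const_complex:
  assumes g: "\<And>i. i < N \<Longrightarrow> (\<Sum>j<N. complex_of_real (P $$ (i,j)) * g j) = g i" and N: "N > 0"
  shows "\<exists>c. \<forall>i<N. g i = c"
proof -
  have "\<exists>c. \<forall>i<N. Re (g i) = c"
  proof (rule right_const[OF _ N])
    fix i assume "i < N" from arg_cong[OF g[OF this], of Re]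
    show "(\<Sum>j<N. P $$ (i,j) * Re (g j)) = Re (g i)" by simp
  qed
  then obtain a where a: "\<forall>i<N. Re (g i) = a" by blast
  have "\<exists>c. \<forall>i<N. Im (g i) = c"
  proof (rule right_const[OF _ N])
    fix i assume "i < N" from arg_cong[OF g[OF this], of Im]
    show "(\<Sum>j<N. P $$ (i,j) * Im (g j)) = Im (g i)" by simp
  qed
  then obtain b where b: "\<forall>i<N. Im (g i) = b" by blast
  show ?thesis by (rule exI[of _ "Complex a b"]) (use a b in \<open>auto simp: complex_eq_iff\<close>)
qed

end

section \<open>The vector of transforms\<close>

locale irreducible_arrivals = map_arrivals +
  fixes \<pi> :: "real vec"
  assumes P_irred: "irreducible_mat (trans_mat D1 D2)"
    and stat: "stationary_vec (trans_mat D1 D2) \<pi>"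
begin

sublocale stochastic_matrix N "trans_mat D1 D2"
  by unfold_locales (use jw_nonneg jw_sum P_irred in \<open>auto simp: trans_mat_jw\<close>)

lemma pi_props:
  "j < N \<Longrightarrow> (\<Sum>i<N. \<pi> $ i * trans_mat D1 D2 $$ (i,j)) = \<pi> $ j"
  "i < N \<Longrightarrow> 0 \<le> \<pi> $ i" "(\<Sum>i<N. \<pi> $ i) = 1" "dim_vec \<pi> = N"
proof -
  have c: "\<pi> \<in> carrier_vec N" and e: "transpose_mat (trans_mat D1 D2) *\<^sub>v \<pi> = \<pi>"
    and "\<forall>i<N. 0 \<le> \<pi> $ i" "(\<Sum>i<N. \<pi> $ i) = 1"
    using stat by (auto simp: stationary_vec_def)
  then show "i < N \<Longrightarrow> 0 \<le> \<pi> $ i" "(\<Sum>i<N. \<pi> $ i) = 1" "dim_vec \<pi> = N" by auto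
  show "(\<Sum>i<N. \<pi> $ i * trans_mat D1 D2 $$ (i,j)) = \<pi> $ j" if j: "j < N"
  proof -
    have "(transpose_mat (trans_mat D1 D2) *\<^sub>v \<pi>) $ j = (\<Sum>i<N. \<pi> $ i * trans_mat D1 D2 $$ (i,j))"
      using j c by (auto simp: scalar_prod_def lessThan_atLeast0 mult.commute intro!: sum.cong)
    then show ?thesis unfolding e by simp
  qed
qed

lemma pi_pos: "i < N \<Longrightarrow> \<pi> $ i > 0"
  by (rule stationary_pos[of "\<lambda>i. \<pi> $ i"]) (auto simp: pi_props)

lemma left_multiple_pi:
  assumes "\<And>j. j < N \<Longrightarrow> (\<Sum>i<N. v i * complex_of_real (trans_mat D1 D2 $$ (i,j))) = v j"
  shows "\<exists>c. \<forall>i<N. v i = c * complex_of_real (\<pi> $ i)"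
  by (rule left_multiple_complex[of "\<lambda>i. \<pi> $ i"]) (use assms in \<open>auto simp: pi_props\<close>)

abbreviation cw :: "nat \<Rightarrow> nat \<Rightarrow> bool \<Rightarrow> complex" where "cw i j b \<equiv> complex_of_real (jw i j b)"
abbreviation clam :: "nat \<Rightarrow> complex" where "clam j \<equiv> complex_of_real (lam j)"

text \<open>The normalisation of \<open>q\<close> by \<open>p\<^sub>i\<^sub>j\<close> cancels in the Hadamard product; all later computations use this form.\<close>

lemma E_mat_index:
  assumes "i < N" "j < N"
  shows "E_mat D1 D2 f t $$ (i,j) = clam j * (cw i j False + f * cw i j True) + (if i = j then t - clam j else 0)"
proof -
  have PL: "(trans_mat D1 D2 * Lam D1 D2) $$ (i,j) = trans_mat D1 D2 $$ (i,j) * lam j"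
    using assms by (subst mat_mult_index) (auto simp: Lam_def mat_diag_def if_distrib[of "(*) _"] cong: if_cong)
  have "E_mat D1 D2 f t $$ (i,j) = (complex_of_real (Q1 D1 D2 $$ (i,j)) + f * complex_of_real (Q2 D1 D2 $$ (i,j)))
      * complex_of_real (trans_mat D1 D2 $$ (i,j) * lam j) + (if i = j then t - clam j else 0)"
    using assms by (auto simp: E_mat_def hadamard_def Lam_def mat_diag_def Q1_def Q2_def PL[unfolded Lam_def mat_diag_def dims])
  also have "\<dots> = clam j * (complex_of_real (trans_mat D1 D2 $$ (i,j) * Q1 D1 D2 $$ (i,j)) +
      f * complex_of_real (trans_mat D1 D2 $$ (i,j) * Q2 D1 D2 $$ (i,j))) + (if i = j then t - clam j else 0)"
    by (simp add: algebra_simps)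
  finally show ?thesis by (simp only: trans_mat_Q[OF assms])
qed

lemma E_mat_carrier [simp]: "E_mat D1 D2 f t \<in> carrier_mat N N"
  by (intro carrier_matI) (auto simp: E_mat_def hadamard_def Lam_def Q1_def Q2_def mat_diag_def)

lemma R_mat_index:
  assumes "i < N" "j < N" shows "R_mat D1 D2 $$ (i,j) = clam j * cw i j True"
proof -
  have PL: "(trans_mat D1 D2 * Lam D1 D2) $$ (i,j) = trans_mat D1 D2 $$ (i,j) * lam j"
    using assms by (subst mat_mult_index) (auto simp: Lam_def mat_diag_def if_distrib[of "(*) _"] cong: if_cong)
  have "R_mat D1 D2 $$ (i,j) = complex_of_real (Q2 D1 D2 $$ (i,j) * (trans_mat D1 D2 $$ (i,j) * lam j))"
    using assms by (auto simp: R_mat_def hadamard_def Q2_def PL)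
  also have "\<dots> = clam j * complex_of_real (trans_mat D1 D2 $$ (i,j) * Q2 D1 D2 $$ (i,j))" by (simp add: mult_ac)
  finally show ?thesis by (simp only: trans_mat_Q[OF assms])
qed

lemma R_mat_carrier [simp]: "R_mat D1 D2 \<in> carrier_mat N N"
  by (simp add: R_mat_def hadamard_def Q2_def)

lemma P2_index:
  assumes "i < N" "j < N" shows "hadamard (Q2 D1 D2) (trans_mat D1 D2) $$ (i,j) = jw i j True"
  using assms trans_mat_Q(1)[OF assms] by (simp add: hadamard_def Q2_def mult.commute)

lemma drift_eq:
  "drift D1 D2 \<pi> (c \<cdot>\<^sub>m hadamard (Q2 D1 D2) (trans_mat D1 D2))
    = (\<Sum>i<N. \<pi> $ i / lam i) - c * (\<Sum>i<N. \<Sum>j<N. \<pi> $ i * jw i j True)"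
proof -
  let ?H = "hadamard (Q2 D1 D2) (trans_mat D1 D2)"
  have H: "?H \<in> carrier_mat N N" by (simp add: hadamard_def Q2_def)
  have "drift D1 D2 \<pi> (c \<cdot>\<^sub>m ?H) = (\<Sum>i<N. \<pi> $ i * (\<Sum>j<N. (if i = j then 1 / lam i else 0) - c * jw i j True))"
    unfolding drift_def scalar_prod_def
    using H by (auto simp: ones_def Lam_inv_def mat_diag_def scalar_prod_def lessThan_atLeast0 P2_index intro!: sum.cong)
  also have "\<dots> = (\<Sum>i<N. \<pi> $ i / lam i - c * (\<Sum>j<N. \<pi> $ i * jw i j True))"
    by (intro sum.cong refl) (auto simp: sum_subtractf right_diff_distrib sum_distrib_left mult_ac)
  finally show ?thesis by (simp add: sum_subtractf sum_distrib_left)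
qed

lemma P2_ones: "\<pi> \<bullet> (hadamard (Q2 D1 D2) (trans_mat D1 D2) *\<^sub>v ones N) = (\<Sum>i<N. \<Sum>j<N. \<pi> $ i * jw i j True)"
proof -
  let ?H = "hadamard (Q2 D1 D2) (trans_mat D1 D2)"
  have H: "?H \<in> carrier_mat N N" by (simp add: hadamard_def Q2_def)
  then show ?thesis
    by (auto simp: scalar_prod_def ones_def lessThan_atLeast0 P2_index sum_distrib_left intro!: sum.cong)
qed

context
  fixes G :: "real measure" and L :: "(real \<times> nat) measure"
  assumes G: "nonneg_dist G" and L: "steady_state D1 D2 G L"
begin

abbreviation \<phi> :: "complex \<Rightarrow> nat \<Rightarrow> complex" where "\<phi> t i \<equiv> workload_lt N L t $ i"

text \<open>
  The equation \<open>\<Phi> E = t u\<close> that replaces the queue by linear algebra.  It holds for every service time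
  distribution, in particular for the mixture.
\<close>

lemma stationary_equation:
  assumes j: "j < N" and t: "Re t \<ge> 0"
  shows "(\<Sum>i<N. \<phi> t i * E_mat D1 D2 (lst G t) t $$ (i,j)) = t * empty_vec G L j"
proof -
  have "(\<Sum>i<N. \<phi> t i * E_mat D1 D2 (lst G t) t $$ (i,j))
     = (\<Sum>i<N. clam j * (\<phi> t i * (cw i j False + cw i j True * lst G t)) + (if i = j then \<phi> t i * (t - clam j) else 0))"
    using j by (intro sum.cong refl) (simp add: E_mat_index algebra_simps)
  also have "\<dots> = clam j * (\<Sum>i<N. \<phi> t i * (cw i j False + cw i j True * lst G t)) + \<phi> t j * (t - clam j)"
    using j by (simp add: sum.distrib sum_distrib_left)
  also have "\<dots> = t * empty_vec G L j"
    using stationary_equation_kernel[OF G L j t] by (simp add: algebra_simps)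
  finally show ?thesis .
qed

text \<open>At \<open>t = 0\<close> the stationary equation says that the law of the tag is invariant under \<open>P\<close>.\<close>

lemma phi_0: assumes "i < N" shows "\<phi> 0 i = complex_of_real (\<pi> $ i)"
proof -
  have pL: "prob_space L" and sL: "sets L = sets S"
    using L unfolding steady_state_def dims by blast+
  interpret L: prob_space L by (rule pL)
  have "\<exists>c. \<forall>i<N. \<phi> 0 i = c * complex_of_real (\<pi> $ i)"
  proof (rule left_multiple_pi)
    fix j assume j: "j < N"
    have lst: "lst G 0 = 1" using G by (simp add: lst_def nonneg_dist_def prob_space.prob_space)
    have "(\<Sum>i<N. \<phi> 0 i * (clam j * (cw i j False + cw i j True) + (if i = j then 0 - clam j else 0))) = 0"
      using stationary_equation[OF j, of 0] j by (simp add: E_mat_index lst)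
    moreover have "(\<Sum>i<N. \<phi> 0 i * (clam j * (cw i j False + cw i j True) + (if i = j then 0 - clam j else 0)))
       = (\<Sum>i<N. clam j * (\<phi> 0 i * complex_of_real (trans_mat D1 D2 $$ (i,j))) + (if i = j then - clam j * \<phi> 0 i else 0))"
      using j by (intro sum.cong refl) (auto simp: trans_mat_jw algebra_simps)
    ultimately have "clam j * (\<Sum>i<N. \<phi> 0 i * complex_of_real (trans_mat D1 D2 $$ (i,j))) = clam j * \<phi> 0 j"
      using j by (simp add: sum.distrib flip: sum_distrib_left)
    then show "(\<Sum>i<N. \<phi> 0 i * complex_of_real (trans_mat D1 D2 $$ (i,j))) = \<phi> 0 j"
      using rate_pos[OF j] by simp
  qed
  then obtain c where c: "\<forall>i<N. \<phi> 0 i = c * complex_of_real (\<pi> $ i)" by blast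
  note W = steady_state_weighted_variable[OF G L]
  have "(\<Sum>i<N. \<phi> 0 i) = (\<Sum>i<N. complex_of_real (\<integral>x. (if snd x = i then 1 else 0) \<partial>L))"
    by (intro sum.cong refl) (simp add: workload_lt_eq_transform[OF G L] weighted_variable.transform_0[OF W])
  also have "\<dots> = complex_of_real (\<integral>x. (\<Sum>i<N. if snd x = i then 1 else 0) \<partial>L)"
    by (subst Bochner_Integration.integral_sum) (use weighted_variable.integrable_g[OF W] in auto)
  also have "(\<integral>x. (\<Sum>i<N. if snd x = i then 1 else (0::real)) \<partial>L) = (\<integral>x. 1 \<partial>L)"
  proof (rule Bochner_Integration.integral_cong[OF refl])
    fix x assume "x \<in> space L"
    then have "x \<in> space S" by (simp only: sets_eq_imp_space_eq[OF sL])
    then show "(\<Sum>i<N. if snd x = i then 1 else (0::real)) = 1" by (auto simp: space_pair_measure)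
  qed
  also have "\<dots> = 1" using L.prob_space by simp
  finally have "(\<Sum>i<N. c * complex_of_real (\<pi> $ i)) = 1" using c by simp
  then have "c * complex_of_real (\<Sum>i<N. \<pi> $ i) = 1" by (simp add: sum_distrib_left)
  then have "c = 1" by (simp add: pi_props)
  then show ?thesis using c assms by simp
qed

lemma norm_phi_le: "i < N \<Longrightarrow> Re t \<ge> 0 \<Longrightarrow> norm (\<phi> t i) \<le> 1"
proof -
  assume i: "i < N" and t: "Re t \<ge> 0"
  note W = steady_state_weighted_variable[OF G L]
  have "norm (\<phi> t i) \<le> (\<integral>x. (if snd x = i then 1 else 0) \<partial>L)"
    unfolding workload_lt_eq_transform[OF G L i] by (rule weighted_variable.norm_transform_le[OF W t])
  also have "\<dots> = \<pi> $ i"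
    using phi_0[OF i] unfolding workload_lt_eq_transform[OF G L i] weighted_variable.transform_0[OF W] by simp
  also have "\<dots> \<le> (\<Sum>i<N. \<pi> $ i)" by (rule member_le_sum) (use i pi_props in auto)
  finally show ?thesis by (simp add: pi_props)
qed

lemma phi_holomorphic: "i < N \<Longrightarrow> (\<lambda>t. \<phi> t i) holomorphic_on {t. Re t > 0}"
  unfolding workload_lt_eq_transform[OF G L]
  by (rule weighted_variable.transform_holomorphic[OF steady_state_weighted_variable[OF G L]])

lemma phi_pos:
  assumes i: "i < N" and c: "c > 0" obtains a where "a > 0" "\<phi> (complex_of_real c) i = complex_of_real a"
proof -
  interpret W: weighted_variable L fst "\<lambda>x. if snd x = i then 1 else 0"
    by (rule steady_state_weighted_variable[OF G L])
  let ?g = "\<lambda>x::real \<times> nat. if snd x = i then 1 else (0::real)"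
  let ?a = "\<integral>x. ?g x * exp (- c * fst x) \<partial>L"
  have e: "\<phi> (complex_of_real c) i = complex_of_real ?a"
    unfolding workload_lt_eq_transform[OF G L i] by (rule W.transform_of_real)
  have int: "integrable L (\<lambda>x. ?g x * exp (- c * fst x))"
    using W.moment_kernel_integrable[OF c, of 0] by simp
  have "?a \<ge> 0" by (intro integral_nonneg_AE) (auto simp: W.g_nonneg)
  moreover have "?a \<noteq> 0"
  proof
    assume "?a = 0"
    then have "AE x in L. ?g x * exp (- c * fst x) = 0"
      by (subst (asm) integral_nonneg_eq_0_iff_AE[OF int]) auto
    then have ae: "AE x in L. ?g x = 0" by eventually_elim simp
    have "(\<integral>x. ?g x \<partial>L) = (\<integral>x. 0 \<partial>L)"
      by (rule integral_cong_AE[OF W.g_meas _ ae]) simp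
    then have "\<phi> 0 i = 0"
      unfolding workload_lt_eq_transform[OF G L i] W.transform_0 by simp
    then show False using phi_0[OF i] pi_pos[OF i] by simp
  qed
  ultimately have "?a > 0" by linarith
  then show ?thesis using e by (rule that)
qed

text \<open>
  Multiply the stationary equation by \<open>\<Lambda>\<^sup>-\<^sup>1 e\<close>, divide by \<open>t\<close>, and let \<open>t \<rightarrow> 0\<close>: the rows of \<open>P\<close> sum to one, so the
  difference quotient of the service time transform is all that remains of \<open>E\<close>.  The mean enters as the limit of
  that quotient so that the lemma applies to mixtures.
\<close>

lemma empty_vec_drift:
  assumes mean: "(\<lambda>n. (1 - lst G (complex_of_real (inverse (real (Suc n))))) / complex_of_real (inverse (real (Suc n)))) \<longlonglongrightarrow> c"
  shows "(\<Sum>j<N. empty_vec G L j / clam j)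
    = complex_of_real (\<Sum>i<N. \<pi> $ i / lam i) - c * complex_of_real (\<Sum>i<N. \<Sum>j<N. \<pi> $ i * jw i j True)"
proof -
  define T where "T n = complex_of_real (inverse (real (Suc n)))" for n
  have T0: "T n \<noteq> 0" for n unfolding T_def of_real_eq_0_iff by simp
  have TR: "Re (T n) \<ge> 0" for n by (simp add: T_def)
  have TL: "T \<longlonglongrightarrow> 0"
    unfolding T_def using tendsto_of_real[OF LIMSEQ_inverse_real_of_nat] by (simp only: of_real_0)
  have cl: "clam j \<noteq> 0" if "j < N" for j using rate_pos[OF that] by simp
  have eq: "(\<Sum>i<N. \<phi> (T n) i * (1 / clam i - (1 - lst G (T n)) / T n * (\<Sum>j<N. cw i j True))) = (\<Sum>j<N. empty_vec G L j / clam j)" for n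
  proof -
    let ?t = "T n" and ?f = "lst G (T n)"
    have row: "(\<Sum>j<N. E_mat D1 D2 ?f ?t $$ (i,j) / clam j) = ?t / clam i - (1 - ?f) * (\<Sum>j<N. cw i j True)" if i: "i < N" for i
    proof -
      have "(\<Sum>j<N. E_mat D1 D2 ?f ?t $$ (i,j) / clam j)
        = (\<Sum>j<N. (cw i j True + cw i j False) - (1 - ?f) * cw i j True + (if j = i then ?t / clam i - 1 else 0))"
        using i by (intro sum.cong refl) (use cl in \<open>auto simp: E_mat_index field_simps\<close>)
      also have "\<dots> = complex_of_real (\<Sum>j<N. jw i j True + jw i j False) - (1 - ?f) * (\<Sum>j<N. cw i j True) + (?t / clam i - 1)"
        using i by (simp add: sum.distrib sum_subtractf sum_distrib_left)
      finally show ?thesis using jw_sum[OF i] by simp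
    qed
    have "?t * (\<Sum>j<N. empty_vec G L j / clam j) = (\<Sum>j<N. (\<Sum>i<N. \<phi> ?t i * E_mat D1 D2 ?f ?t $$ (i,j)) / clam j)"
      by (simp add: stationary_equation TR sum_distrib_left)
    also have "\<dots> = (\<Sum>i<N. \<phi> ?t i * (\<Sum>j<N. E_mat D1 D2 ?f ?t $$ (i,j) / clam j))"
      unfolding sum_divide_distrib sum_distrib_left by (subst sum.swap) simp
    also have "\<dots> = (\<Sum>i<N. \<phi> ?t i * (?t / clam i - (1 - ?f) * (\<Sum>j<N. cw i j True)))"
      by (intro sum.cong refl) (simp add: row)
    also have "\<dots> = ?t * (\<Sum>i<N. \<phi> ?t i * (1 / clam i - (1 - ?f) / ?t * (\<Sum>j<N. cw i j True)))"
    proof -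
      have "?t / l - (1 - ?f) * A = ?t * (1 / l - (1 - ?f) / ?t * A)" for l A
        using T0[of n] by (simp add: right_diff_distrib)
      then have "(\<Sum>i<N. \<phi> ?t i * (?t / clam i - (1 - ?f) * (\<Sum>j<N. cw i j True)))
          = (\<Sum>i<N. ?t * (\<phi> ?t i * (1 / clam i - (1 - ?f) / ?t * (\<Sum>j<N. cw i j True))))"
        by (intro sum.cong refl) (simp only: mult.left_commute)
      then show ?thesis by (simp only: sum_distrib_left[of ?t])
    qed
    finally show ?thesis using T0[of n] by simp
  qed
  have phiL: "(\<lambda>n. \<phi> (T n) i) \<longlonglongrightarrow> complex_of_real (\<pi> $ i)" if i: "i < N" for i
    using weighted_variable.transform_tendsto[OF steady_state_weighted_variable[OF G L], of T 0 i] TR TL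
    by (simp add: workload_lt_eq_transform[OF G L i, symmetric] phi_0[OF i])
  have "(\<lambda>n. \<Sum>i<N. \<phi> (T n) i * (1 / clam i - (1 - lst G (T n)) / T n * (\<Sum>j<N. cw i j True)))
      \<longlonglongrightarrow> (\<Sum>i<N. complex_of_real (\<pi> $ i) * (1 / clam i - c * (\<Sum>j<N. cw i j True)))"
    by (intro tendsto_intros phiL) (use mean in \<open>auto simp: T_def\<close>)
  then have "(\<Sum>j<N. empty_vec G L j / clam j) = (\<Sum>i<N. complex_of_real (\<pi> $ i) * (1 / clam i - c * (\<Sum>j<N. cw i j True)))"
    unfolding eq by (simp add: LIMSEQ_const_iff)
  also have "\<dots> = complex_of_real (\<Sum>i<N. \<pi> $ i / lam i) - c * complex_of_real (\<Sum>i<N. \<Sum>j<N. \<pi> $ i * jw i j True)"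
    by (simp add: right_diff_distrib sum_subtractf sum_distrib_left mult_ac)
  finally show ?thesis .
qed

text \<open>
  No tag can be approached with probability zero, as \<open>\<pi>\<close> is positive and invariant; hence some summand in the
  definition is positive.
\<close>

lemma empty_vec_pos:
  assumes F: "service_dist G" and j: "j < N"
  obtains a where "a > 0" "empty_vec G L j = complex_of_real a"
proof -
  have lj: "lam j > 0" by (rule rate_pos[OF j])
  define \<psi> where "\<psi> i = Re (\<phi> (clam j) i)" for i
  have psi: "\<psi> i > 0 \<and> \<phi> (clam j) i = complex_of_real (\<psi> i)" if "i < N" for i
    using phi_pos[OF that lj] unfolding \<psi>_def by (metis Re_complex_of_real)
  define f where "f = (\<integral>x. exp (- lam j * x) \<partial>G)"
  have f: "f > 0" "lst G (clam j) = complex_of_real f"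
    unfolding f_def using lst_pos[OF F lj] lst_of_real[OF F] by auto
  let ?a = "\<Sum>i<N. \<psi> i * (jw i j False + jw i j True * f)"
  have "empty_vec G L j = complex_of_real ?a"
    by (simp add: empty_vec_def psi f)
  moreover have nn: "0 \<le> \<psi> i * (jw i j False + jw i j True * f)" if "i < N" for i
    using psi[OF that] f jw_nonneg[OF that j] by (intro mult_nonneg_nonneg add_nonneg_nonneg) (auto intro: less_imp_le)
  moreover have "?a \<noteq> 0"
  proof
    assume "?a = 0"
    then have z: "\<psi> i * (jw i j False + jw i j True * f) = 0" if "i < N" for i
      by (subst (asm) sum_nonneg_eq_0_iff) (use nn that in auto)
    have "trans_mat D1 D2 $$ (i,j) = 0" if i: "i < N" for i
    proof -
      have "jw i j False + jw i j True * f = 0" using z[OF i] psi[OF i] by auto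
      moreover have "jw i j False \<ge> 0" "jw i j True * f \<ge> 0" using jw_nonneg[OF i j] f by auto
      ultimately have "jw i j False = 0" "jw i j True * f = 0" by linarith+
      then show ?thesis using f i j by (simp add: trans_mat_jw)
    qed
    then have "\<pi> $ j = 0" using pi_props(1)[OF j] by simp
    then show False using pi_pos[OF j] by simp
  qed
  moreover have "?a \<ge> 0" by (rule sum_nonneg) (use nn in auto)
  ultimately show ?thesis using that[of ?a] by simp
qed

end
end

section \<open>Directional derivatives of determinants and adjugates\<close>

lemma mat_delete_replace_col: "mat_delete (replace_col X b j) i j = mat_delete X i j"
  by (rule eq_matI) (auto simp: mat_delete_def replace_col_def)

lemma det_dir_cofactor:
  fixes X Y :: "'a :: comm_ring_1 mat"
  assumes X: "X \<in> carrier_mat n n" and Y: "Y \<in> carrier_mat n n"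
  shows "det_dir X Y = (\<Sum>j<n. \<Sum>i<n. Y $$ (i,j) * cofactor X i j)"
proof -
  have "det (replace_col X (col Y j) j) = (\<Sum>i<n. Y $$ (i,j) * cofactor X i j)" if j: "j < n" for j
  proof -
    have R: "replace_col X (col Y j) j \<in> carrier_mat n n" using X by (auto simp: replace_col_def)
    show ?thesis unfolding laplace_expansion_column[OF R j] cofactor_def mat_delete_replace_col
      using X Y j by (intro sum.cong refl) (auto simp: replace_col_def)
  qed
  then show ?thesis using X by (simp add: det_dir_def)
qed

lemma det_dir_smult:
  fixes X Y :: "'a :: comm_ring_1 mat"
  assumes X: "X \<in> carrier_mat n n" and Y: "Y \<in> carrier_mat n n"
  shows "det_dir X (c \<cdot>\<^sub>m Y) = c * det_dir X Y"
proof -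
  have cY: "c \<cdot>\<^sub>m Y \<in> carrier_mat n n" using Y by simp
  show ?thesis unfolding det_dir_cofactor[OF X Y] det_dir_cofactor[OF X cY] sum_distrib_left
    using Y by (intro sum.cong refl) (auto simp: mult.assoc)
qed

text \<open>The adjugate analogue of \<^const>\<open>det_dir\<close>: the derivative of \<^const>\<open>adj_mat\<close> at \<open>X\<close> in the direction \<open>Y\<close>.\<close>

definition adj_dir :: "'a :: comm_ring_1 mat \<Rightarrow> 'a mat \<Rightarrow> 'a mat" where
  "adj_dir X Y = mat (dim_row X) (dim_col X)
     (\<lambda>(i,j). (- 1) ^ (j + i) * det_dir (mat_delete X j i) (mat_delete Y j i))"

lemma mat_delete_smult: "Y \<in> carrier_mat n n \<Longrightarrow> mat_delete (c \<cdot>\<^sub>m Y) i j = c \<cdot>\<^sub>m mat_delete Y i j"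
  by (rule eq_matI) (auto simp: mat_delete_def)

text \<open>
  Jacobi's formula.  Differentiating each product in the permutation expansion yields the same terms as replacing
  one column at a time, since a permutation meets each column once.
\<close>

lemma has_field_derivative_det:
  fixes X :: "complex \<Rightarrow> complex mat"
  assumes X: "\<And>z. X z \<in> carrier_mat n n" and Y: "Y \<in> carrier_mat n n"
    and d: "\<And>i j. i < n \<Longrightarrow> j < n \<Longrightarrow> ((\<lambda>z. X z $$ (i,j)) has_field_derivative Y $$ (i,j)) (at z0)"
  shows "((\<lambda>z. det (X z)) has_field_derivative det_dir (X z0) Y) (at z0)"
proof -
  let ?P = "{p. p permutes {0..<n}}"
  have D: "((\<lambda>z. \<Sum>p\<in>?P. signof p * (\<Prod>i=0..<n. X z $$ (i, p i))) has_field_derivative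
      (\<Sum>p\<in>?P. signof p * (\<Sum>i=0..<n. Y $$ (i, p i) * (\<Prod>k\<in>{0..<n} - {i}. X z0 $$ (k, p k))))) (at z0)"
  proof (intro DERIV_sum DERIV_cmult has_field_derivative_prod d)
    fix p i assume "p \<in> ?P" "i \<in> {0..<n}"
    then show "p i < n" "i < n" using permutes_in_image[of p "{0..<n}" i] by auto
  qed
  have e1: "(\<lambda>z. \<Sum>p\<in>?P. signof p * (\<Prod>i=0..<n. X z $$ (i, p i))) = (\<lambda>z. det (X z))"
    using X by (intro ext det_def'[symmetric]) auto
  have e2: "(\<Sum>p\<in>?P. signof p * (\<Sum>i=0..<n. Y $$ (i, p i) * (\<Prod>k\<in>{0..<n} - {i}. X z0 $$ (k, p k)))) = det_dir (X z0) Y"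
  proof -
    have "det_dir (X z0) Y = (\<Sum>j=0..<n. det (replace_col (X z0) (col Y j) j))"
      using X[of z0] by (simp add: det_dir_def lessThan_atLeast0)
    also have "\<dots> = (\<Sum>j=0..<n. \<Sum>p\<in>?P. signof p * (\<Prod>i=0..<n. if p i = j then Y $$ (i, j) else X z0 $$ (i, p i)))"
    proof (intro sum.cong refl)
      fix j assume j: "j \<in> {0..<n}"
      have R: "replace_col (X z0) (col Y j) j \<in> carrier_mat n n" using X[of z0] by (auto simp: replace_col_def)
      show "det (replace_col (X z0) (col Y j) j)
        = (\<Sum>p\<in>?P. signof p * (\<Prod>i=0..<n. if p i = j then Y $$ (i, j) else X z0 $$ (i, p i)))"
        unfolding det_def'[OF R]
      proof (intro sum.cong refl arg_cong2[of _ _ _ _ "(*)"] prod.cong)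
        fix p i assume "p \<in> ?P" "i \<in> {0..<n}"
        then have "p i < n" "i < n" using permutes_in_image[of p "{0..<n}" i] by auto
        then show "replace_col (X z0) (col Y j) j $$ (i, p i) = (if p i = j then Y $$ (i, j) else X z0 $$ (i, p i))"
          using X[of z0] Y j by (auto simp: replace_col_def)
      qed
    qed
    also have "\<dots> = (\<Sum>p\<in>?P. signof p * (\<Sum>j=0..<n. \<Prod>i=0..<n. if p i = j then Y $$ (i, j) else X z0 $$ (i, p i)))"
      by (subst sum.swap) (simp add: sum_distrib_left)
    also have "\<dots> = (\<Sum>p\<in>?P. signof p * (\<Sum>i=0..<n. Y $$ (i, p i) * (\<Prod>k\<in>{0..<n} - {i}. X z0 $$ (k, p k))))"
    proof (rule sum.cong[OF refl], rule arg_cong2[of _ _ _ _ "(*)", OF refl])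
      fix p assume "p \<in> ?P"
      then have p: "p permutes {0..<n}" by simp
      have "(\<Sum>j=0..<n. \<Prod>i=0..<n. if p i = j then Y $$ (i, j) else X z0 $$ (i, p i))
          = (\<Sum>k=0..<n. \<Prod>i=0..<n. if p i = p k then Y $$ (i, p k) else X z0 $$ (i, p i))"
        using sum.permute[OF p, of "\<lambda>j. \<Prod>i=0..<n. if p i = j then Y $$ (i, j) else X z0 $$ (i, p i)"] by (simp add: o_def)
      also have "\<dots> = (\<Sum>i=0..<n. Y $$ (i, p i) * (\<Prod>k\<in>{0..<n} - {i}. X z0 $$ (k, p k)))"
      proof (intro sum.cong refl)
        fix k assume k: "k \<in> {0..<n}"
        have "(\<Prod>i\<in>{0..<n} - {k}. if p i = p k then Y $$ (i, p k) else X z0 $$ (i, p i)) = (\<Prod>i\<in>{0..<n} - {k}. X z0 $$ (i, p i))"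
          using permutes_inj[OF p] by (intro prod.cong refl) (auto dest: injD)
        then show "(\<Prod>i=0..<n. if p i = p k then Y $$ (i, p k) else X z0 $$ (i, p i))
          = Y $$ (k, p k) * (\<Prod>i\<in>{0..<n} - {k}. X z0 $$ (i, p i))"
          using k by (subst prod.remove[of _ k]) auto
      qed
      finally show "(\<Sum>j=0..<n. \<Prod>i=0..<n. if p i = j then Y $$ (i, j) else X z0 $$ (i, p i))
        = (\<Sum>i=0..<n. Y $$ (i, p i) * (\<Prod>k\<in>{0..<n} - {i}. X z0 $$ (k, p k)))" .
    qed
    finally show ?thesis by simp
  qed
  show ?thesis using D by (simp only: e1 e2)
qed

lemma has_field_derivative_adj:
  fixes X :: "complex \<Rightarrow> complex mat"
  assumes X: "\<And>z. X z \<in> carrier_mat n n" and Y: "Y \<in> carrier_mat n n"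
    and d: "\<And>i j. i < n \<Longrightarrow> j < n \<Longrightarrow> ((\<lambda>z. X z $$ (i,j)) has_field_derivative Y $$ (i,j)) (at z0)"
    and ij: "i < n" "j < n"
  shows "((\<lambda>z. adj_mat (X z) $$ (i,j)) has_field_derivative adj_dir (X z0) Y $$ (i,j)) (at z0)"
proof -
  have e: "adj_mat (X z) $$ (i,j) = (- 1) ^ (j + i) * det (mat_delete (X z) j i)" for z
    using X[of z] ij by (simp add: adj_mat_def cofactor_def)
  have "((\<lambda>z. det (mat_delete (X z) j i)) has_field_derivative det_dir (mat_delete (X z0) j i) (mat_delete Y j i)) (at z0)"
  proof (rule has_field_derivative_det[where n = "n - 1"])
    show "mat_delete (X z) j i \<in> carrier_mat (n - 1) (n - 1)" for z by (rule mat_delete_carrier[OF X])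
    show "mat_delete Y j i \<in> carrier_mat (n - 1) (n - 1)" by (rule mat_delete_carrier[OF Y])
    fix k l assume kl: "k < n - 1" "l < n - 1"
    let ?k = "if k < j then k else Suc k" and ?l = "if l < i then l else Suc l"
    have "mat_delete (X z) j i $$ (k,l) = X z $$ (?k, ?l)" for z
      using X[of z] kl by (simp add: mat_delete_def)
    moreover have "mat_delete Y j i $$ (k,l) = Y $$ (?k, ?l)" using Y kl by (simp add: mat_delete_def)
    moreover have "?k < n" "?l < n" using kl by auto
    ultimately show "((\<lambda>z. mat_delete (X z) j i $$ (k,l)) has_field_derivative mat_delete Y j i $$ (k,l)) (at z0)"
      using d by simp
  qed
  then show ?thesis
    unfolding e using X[of z0] ij by (auto simp: adj_dir_def intro!: DERIV_cmult)
qed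

lemma adj_mat_index_right:
  assumes A: "A \<in> carrier_mat n n" and "i < n" "l < n"
  shows "(\<Sum>j<n. A $$ (i,j) * adj_mat A $$ (j,l)) = (if i = l then det A else (0 :: 'a :: comm_ring_1))"
proof -
  have "(A * adj_mat A) $$ (i,l) = (det A \<cdot>\<^sub>m 1\<^sub>m n) $$ (i,l)" by (simp only: adj_mat(2)[OF A])
  then show ?thesis using A adj_mat(1)[OF A] assms(2,3)
    by (simp add: scalar_prod_def lessThan_atLeast0)
qed

lemma adj_mat_index_left:
  assumes A: "A \<in> carrier_mat n n" and "i < n" "l < n"
  shows "(\<Sum>j<n. adj_mat A $$ (i,j) * A $$ (j,l)) = (if i = l then det A else (0 :: 'a :: comm_ring_1))"
proof -
  have "(adj_mat A * A) $$ (i,l) = (det A \<cdot>\<^sub>m 1\<^sub>m n) $$ (i,l)" by (simp only: adj_mat(3)[OF A])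
  then show ?thesis using A adj_mat(1)[OF A] assms(2,3)
    by (simp add: scalar_prod_def lessThan_atLeast0)
qed

text \<open>The derivative of \<open>A adj(A) = det(A) I\<close> at \<open>X\<close> in the direction \<open>Y\<close>.\<close>

lemma adj_dir_identity:
  fixes X Y :: "complex mat"
  assumes X: "X \<in> carrier_mat n n" and Y: "Y \<in> carrier_mat n n" and il: "i < n" "l < n"
  shows "(\<Sum>j<n. Y $$ (i,j) * adj_mat X $$ (j,l)) + (\<Sum>j<n. X $$ (i,j) * adj_dir X Y $$ (j,l))
    = (if i = l then det_dir X Y else 0)"
proof -
  define A where "A z = X + z \<cdot>\<^sub>m Y" for z
  have A: "A z \<in> carrier_mat n n" for z using X Y by (auto simp: A_def)
  have A0: "A 0 = X" using X Y by (auto simp: A_def intro!: eq_matI)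
  have d: "((\<lambda>z. A z $$ (i,j)) has_field_derivative Y $$ (i,j)) (at 0)" if "i < n" "j < n" for i j
    using X Y that by (auto simp: A_def intro!: derivative_eq_intros)
  have "((\<lambda>z. \<Sum>j<n. A z $$ (i,j) * adj_mat (A z) $$ (j,l)) has_field_derivative
      (\<Sum>j<n. Y $$ (i,j) * adj_mat (A 0) $$ (j,l) + adj_dir (A 0) Y $$ (j,l) * A 0 $$ (i,j))) (at 0)"
    by (intro DERIV_sum DERIV_mult d has_field_derivative_adj[OF A Y d]) (use il in auto)
  also have "(\<lambda>z. \<Sum>j<n. A z $$ (i,j) * adj_mat (A z) $$ (j,l)) = (\<lambda>z. if i = l then det (A z) else 0)"
    by (simp only: adj_mat_index_right[OF A il])
  finally have 1: "((\<lambda>z. if i = l then det (A z) else 0) has_field_derivative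
      (\<Sum>j<n. Y $$ (i,j) * adj_mat (A 0) $$ (j,l) + adj_dir (A 0) Y $$ (j,l) * A 0 $$ (i,j))) (at 0)" .
  have 2: "((\<lambda>z. if i = l then det (A z) else 0) has_field_derivative (if i = l then det_dir (A 0) Y else 0)) (at 0)"
    using has_field_derivative_det[OF A Y d] by auto
  from DERIV_unique[OF 1 2] show ?thesis unfolding A0 by (simp add: sum.distrib mult.commute)
qed

text \<open>The previous identity multiplied by \<open>adj(X)\<close> from the left.  It says that \<open>adj(X) Y adj(X)\<close> is, modulo \<open>det X\<close>, a
  multiple of \<open>adj(X)\<close>; for this reason the first-order term below has a simple denominator.\<close>

lemma adj_mult_adj_dir:
  fixes X Y :: "complex mat"
  assumes X: "X \<in> carrier_mat n n" and Y: "Y \<in> carrier_mat n n" and il: "i < n" "l < n"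
  shows "(\<Sum>k<n. adj_mat X $$ (i,k) * (\<Sum>j<n. Y $$ (k,j) * adj_mat X $$ (j,l))) + det X * adj_dir X Y $$ (i,l)
    = det_dir X Y * adj_mat X $$ (i,l)"
proof -
  have "(\<Sum>k<n. adj_mat X $$ (i,k) * ((\<Sum>j<n. Y $$ (k,j) * adj_mat X $$ (j,l)) + (\<Sum>j<n. X $$ (k,j) * adj_dir X Y $$ (j,l))))
      = (\<Sum>k<n. if k = l then adj_mat X $$ (i,k) * det_dir X Y else 0)"
    by (intro sum.cong refl) (use adj_dir_identity[OF X Y _ il(2)] in auto)
  also have "\<dots> = det_dir X Y * adj_mat X $$ (i,l)" using il by (simp add: mult.commute)
  finally have "(\<Sum>k<n. adj_mat X $$ (i,k) * (\<Sum>j<n. Y $$ (k,j) * adj_mat X $$ (j,l)))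
      + (\<Sum>k<n. adj_mat X $$ (i,k) * (\<Sum>j<n. X $$ (k,j) * adj_dir X Y $$ (j,l))) = det_dir X Y * adj_mat X $$ (i,l)"
    by (simp add: distrib_left sum.distrib)
  moreover have "(\<Sum>k<n. adj_mat X $$ (i,k) * (\<Sum>j<n. X $$ (k,j) * adj_dir X Y $$ (j,l)))
      = (\<Sum>j<n. (\<Sum>k<n. adj_mat X $$ (i,k) * X $$ (k,j)) * adj_dir X Y $$ (j,l))"
    unfolding sum_distrib_left sum_distrib_right by (subst sum.swap) (simp add: mult.assoc)
  moreover have "\<dots> = (\<Sum>j<n. if j = i then det X * adj_dir X Y $$ (j,l) else 0)"
    by (intro sum.cong refl) (use adj_mat_index_left[OF X il(1)] in auto)
  ultimately show ?thesis using il by simp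
qed

lemma row_times_adj:
  fixes X :: "'a :: comm_ring_1 mat"
  assumes X: "X \<in> carrier_mat n n" and b: "\<And>j. j < n \<Longrightarrow> (\<Sum>k<n. x k * X $$ (k,j)) = b j" and l: "l < n"
  shows "x l * det X = (\<Sum>j<n. b j * adj_mat X $$ (j,l))"
proof -
  have "(\<Sum>j<n. b j * adj_mat X $$ (j,l)) = (\<Sum>j<n. \<Sum>k<n. x k * (X $$ (k,j) * adj_mat X $$ (j,l)))"
    by (intro sum.cong refl) (simp add: sum_distrib_right mult.assoc flip: b)
  also have "\<dots> = (\<Sum>k<n. x k * (\<Sum>j<n. X $$ (k,j) * adj_mat X $$ (j,l)))"
    by (subst sum.swap) (simp add: sum_distrib_left)
  also have "\<dots> = (\<Sum>k<n. if k = l then x k * det X else 0)"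
    by (intro sum.cong refl) (simp add: adj_mat_index_right[OF X _ l])
  finally show ?thesis using l by simp
qed

section \<open>Behaviour at infinity\<close>

lemma tendsto_det:
  fixes X :: "'b \<Rightarrow> complex mat"
  assumes X: "\<And>z. X z \<in> carrier_mat n n" and Y: "Y \<in> carrier_mat n n"
    and d: "\<And>i j. i < n \<Longrightarrow> j < n \<Longrightarrow> ((\<lambda>z. X z $$ (i,j)) \<longlongrightarrow> Y $$ (i,j)) F"
  shows "((\<lambda>z. det (X z)) \<longlongrightarrow> det Y) F"
  unfolding det_def'[OF X] det_def'[OF Y]
proof (intro tendsto_sum tendsto_mult tendsto_const tendsto_prod d)
  fix p i assume "p \<in> {p. p permutes {0..<n}}" "i \<in> {0..<n}"
  then show "p i < n" "i < n" using permutes_in_image[of p "{0..<n}" i] by auto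
qed

lemma tendsto_adj:
  fixes X :: "'b \<Rightarrow> complex mat"
  assumes X: "\<And>z. X z \<in> carrier_mat n n" and Y: "Y \<in> carrier_mat n n"
    and d: "\<And>i j. i < n \<Longrightarrow> j < n \<Longrightarrow> ((\<lambda>z. X z $$ (i,j)) \<longlongrightarrow> Y $$ (i,j)) F"
    and ij: "i < n" "j < n"
  shows "((\<lambda>z. adj_mat (X z) $$ (i,j)) \<longlongrightarrow> adj_mat Y $$ (i,j)) F"
proof -
  have e: "adj_mat A $$ (i,j) = (- 1) ^ (j + i) * det (mat_delete A j i)" if "A \<in> carrier_mat n n" for A :: "complex mat"
    using that ij by (simp add: adj_mat_def cofactor_def)
  have "((\<lambda>z. det (mat_delete (X z) j i)) \<longlongrightarrow> det (mat_delete Y j i)) F"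
  proof (rule tendsto_det[where n = "n - 1"])
    show "mat_delete (X z) j i \<in> carrier_mat (n - 1) (n - 1)" for z by (rule mat_delete_carrier[OF X])
    show "mat_delete Y j i \<in> carrier_mat (n - 1) (n - 1)" by (rule mat_delete_carrier[OF Y])
    fix k l assume kl: "k < n - 1" "l < n - 1"
    let ?k = "if k < j then k else Suc k" and ?l = "if l < i then l else Suc l"
    have "mat_delete (X z) j i $$ (k,l) = X z $$ (?k, ?l)" for z
      using X[of z] kl by (simp add: mat_delete_def)
    moreover have "mat_delete Y j i $$ (k,l) = Y $$ (?k, ?l)" using Y kl by (simp add: mat_delete_def)
    moreover have "?k < n" "?l < n" using kl by auto
    ultimately show "((\<lambda>z. mat_delete (X z) j i $$ (k,l)) \<longlongrightarrow> mat_delete Y j i $$ (k,l)) F"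
      using d by simp
  qed
  then show ?thesis unfolding e[OF X] e[OF Y] by (intro tendsto_mult tendsto_const)
qed

lemma adj_mat_smult:
  assumes X: "X \<in> carrier_mat n n" and ij: "i < n" "j < n"
  shows "adj_mat (c \<cdot>\<^sub>m X) $$ (i,j) = c ^ (n - 1) * adj_mat X $$ (i,j)"
proof -
  have "mat_delete X j i \<in> carrier_mat (n - 1) (n - 1)" by (rule mat_delete_carrier[OF X])
  then show ?thesis
    using X ij by (simp add: adj_mat_def cofactor_def mat_delete_smult[OF X] det_smult mult.left_commute)
qed

lemma adj_mat_one: "i < n \<Longrightarrow> j < n \<Longrightarrow> adj_mat (1\<^sub>m n :: complex mat) $$ (i,j) = (if i = j then 1 else 0)"
proof -
  assume ij: "i < n" "j < n"
  have c: "adj_mat (1\<^sub>m n :: complex mat) \<in> carrier_mat n n" by (rule adj_mat(1)) simp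
  have "1\<^sub>m n * adj_mat (1\<^sub>m n :: complex mat) = det (1\<^sub>m n) \<cdot>\<^sub>m 1\<^sub>m n" by (rule adj_mat(2)) simp
  then have "adj_mat (1\<^sub>m n :: complex mat) = 1\<^sub>m n" using c by (auto intro!: eq_matI)
  then show ?thesis using ij by simp
qed

lemma tendsto_poly_quotient:
  fixes P :: "complex poly" assumes "degree P \<le> d"
  shows "((\<lambda>t. poly P t / t ^ d) \<longlongrightarrow> coeff P d) at_infinity"
proof -
  have "((\<lambda>t. \<Sum>i\<le>d. coeff P i * inverse t ^ (d - i)) \<longlongrightarrow> (\<Sum>i\<le>d. coeff P i * 0 ^ (d - i))) at_infinity"
    by (intro tendsto_intros tendsto_inverse_0)
  moreover have "(\<Sum>i\<le>d. coeff P i * 0 ^ (d - i)) = coeff P d"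
    by (subst sum.remove[of _ d]) (auto intro!: sum.neutral)
  moreover have "eventually (\<lambda>t. (\<Sum>i\<le>d. coeff P i * inverse t ^ (d - i)) = poly P t / t ^ d) at_infinity"
  proof -
    have "eventually (\<lambda>t::complex. t \<noteq> 0) at_infinity"
      using eventually_not_equal_at_infinity by blast
    then show ?thesis
    proof eventually_elim
      case (elim t)
      have "poly P t = (\<Sum>i\<le>d. coeff P i * t ^ i)"
        unfolding poly_altdef using assms by (intro sum.mono_neutral_left) (auto simp: coeff_eq_0)
      then have "poly P t / t ^ d = (\<Sum>i\<le>d. coeff P i * (t ^ i / t ^ d))"
        by (simp add: sum_divide_distrib)
      also have "\<dots> = (\<Sum>i\<le>d. coeff P i * inverse t ^ (d - i))"
      proof (intro sum.cong refl)
        fix i assume "i \<in> {..d}"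
        then have "t ^ d = t ^ i * t ^ (d - i)" by (simp flip: power_add)
        then show "coeff P i * (t ^ i / t ^ d) = coeff P i * inverse t ^ (d - i)"
          using elim by (simp add: field_simps)
      qed
      finally show ?case by simp
    qed
  qed
  ultimately show ?thesis using tendsto_cong by fastforce
qed

text \<open>
  The degrees and leading coefficients of the numerators are read off from their growth, which avoids
  expanding determinants.
\<close>

lemma poly_degree_from_limit:
  fixes P :: "complex poly"
  assumes "((\<lambda>t. poly P t / t ^ n) \<longlongrightarrow> c) at_infinity"
  shows "degree P \<le> n" "coeff P n = c"
proof -
  show *: "degree P \<le> n"
  proof (rule ccontr)
    assume "\<not> degree P \<le> n"
    define d where "d = degree P"
    have d: "n < d" using \<open>\<not> degree P \<le> n\<close> by (simp add: d_def)
    have "((\<lambda>t. poly P t / t ^ n * inverse t ^ (d - n)) \<longlongrightarrow> c * 0 ^ (d - n)) at_infinity"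
      by (intro tendsto_intros assms tendsto_inverse_0)
    moreover have "poly P t / t ^ n * inverse t ^ (d - n) = poly P t / t ^ d" for t
    proof -
      have "t ^ d = t ^ n * t ^ (d - n)" using d by (simp flip: power_add)
      then show ?thesis by (simp add: power_inverse field_simps)
    qed
    ultimately have "((\<lambda>t. poly P t / t ^ d) \<longlongrightarrow> 0) at_infinity" using d by (simp add: power_0_left)
    moreover have "((\<lambda>t. poly P t / t ^ d) \<longlongrightarrow> coeff P d) at_infinity"
      by (rule tendsto_poly_quotient) (simp add: d_def)
    ultimately have "coeff P d = 0" using tendsto_unique[OF trivial_limit_at_infinity] by blast
    then have "P = 0" by (simp add: d_def)
    then show False using d by (simp add: d_def)
  qed
  show "coeff P n = c"
    by (rule tendsto_unique[OF trivial_limit_at_infinity tendsto_poly_quotient[OF *] assms])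
qed

section \<open>Partial fractions\<close>

context
  fixes J :: "'i set" and b :: "'i \<Rightarrow> complex"
  assumes finJ: "finite J" and injb: "inj_on b J"
begin

definition pf_denom :: "('i \<Rightarrow> nat) \<Rightarrow> complex poly" where
  "pf_denom n = (\<Prod>j\<in>J. [:- b j, 1:] ^ n j)"

definition pf_sum :: "('i \<Rightarrow> nat) \<Rightarrow> complex \<Rightarrow> ('i \<times> nat \<Rightarrow> complex) \<Rightarrow> complex \<Rightarrow> complex" where
  "pf_sum n c0 c t = c0 + (\<Sum>j\<in>J. \<Sum>e\<in>{1..n j}. c (j,e) / (t - b j) ^ e)"

lemma poly_pf_denom: "poly (pf_denom n) t = (\<Prod>j\<in>J. (t - b j) ^ n j)"
  by (simp add: pf_denom_def poly_prod poly_power)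

lemma pf_denom_nonzero: "t \<notin> b ` J \<Longrightarrow> poly (pf_denom n) t \<noteq> 0"
  using finJ by (auto simp: poly_pf_denom)

lemma degree_linear_power: "degree ([:- a, 1:] ^ m :: complex poly) = m"
  by (simp add: degree_power_eq)

lemma degree_prod_linear: "A \<subseteq> J \<Longrightarrow> degree (\<Prod>j\<in>A. [:- b j, 1:] ^ n j :: complex poly) = (\<Sum>j\<in>A. n j)"
  by (subst degree_prod_eq_sum_degree) (auto simp: degree_linear_power)

text \<open>
  The numerator may have the same degree as the denominator; the constant term of the decomposition is then its
  coefficient in that degree.
\<close>

lemma partial_fractions_exist:
  "degree P \<le> (\<Sum>j\<in>J. n j) \<Longrightarrow>
   \<exists>c. \<forall>t. t \<notin> b ` J \<longrightarrow> pf_sum n (coeff P (\<Sum>j\<in>J. n j)) c t = poly P t / poly (pf_denom n) t"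
proof (induction "\<Sum>j\<in>J. n j" arbitrary: n P)
  case 0
  then have n0: "n j = 0" if "j \<in> J" for j using finJ that by simp
  have "degree P = 0" using 0 by simp
  then obtain a where "P = [:a:]" by (rule degree_eq_zeroE)
  then show ?case using n0 by (intro exI[of _ "\<lambda>_. 0"]) (simp add: pf_sum_def poly_pf_denom)
next
  case (Suc d)
  note d = Suc.hyps(2)[symmetric]
  obtain k where k: "k \<in> J" "n k > 0"
  proof -
    have "\<not> (\<forall>j\<in>J. n j = 0)"
    proof
      assume "\<forall>j\<in>J. n j = 0"
      then have "(\<Sum>j\<in>J. n j) = 0" by simp
      then show False using d by simp
    qed
    then show thesis using that by auto
  qed
  define n' where "n' = n(k := n k - 1)"
  have split: "(\<Sum>j\<in>J. f j) = f k + (\<Sum>j\<in>J-{k}. f j)" for f :: "'i \<Rightarrow> nat"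
    using finJ k by (intro sum.remove)
  have n'k: "n' j = n j" if "j \<in> J - {k}" for j using that by (simp add: n'_def)
  have dn': "d = (\<Sum>j\<in>J. n' j)"
    using d k(2) by (simp add: split[of n] split[of n'] n'k) (simp add: n'_def)
  define G where "G = (\<Prod>j\<in>J - {k}. [:- b j, 1:] ^ n j)"
  have Gk: "poly G (b k) \<noteq> 0"
    using finJ injb k by (auto simp: G_def poly_prod poly_power inj_on_def)
  have degG: "degree G = (\<Sum>j\<in>J - {k}. n j)" unfolding G_def by (rule degree_prod_linear) auto
  have denG: "pf_denom n = [:- b k, 1:] ^ n k * G"
    unfolding pf_denom_def G_def using finJ k by (intro prod.remove)
  have denG': "pf_denom n' = [:- b k, 1:] ^ (n k - 1) * G"
    unfolding pf_denom_def using finJ k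
    by (subst prod.remove[of _ k]) (auto simp: n'_def G_def intro!: prod.cong)
  \<comment> \<open>Splitting off the summand of highest order at \<open>b k\<close> lowers the order of that pole by one.\<close>
  define a where "a = poly P (b k) / poly G (b k)"
  have "poly (P - Polynomial.smult a G) (b k) = 0" using Gk by (simp add: a_def)
  then obtain P' where P': "P - Polynomial.smult a G = [:- b k, 1:] * P'"
    unfolding poly_eq_0_iff_dvd by (rule dvdE)
  then have P: "P = Polynomial.smult a G + [:- b k, 1:] * P'" by (simp add: algebra_simps)
  have dG: "degree G < Suc d" using d k(2) by (simp add: degG split[of n])
  have dP': "degree P' \<le> d"
  proof (cases "P' = 0")
    case False
    have "degree (P - Polynomial.smult a G) \<le> Suc d"
      using Suc.prems d dG by (intro degree_diff_le) (auto intro: order.trans[OF degree_smult_le])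
    then show ?thesis unfolding P' using False by (subst (asm) degree_mult_eq) auto
  qed simp
  have cP: "coeff P (Suc d) = coeff P' d"
    unfolding P using dG dP' by (simp add: coeff_eq_0)
  obtain c where c: "\<And>t. t \<notin> b ` J \<Longrightarrow> pf_sum n' (coeff P' d) c t = poly P' t / poly (pf_denom n') t"
    using Suc.hyps(1)[OF dn'] dP' unfolding dn' by blast
  have "pf_sum n (coeff P (Suc d)) (c((k, n k) := a)) t = poly P t / poly (pf_denom n) t" if t: "t \<notin> b ` J" for t
  proof -
    have tk: "t - b k \<noteq> 0" using t k by auto
    have Gt: "poly G t \<noteq> 0" using pf_denom_nonzero[OF t, of n] by (simp add: denG)
    let ?c = "c((k, n k) := a)"
    let ?f = "\<lambda>c n j. \<Sum>e\<in>{1..n j}. c (j,e) / (t - b j) ^ e"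
    have 1: "(\<Sum>j\<in>J - {k}. ?f ?c n j) = (\<Sum>j\<in>J - {k}. ?f c n' j)"
      by (intro sum.cong refl) (auto simp: n'_def)
    have "{1..n k} = insert (n k) {1..n k - 1}" using k(2) by auto
    then have "?f ?c n k = a / (t - b k) ^ n k + (\<Sum>e\<in>{1..n k - 1}. ?c (k,e) / (t - b k) ^ e)"
      using k(2) by (simp add: sum.insert_if)
    also have "(\<Sum>e\<in>{1..n k - 1}. ?c (k,e) / (t - b k) ^ e) = ?f c n' k"
      using k(2) by (intro sum.cong) (auto simp: n'_def)
    finally have 2: "?f ?c n k = a / (t - b k) ^ n k + ?f c n' k" .
    have "pf_sum n (coeff P (Suc d)) ?c t = coeff P' d + (?f ?c n k + (\<Sum>j\<in>J - {k}. ?f ?c n j))"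
      unfolding pf_sum_def cP using finJ k by (simp add: sum.remove[of J k])
    also have "\<dots> = a / (t - b k) ^ n k + pf_sum n' (coeff P' d) c t"
      unfolding 1 2 pf_sum_def using finJ k by (simp add: sum.remove[of J k])
    also have "\<dots> = a / (t - b k) ^ n k + poly P' t / ((t - b k) ^ (n k - 1) * poly G t)"
      by (simp add: c[OF t] denG')
    also have "\<dots> = poly P t / ((t - b k) ^ n k * poly G t)"
    proof -
      obtain m where m: "n k = Suc m" using k(2) by (cases "n k") auto
      show ?thesis using tk Gt by (simp add: P m field_simps)
    qed
    finally show ?thesis by (simp add: denG)
  qed
  then show ?case unfolding d by blast
qed

lemma pf_numerator:
  obtains W where "\<And>t. t \<notin> b ` J \<Longrightarrow> poly W t = pf_sum n c0 c t * poly (pf_denom n) t"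
    and "\<And>k. k \<in> J \<Longrightarrow> n k > 0 \<Longrightarrow> poly W (b k) = c (k, n k) * (\<Prod>j\<in>J - {k}. (b k - b j) ^ n j)"
proof
  define W where "W = Polynomial.smult c0 (pf_denom n) + (\<Sum>j\<in>J. \<Sum>e\<in>{1..n j}.
     Polynomial.smult (c (j,e)) ([:- b j, 1:] ^ (n j - e) * (\<Prod>i\<in>J - {j}. [:- b i, 1:] ^ n i)))"
  have W: "poly W t = c0 * poly (pf_denom n) t + (\<Sum>j\<in>J. \<Sum>e\<in>{1..n j}.
     c (j,e) * ((t - b j) ^ (n j - e) * (\<Prod>i\<in>J - {j}. (t - b i) ^ n i)))" for t
    by (simp add: W_def poly_sum poly_prod poly_power)
  show "poly W t = pf_sum n c0 c t * poly (pf_denom n) t" if t: "t \<notin> b ` J" for t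
  proof -
    have "c (j,e) * ((t - b j) ^ (n j - e) * (\<Prod>i\<in>J - {j}. (t - b i) ^ n i))
        = c (j,e) / (t - b j) ^ e * poly (pf_denom n) t" if "j \<in> J" "e \<in> {1..n j}" for j e
    proof -
      have "(t - b j) ^ n j = (t - b j) ^ e * (t - b j) ^ (n j - e)" using that by (simp flip: power_add)
      moreover have "poly (pf_denom n) t = (t - b j) ^ n j * (\<Prod>i\<in>J - {j}. (t - b i) ^ n i)"
        unfolding poly_pf_denom using finJ that by (intro prod.remove) auto
      moreover have "t - b j \<noteq> 0" using t that by auto
      ultimately show ?thesis by simp
    qed
    then show ?thesis unfolding W pf_sum_def by (simp add: distrib_right sum_distrib_right)
  qed
  show "poly W (b k) = c (k, n k) * (\<Prod>j\<in>J - {k}. (b k - b j) ^ n j)" if k: "k \<in> J" "n k > 0" for k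
  proof -
    have den: "poly (pf_denom n) (b k) = 0"
      unfolding poly_pf_denom using finJ k by (subst prod_zero_iff) auto
    have z: "(\<Prod>i\<in>J - {j}. (b k - b i) ^ n i) = 0" if "j \<in> J - {k}" for j
      using finJ k that by (subst prod_zero_iff) auto
    have "poly W (b k) = (\<Sum>e\<in>{1..n k}. c (k,e) * ((b k - b k) ^ (n k - e) * (\<Prod>i\<in>J - {k}. (b k - b i) ^ n i)))"
      unfolding W den using finJ k z by (subst sum.remove[of _ k]) (auto intro!: sum.neutral)
    also have "\<dots> = c (k, n k) * (\<Prod>j\<in>J - {k}. (b k - b j) ^ n j)"
      using k(2) by (subst sum.remove[of _ "n k"]) (auto intro!: sum.neutral)
    finally show ?thesis .
  qed
qed

text \<open>
  Over the common denominator, the value of the numerator at \<open>b k\<close> is a nonzero multiple of the coefficient of highest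
  order at \<open>b k\<close>; that coefficient therefore vanishes, and the total order decreases.
\<close>

lemma partial_fractions_zero:
  assumes U: "infinite U" "U \<inter> b ` J = {}" and z: "\<And>t. t \<in> U \<Longrightarrow> pf_sum n c0 c t = 0"
  shows "c0 = 0 \<and> (\<forall>j\<in>J. \<forall>e\<in>{1..n j}. c (j,e) = 0)"
  using z
proof (induction "\<Sum>j\<in>J. n j" arbitrary: n)
  case 0
  then have n0: "n j = 0" if "j \<in> J" for j using finJ that by simp
  obtain t where "t \<in> U" using U by fastforce
  from 0(2)[OF this] show ?case using n0 by (simp add: pf_sum_def)
next
  case (Suc d)
  note d = Suc.hyps(2)[symmetric]
  obtain k where k: "k \<in> J" "n k > 0"
  proof -
    have "\<not> (\<forall>j\<in>J. n j = 0)"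
    proof
      assume "\<forall>j\<in>J. n j = 0"
      then have "(\<Sum>j\<in>J. n j) = 0" by simp
      then show False using d by simp
    qed
    then show thesis using that by auto
  qed
  obtain W where W: "\<And>t. t \<notin> b ` J \<Longrightarrow> poly W t = pf_sum n c0 c t * poly (pf_denom n) t"
    and Wk: "\<And>k. k \<in> J \<Longrightarrow> n k > 0 \<Longrightarrow> poly W (b k) = c (k, n k) * (\<Prod>j\<in>J - {k}. (b k - b j) ^ n j)"
    using pf_numerator[of n c0 c] by blast
  have "U \<subseteq> {t. poly W t = 0}"
  proof
    fix t assume t: "t \<in> U"
    then have "t \<notin> b ` J" using U by auto
    with Suc.prems[OF t] W show "t \<in> {t. poly W t = 0}" by simp
  qed
  then have "W = 0" using U(1) poly_roots_finite finite_subset by blast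
  moreover have "(\<Prod>j\<in>J - {k}. (b k - b j) ^ n j) \<noteq> 0"
    using finJ injb k by (auto simp: inj_on_def)
  ultimately have ck: "c (k, n k) = 0" using Wk[OF k] by simp
  define n' where "n' = n(k := n k - 1)"
  have split: "(\<Sum>j\<in>J. f j) = f k + (\<Sum>j\<in>J-{k}. f j)" for f :: "'i \<Rightarrow> 'b::comm_monoid_add"
    using finJ k by (intro sum.remove)
  have dn': "d = (\<Sum>j\<in>J. n' j)"
  proof -
    have "(\<Sum>j\<in>J - {k}. n' j) = (\<Sum>j\<in>J - {k}. n j)" by (intro sum.cong) (auto simp: n'_def)
    then show ?thesis using d k(2) unfolding split[of n] split[of n'] by (simp add: n'_def)
  qed
  have "pf_sum n' c0 c t = pf_sum n c0 c t" for t
  proof -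
    have "{1..n k} = insert (n k) {1..n k - 1}" using k(2) by auto
    then have "(\<Sum>e\<in>{1..n k}. c (k,e) / (t - b k) ^ e) = (\<Sum>e\<in>{1..n k - 1}. c (k,e) / (t - b k) ^ e)"
      using k(2) ck by (simp add: sum.insert_if)
    then show ?thesis by (simp add: pf_sum_def split n'_def)
  qed
  then have "c0 = 0 \<and> (\<forall>j\<in>J. \<forall>e\<in>{1..n' j}. c (j,e) = 0)"
    using Suc.hyps(1)[OF dn'] Suc.prems by simp
  moreover have "c (j,e) = 0" if "j \<in> J" "e \<in> {1..n j}" "\<not> e \<in> {1..n' j}" for j e
  proof -
    have "j = k" "e = n k" using that by (auto simp: n'_def split: if_splits)
    then show ?thesis using ck by simp
  qed
  ultimately show ?case by blast
qed

end

text \<open>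
  The sums of \<^const>\<open>simple_fractions\<close> are partial fractions with simple poles at the \<open>s k\<close> and poles of order
  \<open>\<rho> j\<close> at the \<open>- y j\<close>.  The translation reverses the order of the terms at \<open>- y j\<close> and absorbs the powers of \<open>y j\<close>
  into the coefficients, which needs \<open>y j \<noteq> 0\<close>.
\<close>

locale fraction_shape =
  fixes N :: nat and s :: "nat \<Rightarrow> complex" and \<sigma> :: nat and y :: "nat \<Rightarrow> complex" and \<rho> :: "nat \<Rightarrow> nat"
  assumes inj_s: "inj_on s {1..<N}" and inj_y: "inj_on y {..<\<sigma>}"
    and s_y: "\<And>k j. k \<in> {1..<N} \<Longrightarrow> j < \<sigma> \<Longrightarrow> s k \<noteq> - y j" and y_nz: "\<And>j. j < \<sigma> \<Longrightarrow> y j \<noteq> 0"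
begin

definition poles :: "complex set" where "poles = s ` {1..<N} \<union> (\<lambda>j. - y j) ` {..<\<sigma>}"
definition denom :: "complex \<Rightarrow> complex" where
  "denom t = (\<Prod>k\<in>{1..<N}. t - s k) * (\<Prod>j<\<sigma>. (t + y j) ^ \<rho> j)"
definition total :: nat where "total = (N - 1) + (\<Sum>j<\<sigma>. \<rho> j)"

abbreviation "SF \<equiv> simple_fractions N s \<sigma> y \<rho>"
abbreviation "K \<equiv> {1..<N} <+> {..<\<sigma>}"
definition "pole = case_sum s (\<lambda>j. - y j)"
definition "ord_at = case_sum (\<lambda>_::nat. 1::nat) \<rho>"
definition scaled :: "(nat \<Rightarrow> complex) \<Rightarrow> (nat \<times> nat \<Rightarrow> complex) \<Rightarrow> (nat + nat) \<times> nat \<Rightarrow> complex" where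
  "scaled c c'' = (\<lambda>(i,e). case i of Inl k \<Rightarrow> c k | Inr j \<Rightarrow> c'' (j, \<rho> j + 1 - e) * y j ^ e)"

lemma finK: "finite K" by simp

lemma inj_pole: "inj_on pole K"
proof (rule inj_onI)
  fix u v assume uv: "u \<in> K" "v \<in> K" and e: "pole u = pole v"
  show "u = v"
  proof (cases u; cases v)
    fix k l assume "u = Inl k" "v = Inl l"
    then show ?thesis using uv e inj_onD[OF inj_s, of k l] by (auto simp: pole_def)
  next
    fix k l assume "u = Inr k" "v = Inr l"
    then show ?thesis using uv e inj_onD[OF inj_y, of k l] by (auto simp: pole_def)
  next
    fix k l assume "u = Inl k" "v = Inr l"
    then show ?thesis using uv e s_y[of k l] by (auto simp: pole_def)
  next
    fix k l assume "u = Inr k" "v = Inl l"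
    then show ?thesis using uv e s_y[of l k] by (auto simp: pole_def)
  qed
qed

lemma poles_eq: "pole ` K = poles"
  by (auto simp: pole_def poles_def Plus_def image_Un image_image)

lemma denom_eq: "poly (pf_denom K pole ord_at) t = denom t"
  unfolding poly_pf_denom[OF finK inj_pole]
  by (subst prod.Plus) (auto simp: pole_def ord_at_def denom_def)

lemma total_eq: "(\<Sum>i\<in>K. ord_at i) = total"
  by (subst sum.Plus) (auto simp: ord_at_def total_def)

lemma denom_nonzero: "t \<notin> poles \<Longrightarrow> denom t \<noteq> 0"
  using pf_denom_nonzero[OF finK inj_pole, of t ord_at] unfolding poles_eq denom_eq .

lemma SF_eq: "SF c0 c c'' t = pf_sum K pole ord_at c0 (scaled c c'') t"
proof -
  have "(\<Sum>l\<in>{1..\<rho> j}. c'' (j,l) * y j ^ (\<rho> j - l + 1) / (t + y j) ^ (\<rho> j - l + 1))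
      = (\<Sum>e\<in>{1..\<rho> j}. scaled c c'' (Inr j, e) / (t + y j) ^ e)" for j
    by (rule sum.reindex_bij_witness[of _ "\<lambda>e. \<rho> j + 1 - e" "\<lambda>l. \<rho> j + 1 - l"])
       (auto simp: scaled_def Suc_diff_le)
  then show ?thesis
    unfolding simple_fractions_def pf_sum_def[OF finK inj_pole]
    by (subst sum.Plus) (auto simp: pole_def ord_at_def scaled_def)
qed

abbreviation "I1 \<equiv> extensional {1..<N}"
abbreviation "I2 \<equiv> extensional (SIGMA j:{..<\<sigma>}. {1..\<rho> j})"

lemma SF_exists:
  assumes "degree P \<le> total"
  obtains c c'' where "c \<in> I1" "c'' \<in> I2"
    and "\<And>t. t \<notin> poles \<Longrightarrow> SF (coeff P total) c c'' t = poly P t / denom t"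
proof -
  obtain d where d: "\<And>t. t \<notin> poles \<Longrightarrow> pf_sum K pole ord_at (coeff P total) d t = poly P t / denom t"
    using partial_fractions_exist[OF finK inj_pole, of P ord_at] assms
    unfolding total_eq poles_eq denom_eq by blast
  define c where "c = restrict (\<lambda>k. d (Inl k, 1)) {1..<N}"
  define c'' where "c'' = restrict (\<lambda>(j,l). d (Inr j, \<rho> j + 1 - l) / y j ^ (\<rho> j + 1 - l)) (SIGMA j:{..<\<sigma>}. {1..\<rho> j})"
  have "pf_sum K pole ord_at (coeff P total) (scaled c c'') t = pf_sum K pole ord_at (coeff P total) d t" for t
    unfolding pf_sum_def[OF finK inj_pole]
  proof (intro arg_cong2[of _ _ _ _ "(+)"] sum.cong refl arg_cong2[of _ _ _ _ "(/)"])
    fix i e assume i: "i \<in> K" and e: "e \<in> {1..ord_at i}"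
    show "scaled c c'' (i,e) = d (i,e)"
    proof (cases i)
      case (Inl k) then show ?thesis using i e by (auto simp: scaled_def c_def ord_at_def)
    next
      case (Inr j)
      have "\<rho> j + 1 - (\<rho> j + 1 - e) = e" "\<rho> j + 1 - e \<in> {1..\<rho> j}" "j < \<sigma>"
        using i e Inr by (auto simp: ord_at_def)
      then show ?thesis using y_nz[of j] Inr by (simp add: scaled_def c''_def)
    qed
  qed
  then show ?thesis using that[of c c''] d by (simp add: SF_eq c_def c''_def)
qed

lemma SF_numerator:
  obtains W where "\<And>t. t \<notin> poles \<Longrightarrow> SF c0 c c'' t = poly W t / denom t"
proof -
  obtain W where "\<And>t. t \<notin> poles \<Longrightarrow> poly W t = pf_sum K pole ord_at c0 (scaled c c'') t * denom t"
    using pf_numerator[OF finK inj_pole, of ord_at c0 "scaled c c''"] unfolding poles_eq denom_eq by metis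
  then show ?thesis using that[of W] denom_nonzero by (simp add: SF_eq)
qed

lemma SF_zero:
  assumes U: "infinite U" "U \<inter> poles = {}" and z: "\<And>t. t \<in> U \<Longrightarrow> SF c0 c c'' t = 0"
  shows "c0 = 0" "\<And>k. k \<in> {1..<N} \<Longrightarrow> c k = 0"
    "\<And>j l. j < \<sigma> \<Longrightarrow> l \<in> {1..\<rho> j} \<Longrightarrow> c'' (j,l) = 0"
proof -
  have *: "c0 = 0 \<and> (\<forall>j\<in>K. \<forall>e\<in>{1..ord_at j}. scaled c c'' (j,e) = 0)"
    by (rule partial_fractions_zero[OF finK inj_pole U(1) U(2)[folded poles_eq]]) (use z in \<open>auto simp: SF_eq\<close>)
  then show "c0 = 0" by simp
  show "c k = 0" if "k \<in> {1..<N}" for k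
    using *[THEN conjunct2, rule_format, OF InlI[OF that], of 1] by (auto simp: scaled_def ord_at_def)
  show "c'' (j,l) = 0" if "j < \<sigma>" "l \<in> {1..\<rho> j}" for j l
  proof -
    have "\<rho> j + 1 - (\<rho> j + 1 - l) = l" "\<rho> j + 1 - l \<in> {1..\<rho> j}" using that by auto
    moreover have "j \<in> {..<\<sigma>}" using that by simp
    ultimately show ?thesis
      using *[THEN conjunct2, rule_format, OF InrI, of j "\<rho> j + 1 - l"] y_nz[of j] by (auto simp: scaled_def ord_at_def)
  qed
qed

lemma SF_diff: "SF c0 c c'' t - SF d0 d d'' t = SF (c0 - d0) (\<lambda>k. c k - d k) (\<lambda>x. c'' x - d'' x) t"
  by (simp add: simple_fractions_def sum_subtractf[symmetric] diff_divide_distrib[symmetric] left_diff_distrib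
        flip: sum_subtractf) (simp add: sum_subtractf diff_divide_distrib left_diff_distrib)

lemma SF_unique:
  assumes U: "infinite U" "U \<inter> poles = {}" and z: "\<And>t. t \<in> U \<Longrightarrow> SF c0 c c'' t = SF d0 d d'' t"
    and "c \<in> I1" "d \<in> I1" "c'' \<in> I2" "d'' \<in> I2"
  shows "c0 = d0" "c = d" "c'' = d''"
proof -
  have "SF (c0 - d0) (\<lambda>k. c k - d k) (\<lambda>x. c'' x - d'' x) t = 0" if "t \<in> U" for t
    using z[OF that] SF_diff[of c0 c c'' t d0 d d''] by simp
  note 0 = SF_zero[OF U this]
  show "c0 = d0" using 0(1) by simp
  show "c = d" using 0(2) assms(4,5) by (intro extensionalityI) auto
  show "c'' = d''" using 0(3) assms(6,7) by (intro extensionalityI) auto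
qed

end

section \<open>Polynomials in the argument and the service time transform\<close>

text \<open>
  The value of a polynomial whose outer indeterminate stands for the service time transform and whose inner one
  stands for the argument of the transform, as in \<^const>\<open>E_formal\<close>.
\<close>

definition bipoly :: "complex poly poly \<Rightarrow> complex \<Rightarrow> complex \<Rightarrow> complex" where
  "bipoly F f t = poly (poly F [:f:]) t"

lemma bipoly_simps [simp]:
  "bipoly 0 f t = 0" "bipoly 1 f t = 1" "bipoly (F + G) f t = bipoly F f t + bipoly G f t"
  "bipoly (F - G) f t = bipoly F f t - bipoly G f t"
  "bipoly (- F) f t = - bipoly F f t"
  "bipoly (F * G) f t = bipoly F f t * bipoly G f t" "bipoly (Polynomial.smult a F) f t = poly a t * bipoly F f t"
  "bipoly (pCons a F) f t = poly a t + f * bipoly F f t"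
  by (simp_all add: bipoly_def)

lemma bipoly_sum: "bipoly (sum F A) f t = (\<Sum>x\<in>A. bipoly (F x) f t)"
  by (induction A rule: infinite_finite_induct) simp_all

lemma bipoly_deriv: "((\<lambda>f. bipoly F f t) has_field_derivative bipoly (pderiv F) f t) (at f)"
proof (induction F)
  case (pCons a F)
  show ?case
    by (auto simp: pderiv_pCons intro!: derivative_eq_intros pCons.IH)
qed simp

interpretation bipoly_hom: comm_ring_hom "\<lambda>F. bipoly F f t" for f t
  by unfold_locales auto

lemma adj_mat_hom:
  assumes "A \<in> carrier_mat n n" "i < n" "j < n"
  shows "adj_mat (map_mat (\<lambda>F. bipoly F f t) A) $$ (i,j) = bipoly (adj_mat A $$ (i,j)) f t"
proof -
  have "mat_delete (map_mat (\<lambda>F. bipoly F f t) A) j i = map_mat (\<lambda>F. bipoly F f t) (mat_delete A j i)"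
    using assms by (intro eq_matI) (auto simp: mat_delete_def)
  then show ?thesis using assms
    by (simp add: adj_mat_def cofactor_def bipoly_hom.hom_det) (cases "even (j + i)"; simp)
qed

text \<open>With \<open>f = q/p\<close>, the degree in the outer indeterminate bounds the power of \<open>p\<close> in the denominator.\<close>

lemma bipoly_homogenize:
  assumes "degree F \<le> r"
  obtains P where "\<And>t. poly p t \<noteq> 0 \<Longrightarrow> poly p t ^ r * bipoly F (poly q t / poly p t) t = poly P t"
proof
  fix t assume t: "poly p t \<noteq> 0"
  have e: "bipoly F (poly q t / poly p t) t = (\<Sum>k\<le>degree F. poly (coeff F k) t * (poly q t / poly p t) ^ k)"
    by (simp add: bipoly_def poly_altdef[of F] poly_sum poly_power)
  have T: "poly p t ^ r * (poly (coeff F k) t * (poly q t / poly p t) ^ k)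
     = poly (coeff F k) t * poly q t ^ k * poly p t ^ (r - k)" if "k \<le> degree F" for k
  proof -
    have "poly p t ^ r = poly p t ^ k * poly p t ^ (r - k)" using that assms by (simp flip: power_add)
    then show ?thesis using t by (simp add: power_divide)
  qed
  show "poly p t ^ r * bipoly F (poly q t / poly p t) t
     = poly (\<Sum>k\<le>degree F. coeff F k * q ^ k * p ^ (r - k)) t"
    unfolding e sum_distrib_left poly_sum
    by (intro sum.cong refl) (simp only: T atMost_iff poly_mult poly_power)
qed

section \<open>First-order perturbation of the stationary equation\<close>

abbreviation (input) eps :: "real \<Rightarrow> complex" where "eps \<equiv> \<lambda>\<epsilon>. complex_of_real \<epsilon>"
abbreviation (input) eps2 :: "real \<Rightarrow> complex" where "eps2 \<equiv> \<lambda>\<epsilon>. complex_of_real (\<epsilon>\<^sup>2)"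
abbreviation (input) one_fun :: "real \<Rightarrow> complex" where "one_fun \<equiv> \<lambda>_. 1"

lemma eps_times: "f \<in> O[at_right 0](one_fun) \<Longrightarrow> (\<lambda>\<epsilon>. eps \<epsilon> * f \<epsilon>) \<in> O[at_right 0](eps)"
  using landau_o.big.mult[OF landau_o.big_refl[of eps "at_right 0"], of f one_fun] by simp

lemma eps_times2: "f \<in> O[at_right 0](eps) \<Longrightarrow> (\<lambda>\<epsilon>. eps \<epsilon> * f \<epsilon>) \<in> O[at_right 0](eps2)"
  using landau_o.big.mult[OF landau_o.big_refl[of eps "at_right 0"], of f eps] by (simp add: power2_eq_square)

lemma bigo_eventually_cong:
  "eventually (\<lambda>\<epsilon>. f \<epsilon> = g \<epsilon>) (at_right 0) \<Longrightarrow> g \<in> O[at_right 0](h) \<Longrightarrow> f \<in> O[at_right (0::real)](h)"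
  for f g h :: "real \<Rightarrow> complex"
  using landau_o.big.in_cong by blast

lemma bigo_mult_const: "f \<in> O[F](g) \<Longrightarrow> (\<lambda>x. f x * c) \<in> O[F](g)" "f \<in> O[F](g) \<Longrightarrow> (\<lambda>x. c * f x) \<in> O[F](g)"
  "f \<in> O[F](g) \<Longrightarrow> (\<lambda>x. f x / c) \<in> O[F](g)"
  for f g :: "real \<Rightarrow> complex"
  using landau_o.big.mult[of f F g "\<lambda>_. c" "\<lambda>_. 1"] landau_o.big.mult[of f F g "\<lambda>_. inverse c" "\<lambda>_. 1"]
  by (simp_all add: divide_inverse mult.commute[of c])

text \<open>
  The queueing content is reduced to a family of vector functions \<open>\<Phi> \<epsilon>\<close>, uniformly bounded by \<open>1\<close> and
  holomorphic in the right half-plane, that solve \<open>\<Phi> (E + \<epsilon> k R) = t \<nu>\<close>; the parameter \<open>\<epsilon> = 0\<close> is included.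
  The matrix \<open>Ai\<close> is a right inverse of the one with columns \<open>l0\<close> and \<open>a\<^sub>i\<close>, the latter being column \<open>m i\<close> of
  \<open>adj E(s\<^sub>i)\<close>.
\<close>

locale perturbed_family =
  fixes N :: nat and E :: "complex \<Rightarrow> complex mat" and R :: "complex mat" and k :: "complex \<Rightarrow> complex"
    and \<Phi> :: "real \<Rightarrow> complex \<Rightarrow> nat \<Rightarrow> complex" and \<nu> :: "real \<Rightarrow> nat \<Rightarrow> complex" and \<epsilon>0 :: real
    and s :: "nat \<Rightarrow> complex" and m :: "nat \<Rightarrow> nat" and l0 :: "nat \<Rightarrow> complex" and c0 d0 :: complex
    and Ai :: "nat \<Rightarrow> nat \<Rightarrow> complex"
  assumes E: "\<And>t. E t \<in> carrier_mat N N" and R: "R \<in> carrier_mat N N"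
    and e0: "\<epsilon>0 > 0"
    and eq: "\<And>\<epsilon> t j. 0 \<le> \<epsilon> \<Longrightarrow> \<epsilon> < \<epsilon>0 \<Longrightarrow> Re t \<ge> 0 \<Longrightarrow> j < N \<Longrightarrow>
      (\<Sum>i<N. \<Phi> \<epsilon> t i * (E t $$ (i,j) + eps \<epsilon> * k t * R $$ (i,j))) = t * \<nu> \<epsilon> j"
    and bound: "\<And>\<epsilon> t i. 0 \<le> \<epsilon> \<Longrightarrow> \<epsilon> < \<epsilon>0 \<Longrightarrow> Re t \<ge> 0 \<Longrightarrow> i < N \<Longrightarrow> norm (\<Phi> \<epsilon> t i) \<le> 1"
    and hol: "\<And>\<epsilon> i. 0 \<le> \<epsilon> \<Longrightarrow> \<epsilon> < \<epsilon>0 \<Longrightarrow> i < N \<Longrightarrow> (\<lambda>t. \<Phi> \<epsilon> t i) holomorphic_on {t. Re t > 0}"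
    and holk: "k holomorphic_on {t. Re t > 0}"
    and holE: "\<And>i j. i < N \<Longrightarrow> j < N \<Longrightarrow> (\<lambda>t. E t $$ (i,j)) holomorphic_on {t. Re t > 0}"
    and roots: "\<And>i. i \<in> {1..<N} \<Longrightarrow> Re (s i) > 0 \<and> det (E (s i)) = 0 \<and> deriv (\<lambda>t. det (E t)) (s i) \<noteq> 0 \<and> m i < N"
    and norm_eq: "\<And>\<epsilon>. 0 \<le> \<epsilon> \<Longrightarrow> \<epsilon> < \<epsilon>0 \<Longrightarrow> (\<Sum>j<N. \<nu> \<epsilon> j * l0 j) = c0 + eps \<epsilon> * d0"
    and Ai: "\<And>j l. j < N \<Longrightarrow> l < N \<Longrightarrow>
      l0 j * Ai 0 l + (\<Sum>i\<in>{1..<N}. adj_mat (E (s i)) $$ (j, m i) * Ai i l) = (if j = l then 1 else 0)"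
begin

abbreviation adjE :: "complex \<Rightarrow> nat \<Rightarrow> nat \<Rightarrow> complex" where "adjE t j l \<equiv> adj_mat (E t) $$ (j,l)"
definition \<Phi>R :: "real \<Rightarrow> complex \<Rightarrow> nat \<Rightarrow> complex" where "\<Phi>R \<epsilon> t j = (\<Sum>i<N. \<Phi> \<epsilon> t i * R $$ (i,j))"
definition \<kappa> :: "real \<Rightarrow> nat \<Rightarrow> nat \<Rightarrow> complex" where
  "\<kappa> \<epsilon> i l = (\<Sum>j<N. k (s i) * \<Phi>R \<epsilon> (s i) j * adjE (s i) j l) / s i"
definition z :: "nat \<Rightarrow> complex" where
  "z l = d0 * Ai 0 l + (\<Sum>i\<in>{1..<N}. \<kappa> 0 i (m i) * Ai i l)"

lemma eventually_small: "eventually (\<lambda>\<epsilon>. 0 \<le> \<epsilon> \<and> \<epsilon> < \<epsilon>0) (at_right 0)"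
  using eventually_at_right_real[OF e0] by (auto elim: eventually_mono)

lemma adjE_deriv:
  assumes "Re t > 0" "i < N" "j < N"
  shows "((\<lambda>t. adjE t i j) has_field_derivative adj_dir (E t) (mat_deriv E t) $$ (i,j)) (at t)"
proof (rule has_field_derivative_adj[OF E _ _ assms(2,3)])
  show "mat_deriv E t \<in> carrier_mat N N" using E[of t] by (auto simp: mat_deriv_def)
  fix i j assume "i < N" "j < N"
  then show "((\<lambda>t. E t $$ (i,j)) has_field_derivative mat_deriv E t $$ (i,j)) (at t)"
    using E[of t] holomorphic_derivI[OF holE, of i j t] assms(1) by (simp add: mat_deriv_def open_halfspace_Re_gt)
qed

lemma E_deriv:
  assumes "Re t > 0" "i < N" "j < N"
  shows "((\<lambda>t. E t $$ (i,j)) has_field_derivative mat_deriv E t $$ (i,j)) (at t)"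
  using E[of t] holomorphic_derivI[OF holE, of i j t] assms by (simp add: mat_deriv_def open_halfspace_Re_gt)

lemma det_deriv:
  assumes "Re t > 0"
  shows "((\<lambda>t. det (E t)) has_field_derivative det_dir (E t) (mat_deriv E t)) (at t)"
  by (rule has_field_derivative_det[OF E]) (use E[of t] E_deriv[OF assms] in \<open>auto simp: mat_deriv_def\<close>)

lemma Phi_deriv:
  "0 \<le> \<epsilon> \<Longrightarrow> \<epsilon> < \<epsilon>0 \<Longrightarrow> i < N \<Longrightarrow> Re t > 0 \<Longrightarrow>
   ((\<lambda>t. \<Phi> \<epsilon> t i) has_field_derivative deriv (\<lambda>t. \<Phi> \<epsilon> t i) t) (at t)"
  using holomorphic_derivI[OF hol, of \<epsilon> i t] by (simp add: open_halfspace_Re_gt)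

lemma k_deriv: "Re t > 0 \<Longrightarrow> (k has_field_derivative deriv k t) (at t)"
  using holomorphic_derivI[OF holk, of t] by (simp add: open_halfspace_Re_gt)

text \<open>
  The bound on \<open>\<Phi>\<close> passes to its derivative by Cauchy's inequality on the disc of radius \<open>Re t / 2\<close>; the result
  does not depend on \<open>\<epsilon>\<close>.
\<close>

lemma norm_deriv_Phi_le:
  assumes e: "0 \<le> \<epsilon>" "\<epsilon> < \<epsilon>0" and i: "i < N" and t: "Re t > 0"
  shows "norm (deriv (\<lambda>t. \<Phi> \<epsilon> t i) t) \<le> 2 / Re t"
proof -
  let ?r = "Re t / 2"
  have sub: "cball t ?r \<subseteq> {t. Re t > 0}"
  proof
    fix x assume "x \<in> cball t ?r"
    then have "norm (t - x) \<le> ?r" by (simp add: dist_norm)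
    then have "\<bar>Re (t - x)\<bar> \<le> ?r" using abs_Re_le_cmod order_trans by blast
    then have "\<bar>Re t - Re x\<bar> \<le> Re t / 2" by simp
    then have "Re x > 0" using t by linarith
    then show "x \<in> {t. Re t > 0}" by simp
  qed
  have "norm ((deriv ^^ 1) (\<lambda>t. \<Phi> \<epsilon> t i) t) \<le> fact 1 * 1 / ?r ^ 1"
  proof (rule Cauchy_inequality)
    show "(\<lambda>t. \<Phi> \<epsilon> t i) holomorphic_on ball t ?r"
      by (rule holomorphic_on_subset[OF hol[OF e i]]) (use sub ball_subset_cball in blast)
    show "continuous_on (cball t ?r) (\<lambda>t. \<Phi> \<epsilon> t i)"
      by (rule continuous_on_subset[OF holomorphic_on_imp_continuous_on[OF hol[OF e i]] sub])
    show "0 < ?r" using t by simp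
    fix x assume "norm (t - x) = ?r"
    then have "x \<in> cball t ?r" by (simp add: dist_norm)
    then have "x \<in> {t. Re t > 0}" using sub by blast
    then show "norm (\<Phi> \<epsilon> x i) \<le> 1" using bound[OF e _ i] by simp
  qed
  then show ?thesis by simp
qed

lemma Phi_bigo: "i < N \<Longrightarrow> Re t \<ge> 0 \<Longrightarrow> (\<lambda>\<epsilon>. \<Phi> \<epsilon> t i) \<in> O[at_right 0](one_fun)"
  by (rule bigoI[of _ 1]) (use eventually_small in \<open>eventually_elim; simp add: bound\<close>)

lemma deriv_Phi_bigo: "i < N \<Longrightarrow> Re t > 0 \<Longrightarrow> (\<lambda>\<epsilon>. deriv (\<lambda>t. \<Phi> \<epsilon> t i) t) \<in> O[at_right 0](one_fun)"
  by (rule bigoI[of _ "2 / Re t"]) (use eventually_small in \<open>eventually_elim; simp add: norm_deriv_Phi_le\<close>)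

lemma PhiR_bigo: "Re t \<ge> 0 \<Longrightarrow> (\<lambda>\<epsilon>. \<Phi>R \<epsilon> t j) \<in> O[at_right 0](one_fun)"
  unfolding \<Phi>R_def by (intro big_sum_in_bigo bigo_mult_const Phi_bigo) auto

text \<open>The stationary equation multiplied by the adjugate of the unperturbed matrix, so that the roots involved do not
  depend on \<open>\<epsilon>\<close>.\<close>

lemma Phi_times_det:
  assumes e: "0 \<le> \<epsilon>" "\<epsilon> < \<epsilon>0" and t: "Re t \<ge> 0" and l: "l < N"
  shows "\<Phi> \<epsilon> t l * det (E t) = (\<Sum>j<N. (t * \<nu> \<epsilon> j - eps \<epsilon> * (k t * \<Phi>R \<epsilon> t j)) * adjE t j l)"
proof (rule row_times_adj[OF E _ l])
  fix j assume j: "j < N"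
  show "(\<Sum>i<N. \<Phi> \<epsilon> t i * E t $$ (i,j)) = t * \<nu> \<epsilon> j - eps \<epsilon> * (k t * \<Phi>R \<epsilon> t j)"
    using eq[OF e t j] by (simp add: \<Phi>R_def distrib_left sum.distrib sum_distrib_left mult_ac algebra_simps)
qed

lemma nu_root:
  assumes e: "0 \<le> \<epsilon>" "\<epsilon> < \<epsilon>0" and i: "i \<in> {1..<N}" and l: "l < N"
  shows "(\<Sum>j<N. \<nu> \<epsilon> j * adjE (s i) j l) = eps \<epsilon> * \<kappa> \<epsilon> i l"
proof -
  have si: "s i \<noteq> 0" "Re (s i) \<ge> 0" using roots[OF i] by auto
  have "0 = (\<Sum>j<N. (s i * \<nu> \<epsilon> j - eps \<epsilon> * (k (s i) * \<Phi>R \<epsilon> (s i) j)) * adjE (s i) j l)"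
    using Phi_times_det[OF e si(2) l] roots[OF i] by simp
  also have "\<dots> = s i * (\<Sum>j<N. \<nu> \<epsilon> j * adjE (s i) j l) - eps \<epsilon> * (s i * \<kappa> \<epsilon> i l)"
  proof -
    have sk: "s i * \<kappa> \<epsilon> i l = (\<Sum>j<N. k (s i) * \<Phi>R \<epsilon> (s i) j * adjE (s i) j l)"
      using si(1) by (simp add: \<kappa>_def)
    show ?thesis unfolding sk by (simp add: left_diff_distrib sum_subtractf sum_distrib_left mult.assoc)
  qed
  finally have "s i * (\<Sum>j<N. \<nu> \<epsilon> j * adjE (s i) j l) = s i * (eps \<epsilon> * \<kappa> \<epsilon> i l)" by (simp add: mult_ac)
  then show ?thesis using si(1) by (simp only: mult_cancel_left simp_thms)
qed

text \<open>The \<open>N\<close> equations for \<open>\<nu>\<close>, one from the normalisation and one from each root, solved with the inverse matrix.\<close>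

lemma nu_formula:
  assumes e: "0 \<le> \<epsilon>" "\<epsilon> < \<epsilon>0" and l: "l < N"
  shows "\<nu> \<epsilon> l = (c0 + eps \<epsilon> * d0) * Ai 0 l + (\<Sum>i\<in>{1..<N}. eps \<epsilon> * \<kappa> \<epsilon> i (m i) * Ai i l)"
proof -
  have "\<nu> \<epsilon> l = (\<Sum>j<N. \<nu> \<epsilon> j * (if j = l then 1 else 0))"
    using l by (simp add: if_distrib[of "(*) _"] cong: if_cong)
  also have "\<dots> = (\<Sum>j<N. \<nu> \<epsilon> j * (l0 j * Ai 0 l + (\<Sum>i\<in>{1..<N}. adjE (s i) j (m i) * Ai i l)))"
    by (intro sum.cong refl) (simp only: lessThan_iff Ai[OF _ l])
  also have "\<dots> = (\<Sum>j<N. \<nu> \<epsilon> j * l0 j) * Ai 0 l + (\<Sum>i\<in>{1..<N}. (\<Sum>j<N. \<nu> \<epsilon> j * adjE (s i) j (m i)) * Ai i l)"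
    unfolding distrib_left sum.distrib sum_distrib_left sum_distrib_right
    by (subst (2) sum.swap) (simp only: mult.assoc)
  also have "\<dots> = (c0 + eps \<epsilon> * d0) * Ai 0 l + (\<Sum>i\<in>{1..<N}. eps \<epsilon> * \<kappa> \<epsilon> i (m i) * Ai i l)"
  proof -
    have "(\<Sum>i\<in>{1..<N}. (\<Sum>j<N. \<nu> \<epsilon> j * adjE (s i) j (m i)) * Ai i l) = (\<Sum>i\<in>{1..<N}. eps \<epsilon> * \<kappa> \<epsilon> i (m i) * Ai i l)"
      by (intro sum.cong refl) (use nu_root[OF e] roots in auto)
    then show ?thesis by (simp only: norm_eq[OF e])
  qed
  finally show ?thesis .
qed

lemma nu_diff:
  assumes e: "0 \<le> \<epsilon>" "\<epsilon> < \<epsilon>0" and l: "l < N"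
  shows "\<nu> \<epsilon> l - \<nu> 0 l = eps \<epsilon> * (d0 * Ai 0 l + (\<Sum>i\<in>{1..<N}. \<kappa> \<epsilon> i (m i) * Ai i l))"
  unfolding nu_formula[OF e l] nu_formula[OF order.refl e0 l]
  by (simp add: algebra_simps sum_distrib_left)

lemma kappa_bigo: "i \<in> {1..<N} \<Longrightarrow> (\<lambda>\<epsilon>. \<kappa> \<epsilon> i l) \<in> O[at_right 0](one_fun)"
  unfolding \<kappa>_def using roots by (intro bigo_mult_const big_sum_in_bigo PhiR_bigo) (auto intro: less_imp_le)

lemma nu_diff_bigo: assumes l: "l < N" shows "(\<lambda>\<epsilon>. \<nu> \<epsilon> l - \<nu> 0 l) \<in> O[at_right 0](eps)"
proof (rule bigo_eventually_cong)
  show "eventually (\<lambda>\<epsilon>. \<nu> \<epsilon> l - \<nu> 0 l = eps \<epsilon> * (d0 * Ai 0 l + (\<Sum>i\<in>{1..<N}. \<kappa> \<epsilon> i (m i) * Ai i l))) (at_right 0)"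
    using eventually_small by eventually_elim (simp add: nu_diff l)
  show "(\<lambda>\<epsilon>. eps \<epsilon> * (d0 * Ai 0 l + (\<Sum>i\<in>{1..<N}. \<kappa> \<epsilon> i (m i) * Ai i l))) \<in> O[at_right 0](eps)"
    by (intro eps_times sum_in_bigo big_sum_in_bigo bigo_mult_const kappa_bigo) auto
qed

text \<open>At a root \<open>s\<^sub>i\<close> of the determinant \<open>Phi_times_det\<close> does not determine \<open>\<Phi>\<close>, but its derivative does.\<close>

lemma Phi_root_formula:
  assumes e: "0 \<le> \<epsilon>" "\<epsilon> < \<epsilon>0" and i: "i \<in> {1..<N}" and l: "l < N"
  defines "\<sigma> \<equiv> s i" and "a' \<equiv> \<lambda>j. adj_dir (E (s i)) (mat_deriv E (s i)) $$ (j,l)"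
  shows "\<Phi> \<epsilon> \<sigma> l * deriv (\<lambda>t. det (E t)) \<sigma> = (\<Sum>j<N. \<nu> \<epsilon> j * (adjE \<sigma> j l + \<sigma> * a' j))
    - eps \<epsilon> * (\<Sum>j<N. (deriv k \<sigma> * \<Phi>R \<epsilon> \<sigma> j + k \<sigma> * (\<Sum>i<N. deriv (\<lambda>t. \<Phi> \<epsilon> t i) \<sigma> * R $$ (i,j))) * adjE \<sigma> j l
        + k \<sigma> * \<Phi>R \<epsilon> \<sigma> j * a' j)"
proof -
  have sg: "Re \<sigma> > 0" "det (E \<sigma>) = 0" using roots[OF i] by (auto simp: \<sigma>_def)
  define P' where "P' j = (\<Sum>i<N. deriv (\<lambda>t. \<Phi> \<epsilon> t i) \<sigma> * R $$ (i,j))" for j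
  have PR: "((\<lambda>t. \<Phi>R \<epsilon> t j) has_field_derivative P' j) (at \<sigma>)" for j
    unfolding \<Phi>R_def P'_def by (intro DERIV_sum DERIV_cmult_right Phi_deriv e sg) simp
  have "((\<lambda>t. \<Phi> \<epsilon> t l * det (E t)) has_field_derivative
      deriv (\<lambda>t. \<Phi> \<epsilon> t l) \<sigma> * det (E \<sigma>) + det_dir (E \<sigma>) (mat_deriv E \<sigma>) * \<Phi> \<epsilon> \<sigma> l) (at \<sigma>)"
    by (intro DERIV_mult Phi_deriv det_deriv e l sg)
  then have 1: "((\<lambda>t. \<Phi> \<epsilon> t l * det (E t)) has_field_derivative \<Phi> \<epsilon> \<sigma> l * deriv (\<lambda>t. det (E t)) \<sigma>) (at \<sigma>)"
    using sg DERIV_imp_deriv[OF det_deriv[OF sg(1)]] by (simp add: mult.commute)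
  have 2: "((\<lambda>t. \<Sum>j<N. (t * \<nu> \<epsilon> j - eps \<epsilon> * (k t * \<Phi>R \<epsilon> t j)) * adjE t j l) has_field_derivative
      (\<Sum>j<N. (1 * \<nu> \<epsilon> j - eps \<epsilon> * (deriv k \<sigma> * \<Phi>R \<epsilon> \<sigma> j + P' j * k \<sigma>)) * adjE \<sigma> j l
        + a' j * (\<sigma> * \<nu> \<epsilon> j - eps \<epsilon> * (k \<sigma> * \<Phi>R \<epsilon> \<sigma> j)))) (at \<sigma>)"
    unfolding a'_def \<sigma>_def[symmetric]
    by (intro DERIV_sum DERIV_mult DERIV_diff DERIV_cmult_right DERIV_cmult DERIV_ident PR k_deriv adjE_deriv sg l) auto
  have ev: "eventually (\<lambda>t. \<Phi> \<epsilon> t l * det (E t) = (\<Sum>j<N. (t * \<nu> \<epsilon> j - eps \<epsilon> * (k t * \<Phi>R \<epsilon> t j)) * adjE t j l)) (nhds \<sigma>)"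
  proof -
    have "eventually (\<lambda>t. t \<in> {t. Re t > 0}) (nhds \<sigma>)"
      by (rule eventually_nhds_in_open) (use sg in \<open>auto simp: open_halfspace_Re_gt\<close>)
    then show ?thesis by eventually_elim (rule Phi_times_det[OF e _ l], simp)
  qed
  have "((\<lambda>t. \<Phi> \<epsilon> t l * det (E t)) has_field_derivative
      (\<Sum>j<N. (1 * \<nu> \<epsilon> j - eps \<epsilon> * (deriv k \<sigma> * \<Phi>R \<epsilon> \<sigma> j + P' j * k \<sigma>)) * adjE \<sigma> j l
        + a' j * (\<sigma> * \<nu> \<epsilon> j - eps \<epsilon> * (k \<sigma> * \<Phi>R \<epsilon> \<sigma> j)))) (at \<sigma>)"
    using DERIV_cong_ev[OF refl ev refl] 2 by blast
  from DERIV_unique[OF 1 this]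
  have "\<Phi> \<epsilon> \<sigma> l * deriv (\<lambda>t. det (E t)) \<sigma> =
      (\<Sum>j<N. (1 * \<nu> \<epsilon> j - eps \<epsilon> * (deriv k \<sigma> * \<Phi>R \<epsilon> \<sigma> j + P' j * k \<sigma>)) * adjE \<sigma> j l
        + a' j * (\<sigma> * \<nu> \<epsilon> j - eps \<epsilon> * (k \<sigma> * \<Phi>R \<epsilon> \<sigma> j)))" .
  also have "\<dots> = (\<Sum>j<N. \<nu> \<epsilon> j * (adjE \<sigma> j l + \<sigma> * a' j)
      - eps \<epsilon> * ((deriv k \<sigma> * \<Phi>R \<epsilon> \<sigma> j + k \<sigma> * P' j) * adjE \<sigma> j l + k \<sigma> * \<Phi>R \<epsilon> \<sigma> j * a' j))"
    by (intro sum.cong refl) (simp add: algebra_simps)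
  finally show ?thesis by (simp only: sum_subtractf sum_distrib_left P'_def)
qed

lemma Phi_root_diff_bigo:
  assumes i: "i \<in> {1..<N}" and l: "l < N"
  shows "(\<lambda>\<epsilon>. \<Phi> \<epsilon> (s i) l - \<Phi> 0 (s i) l) \<in> O[at_right 0](eps)"
proof -
  let ?s = "s i"
  define D where "D = deriv (\<lambda>t. det (E t)) ?s"
  define a' where "a' j = adj_dir (E ?s) (mat_deriv E ?s) $$ (j,l)" for j
  define X where "X \<epsilon> = (\<Sum>j<N. (deriv k ?s * \<Phi>R \<epsilon> ?s j + k ?s * (\<Sum>i<N. deriv (\<lambda>t. \<Phi> \<epsilon> t i) ?s * R $$ (i,j))) * adjE ?s j l
        + k ?s * \<Phi>R \<epsilon> ?s j * a' j)" for \<epsilon>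
  have D: "D \<noteq> 0" and sg: "Re ?s > 0" using roots[OF i] by (auto simp: D_def)
  have F: "\<Phi> \<epsilon> ?s l * D = (\<Sum>j<N. \<nu> \<epsilon> j * (adjE ?s j l + ?s * a' j)) - eps \<epsilon> * X \<epsilon>" if "0 \<le> \<epsilon>" "\<epsilon> < \<epsilon>0" for \<epsilon>
    using Phi_root_formula[OF that i l] by (simp only: D_def a'_def X_def)
  have Xb: "X \<in> O[at_right 0](one_fun)"
    unfolding X_def by (intro big_sum_in_bigo sum_in_bigo bigo_mult_const PhiR_bigo deriv_Phi_bigo) (use sg in auto)
  show ?thesis
  proof (rule bigo_eventually_cong)
    show "eventually (\<lambda>\<epsilon>. \<Phi> \<epsilon> ?s l - \<Phi> 0 ?s l = ((\<Sum>j<N. (\<nu> \<epsilon> j - \<nu> 0 j) * (adjE ?s j l + ?s * a' j)) - eps \<epsilon> * X \<epsilon>) / D) (at_right 0)"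
      using eventually_small
    proof eventually_elim
      case (elim \<epsilon>)
      have "(\<Phi> \<epsilon> ?s l - \<Phi> 0 ?s l) * D = (\<Sum>j<N. (\<nu> \<epsilon> j - \<nu> 0 j) * (adjE ?s j l + ?s * a' j)) - eps \<epsilon> * X \<epsilon>"
        using F[of \<epsilon>] F[of 0] elim e0 by (simp add: left_diff_distrib sum_subtractf)
      then show ?case using D by (simp add: eq_divide_eq)
    qed
    show "(\<lambda>\<epsilon>. ((\<Sum>j<N. (\<nu> \<epsilon> j - \<nu> 0 j) * (adjE ?s j l + ?s * a' j)) - eps \<epsilon> * X \<epsilon>) / D) \<in> O[at_right 0](eps)"
      by (intro bigo_mult_const sum_in_bigo big_sum_in_bigo nu_diff_bigo eps_times Xb) auto
  qed
qed

lemma kappa_diff_bigo: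
  assumes i: "i \<in> {1..<N}" shows "(\<lambda>\<epsilon>. \<kappa> \<epsilon> i l - \<kappa> 0 i l) \<in> O[at_right 0](eps)"
proof -
  have "\<kappa> \<epsilon> i l - \<kappa> 0 i l = (\<Sum>j<N. k (s i) * (\<Sum>n<N. (\<Phi> \<epsilon> (s i) n - \<Phi> 0 (s i) n) * R $$ (n,j)) * adjE (s i) j l) / s i" for \<epsilon>
    by (simp add: \<kappa>_def \<Phi>R_def left_diff_distrib right_diff_distrib sum_subtractf diff_divide_distrib)
  then show ?thesis by (simp only:) (intro bigo_mult_const big_sum_in_bigo Phi_root_diff_bigo i, auto)
qed

lemma nu_expansion: assumes l: "l < N" shows "(\<lambda>\<epsilon>. \<nu> \<epsilon> l - \<nu> 0 l - eps \<epsilon> * z l) \<in> O[at_right 0](eps2)"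
proof (rule bigo_eventually_cong)
  show "eventually (\<lambda>\<epsilon>. \<nu> \<epsilon> l - \<nu> 0 l - eps \<epsilon> * z l = eps \<epsilon> * (\<Sum>i\<in>{1..<N}. (\<kappa> \<epsilon> i (m i) - \<kappa> 0 i (m i)) * Ai i l)) (at_right 0)"
    using eventually_small by eventually_elim (simp add: nu_diff l z_def algebra_simps sum_subtractf)
  show "(\<lambda>\<epsilon>. eps \<epsilon> * (\<Sum>i\<in>{1..<N}. (\<kappa> \<epsilon> i (m i) - \<kappa> 0 i (m i)) * Ai i l)) \<in> O[at_right 0](eps2)"
    by (intro eps_times2 big_sum_in_bigo bigo_mult_const kappa_diff_bigo)
qed

definition \<Phi>1 :: "complex \<Rightarrow> nat \<Rightarrow> complex" where
  "\<Phi>1 t l = (\<Sum>j<N. (t * z j - k t * \<Phi>R 0 t j) * adjE t j l) / det (E t)"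

lemma Phi_expansion:
  assumes t: "Re t \<ge> 0" "det (E t) \<noteq> 0" and l: "l < N"
  shows "(\<lambda>\<epsilon>. \<Phi> \<epsilon> t l - \<Phi> 0 t l - eps \<epsilon> * \<Phi>1 t l) \<in> O[at_right 0](eps2)"
proof -
  let ?d = "det (E t)"
  have F: "\<Phi> \<epsilon> t l = (\<Sum>j<N. (t * \<nu> \<epsilon> j - eps \<epsilon> * (k t * \<Phi>R \<epsilon> t j)) * adjE t j l) / ?d" if "0 \<le> \<epsilon>" "\<epsilon> < \<epsilon>0" "l < N" for \<epsilon> l
    using Phi_times_det[OF that(1,2) t(1) that(3)] t(2) by (simp add: eq_divide_eq)
  have diff: "(\<lambda>\<epsilon>. \<Phi> \<epsilon> t l - \<Phi> 0 t l) \<in> O[at_right 0](eps)" if l: "l < N" for l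
  proof (rule bigo_eventually_cong)
    show "eventually (\<lambda>\<epsilon>. \<Phi> \<epsilon> t l - \<Phi> 0 t l = (\<Sum>j<N. (t * (\<nu> \<epsilon> j - \<nu> 0 j) - eps \<epsilon> * (k t * \<Phi>R \<epsilon> t j)) * adjE t j l) / ?d) (at_right 0)"
      using eventually_small by eventually_elim
        (simp add: F[OF _ _ l] F[OF order.refl e0 l] left_diff_distrib right_diff_distrib sum_subtractf diff_divide_distrib)
    show "(\<lambda>\<epsilon>. (\<Sum>j<N. (t * (\<nu> \<epsilon> j - \<nu> 0 j) - eps \<epsilon> * (k t * \<Phi>R \<epsilon> t j)) * adjE t j l) / ?d) \<in> O[at_right 0](eps)"
      by (intro bigo_mult_const sum_in_bigo big_sum_in_bigo nu_diff_bigo eps_times PhiR_bigo t) auto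
  qed
  show ?thesis
  proof (rule bigo_eventually_cong)
    show "eventually (\<lambda>\<epsilon>. \<Phi> \<epsilon> t l - \<Phi> 0 t l - eps \<epsilon> * \<Phi>1 t l = (\<Sum>j<N. (t * (\<nu> \<epsilon> j - \<nu> 0 j - eps \<epsilon> * z j)
        - eps \<epsilon> * (k t * (\<Sum>n<N. (\<Phi> \<epsilon> t n - \<Phi> 0 t n) * R $$ (n,j)))) * adjE t j l) / ?d) (at_right 0)"
      using eventually_small
    proof eventually_elim
      case (elim \<epsilon>)
      have "(\<Sum>n<N. (\<Phi> \<epsilon> t n - \<Phi> 0 t n) * R $$ (n,j)) = \<Phi>R \<epsilon> t j - \<Phi>R 0 t j" for j
        by (simp add: \<Phi>R_def left_diff_distrib sum_subtractf)
      moreover have "eps \<epsilon> * \<Phi>1 t l = (\<Sum>j<N. eps \<epsilon> * (t * z j - k t * \<Phi>R 0 t j) * adjE t j l) / ?d"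
        by (simp add: \<Phi>1_def sum_distrib_left mult.assoc)
      ultimately show ?case
        unfolding F[OF elim[THEN conjunct1] elim[THEN conjunct2] l] F[OF order.refl e0 l]
        by (simp only: diff_divide_distrib[symmetric] sum_subtractf[symmetric])
           (intro arg_cong2[of _ _ _ _ "(/)"] sum.cong refl, simp add: algebra_simps)
    qed
    show "(\<lambda>\<epsilon>. (\<Sum>j<N. (t * (\<nu> \<epsilon> j - \<nu> 0 j - eps \<epsilon> * z j)
        - eps \<epsilon> * (k t * (\<Sum>n<N. (\<Phi> \<epsilon> t n - \<Phi> 0 t n) * R $$ (n,j)))) * adjE t j l) / ?d) \<in> O[at_right 0](eps2)"
      by (intro bigo_mult_const sum_in_bigo big_sum_in_bigo nu_expansion eps_times2 diff) auto
  qed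
qed

text \<open>For \<open>l = m i\<close> the right-hand side is the \<open>i\<close>-th entry of \<open>u B\<close>.  Differentiating \<open>E adj(E) = det(E) I\<close>
  at \<open>s\<^sub>i\<close> along \<open>E'\<close> and along \<open>K\<close>, and using that \<open>\<Phi> E' a\<^sub>i = 0\<close>, gives two equations for the
  number \<open>\<Phi>\<^sub>l(s\<^sub>i)\<close>; \<open>\<delta>\<^sub>i\<close> is the ratio of their coefficients and eliminates it.\<close>

lemma kappa_0_eq:
  assumes i: "i \<in> {1..<N}" and l: "l < N"
  defines "\<delta> \<equiv> det_dir (E (s i)) (k (s i) \<cdot>\<^sub>m R) / det_dir (E (s i)) (mat_deriv E (s i))"
  shows "\<kappa> 0 i l = (\<Sum>j<N. \<nu> 0 j * (\<delta> * adj_dir (E (s i)) (mat_deriv E (s i)) $$ (j,l)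
    - adj_dir (E (s i)) (k (s i) \<cdot>\<^sub>m R) $$ (j,l)))"
proof -
  let ?s = "s i" and ?X = "E (s i)" and ?Y = "mat_deriv E (s i)" and ?K = "k (s i) \<cdot>\<^sub>m R"
  have sg: "Re ?s > 0" "?s \<noteq> 0" "det ?X = 0" "deriv (\<lambda>t. det (E t)) ?s \<noteq> 0" using roots[OF i] by auto
  have Y: "?Y \<in> carrier_mat N N" using E[of ?s] by (auto simp: mat_deriv_def)
  have K: "?K \<in> carrier_mat N N" using R by simp
  have dne: "det_dir ?X ?Y \<noteq> 0" using sg DERIV_imp_deriv[OF det_deriv[OF sg(1)]] by simp
  have e: "0 \<le> (0::real)" "0 < \<epsilon>0" using e0 by auto
  have eq0: "(\<Sum>n<N. \<Phi> 0 t n * E t $$ (n,j)) = t * \<nu> 0 j" if "j < N" "Re t \<ge> 0" for t j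
    using eq[OF e that(2,1)] by simp
  \<comment> \<open>\<open>E adj(E) = det(E) I\<close> differentiated in a direction \<open>Z\<close> and multiplied by \<open>\<Phi>\<close> from the left.\<close>
  have dir: "(\<Sum>n<N. \<Phi> 0 ?s n * (\<Sum>j<N. Z $$ (n,j) * adjE ?s j l)) + ?s * (\<Sum>j<N. \<nu> 0 j * adj_dir ?X Z $$ (j,l))
      = \<Phi> 0 ?s l * det_dir ?X Z" if Z: "Z \<in> carrier_mat N N" for Z
  proof -
    have "(\<Sum>n<N. \<Phi> 0 ?s n * ((\<Sum>j<N. Z $$ (n,j) * adjE ?s j l) + (\<Sum>j<N. ?X $$ (n,j) * adj_dir ?X Z $$ (j,l))))
        = (\<Sum>n<N. if n = l then \<Phi> 0 ?s n * det_dir ?X Z else 0)"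
      by (intro sum.cong refl) (use adj_dir_identity[OF E Z _ l] in auto)
    moreover have "(\<Sum>n<N. \<Phi> 0 ?s n * (\<Sum>j<N. ?X $$ (n,j) * adj_dir ?X Z $$ (j,l)))
        = (\<Sum>j<N. (\<Sum>n<N. \<Phi> 0 ?s n * ?X $$ (n,j)) * adj_dir ?X Z $$ (j,l))"
      unfolding sum_distrib_left sum_distrib_right by (subst sum.swap) (simp add: mult.assoc)
    moreover have "\<dots> = ?s * (\<Sum>j<N. \<nu> 0 j * adj_dir ?X Z $$ (j,l))"
      unfolding sum_distrib_left using sg by (intro sum.cong refl) (simp add: eq0 mult.assoc)
    ultimately show ?thesis using l by (simp add: distrib_left sum.distrib)
  qed
  have ua: "(\<Sum>j<N. \<nu> 0 j * adjE ?s j l) = 0" using nu_root[OF e i l] by simp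
  \<comment> \<open>Differentiate \<open>\<Phi> E = t u\<close> at \<open>s\<^sub>i\<close> and multiply by \<open>a\<^sub>i\<close>, which \<open>E(s\<^sub>i)\<close> annihilates.\<close>
  have zero: "(\<Sum>n<N. \<Phi> 0 ?s n * (\<Sum>j<N. ?Y $$ (n,j) * adjE ?s j l)) = 0"
  proof -
    have d: "(\<Sum>n<N. deriv (\<lambda>t. \<Phi> 0 t n) ?s * ?X $$ (n,j) + ?Y $$ (n,j) * \<Phi> 0 ?s n) = \<nu> 0 j" if j: "j < N" for j
    proof -
      have 1: "((\<lambda>t. \<Sum>n<N. \<Phi> 0 t n * E t $$ (n,j)) has_field_derivative
         (\<Sum>n<N. deriv (\<lambda>t. \<Phi> 0 t n) ?s * ?X $$ (n,j) + ?Y $$ (n,j) * \<Phi> 0 ?s n)) (at ?s)"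
        by (intro DERIV_sum DERIV_mult Phi_deriv E_deriv e sg j) auto
      have 2: "((\<lambda>t. t * \<nu> 0 j) has_field_derivative 1 * \<nu> 0 j) (at ?s)"
        by (intro DERIV_cmult_right DERIV_ident)
      have ev: "eventually (\<lambda>t. (\<Sum>n<N. \<Phi> 0 t n * E t $$ (n,j)) = t * \<nu> 0 j) (nhds ?s)"
      proof -
        have "eventually (\<lambda>t. t \<in> {t. Re t > 0}) (nhds ?s)"
          by (rule eventually_nhds_in_open) (use sg in \<open>auto simp: open_halfspace_Re_gt\<close>)
        then show ?thesis by eventually_elim (simp add: eq0 j)
      qed
      show ?thesis using DERIV_unique[OF 1] DERIV_cong_ev[OF refl ev refl] 2 by auto
    qed
    have "0 = (\<Sum>j<N. (\<Sum>n<N. deriv (\<lambda>t. \<Phi> 0 t n) ?s * ?X $$ (n,j) + ?Y $$ (n,j) * \<Phi> 0 ?s n) * adjE ?s j l)"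
      using ua by (simp add: d)
    also have "\<dots> = (\<Sum>n<N. deriv (\<lambda>t. \<Phi> 0 t n) ?s * (\<Sum>j<N. ?X $$ (n,j) * adjE ?s j l))
        + (\<Sum>n<N. \<Phi> 0 ?s n * (\<Sum>j<N. ?Y $$ (n,j) * adjE ?s j l))"
      unfolding sum_distrib_left sum_distrib_right sum.distrib[symmetric]
      by (subst sum.swap) (intro sum.cong refl, simp add: algebra_simps)
    also have "(\<Sum>n<N. deriv (\<lambda>t. \<Phi> 0 t n) ?s * (\<Sum>j<N. ?X $$ (n,j) * adjE ?s j l)) = 0"
      by (intro sum.neutral ballI) (simp add: adj_mat_index_right[OF E _ l] sg)
    finally show ?thesis by simp
  qed
  have kap: "(\<Sum>n<N. \<Phi> 0 ?s n * (\<Sum>j<N. ?K $$ (n,j) * adjE ?s j l)) = ?s * \<kappa> 0 i l"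
  proof -
    have "(\<Sum>n<N. \<Phi> 0 ?s n * (\<Sum>j<N. ?K $$ (n,j) * adjE ?s j l)) = (\<Sum>n<N. \<Sum>j<N. k ?s * (\<Phi> 0 ?s n * R $$ (n,j)) * adjE ?s j l)"
      unfolding sum_distrib_left using R by (intro sum.cong refl) (simp add: mult_ac)
    also have "\<dots> = (\<Sum>j<N. k ?s * \<Phi>R 0 ?s j * adjE ?s j l)"
      unfolding \<Phi>R_def sum_distrib_left sum_distrib_right by (rule sum.swap)
    finally show ?thesis using sg by (simp add: \<kappa>_def)
  qed
  let ?p = "\<Sum>j<N. \<nu> 0 j * adj_dir ?X ?Y $$ (j,l)" and ?q = "\<Sum>j<N. \<nu> 0 j * adj_dir ?X ?K $$ (j,l)"
  have 1: "?s * ?p = \<Phi> 0 ?s l * det_dir ?X ?Y" using dir[OF Y] zero by simp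
  have 2: "?s * \<kappa> 0 i l + ?s * ?q = \<Phi> 0 ?s l * det_dir ?X ?K" using dir[OF K] kap by simp
  have 3: "\<delta> * det_dir ?X ?Y = det_dir ?X ?K" using dne by (simp add: \<delta>_def)
  have "?s * (\<kappa> 0 i l + ?q) = \<Phi> 0 ?s l * (\<delta> * det_dir ?X ?Y)" by (simp only: distrib_left 2 3)
  also have "\<dots> = \<delta> * (?s * ?p)" by (simp only: 1 mult.left_commute)
  finally have "?s * (\<kappa> 0 i l + ?q) = ?s * (\<delta> * ?p)" by (simp only: mult.left_commute)
  then have "\<kappa> 0 i l + ?q = \<delta> * ?p" using sg(2) by (simp only: mult_cancel_left simp_thms)
  then have "\<kappa> 0 i l = \<delta> * ?p - ?q" by (simp only: eq_diff_eq)
  then show ?thesis by (simp add: right_diff_distrib sum_subtractf sum_distrib_left mult.left_commute)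
qed

end

section \<open>The base model\<close>

locale base_queue = irreducible_arrivals +
  fixes Fp :: "real measure" and p q :: "complex poly" and L :: "(real \<times> nat) measure"
  assumes real_customers: "\<exists>i<N. \<exists>j<N. D2 $$ (i,j) > 0"
    and Fp: "service_dist Fp" and L: "steady_state D1 D2 Fp L"
    and lst_rational: "\<And>t. Re t \<ge> 0 \<Longrightarrow> lst Fp t = poly q t / poly p t"
    and no_common_root: "\<And>t. \<not> (poly p t = 0 \<and> poly q t = 0)"
    and monic: "lead_coeff p = 1" and degree_less: "degree q < degree p"
begin

lemmas Fp_nonneg = service_dist_nonneg[OF Fp]

abbreviation F :: "complex \<Rightarrow> complex" where "F t \<equiv> poly q t / poly p t"
definition E :: "complex \<Rightarrow> complex mat" where "E t = E_mat D1 D2 (F t) t"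
abbreviation R :: "complex mat" where "R \<equiv> R_mat D1 D2"
definition u :: "nat \<Rightarrow> complex" where "u j = empty_vec Fp L j"
definition om :: "nat \<Rightarrow> complex" where "om l = cvec (omega D1 D2 \<pi>) $ l"
abbreviation phi :: "complex \<Rightarrow> nat \<Rightarrow> complex" where "phi t i \<equiv> workload_lt N L t $ i"
abbreviation adjE :: "complex \<Rightarrow> nat \<Rightarrow> nat \<Rightarrow> complex" where "adjE t j l \<equiv> adj_mat (E t) $$ (j,l)"

lemma E_carrier [simp]: "E t \<in> carrier_mat N N" by (simp add: E_def)

lemma p_nz: "p \<noteq> 0" using monic by auto

text \<open>A root of \<open>p\<close> in the closed right half-plane would be a pole of the bounded function \<open>lst Fp\<close>.\<close>

lemma p_nonzero: assumes a: "Re a \<ge> 0" shows "poly p a \<noteq> 0"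
proof
  assume pa: "poly p a = 0"
  let ?T = "\<lambda>n. a + complex_of_real (inverse (real (Suc n)))"
  have T: "?T \<longlonglongrightarrow> a"
    using tendsto_add[OF tendsto_const tendsto_of_real[OF LIMSEQ_inverse_real_of_nat], of a] by simp
  have "\<not> a islimpt {t. poly p t = 0}" by (rule islimpt_finite[OF poly_roots_finite[OF p_nz]])
  then have ev: "eventually (\<lambda>t. poly p t \<noteq> 0) (at a)" by (simp add: islimpt_iff_eventually)
  have Ta: "?T n \<noteq> a" for n
  proof -
    have "complex_of_real (inverse (real (Suc n))) \<noteq> 0" unfolding of_real_eq_0_iff by simp
    then show ?thesis by (simp only: add_cancel_left_right not_False_eq_True)
  qed
  have "filterlim ?T (at a) sequentially"
    using T Ta by (simp only: filterlim_at eventually_True simp_thms UNIV_I)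
  then have "eventually (\<lambda>n. poly p (?T n) \<noteq> 0) sequentially" using ev by (rule eventually_compose_filterlim[rotated])
  then have le: "eventually (\<lambda>n. norm (poly q (?T n)) \<le> norm (poly p (?T n))) sequentially"
  proof eventually_elim
    case (elim n)
    have RT: "Re (?T n) \<ge> 0" using a by simp
    have "norm (poly q (?T n) / poly p (?T n)) \<le> 1"
      unfolding lst_rational[OF RT, symmetric] by (rule norm_lst_le[OF Fp RT])
    moreover have "norm (poly p (?T n)) > 0" using elim by (simp only: zero_less_norm_iff not_False_eq_True)
    ultimately show ?case by (simp only: norm_divide pos_divide_le_eq mult_1)
  qed
  have "(\<lambda>n. norm (poly q (?T n))) \<longlonglongrightarrow> norm (poly q a)" "(\<lambda>n. norm (poly p (?T n))) \<longlonglongrightarrow> norm (poly p a)"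
    by (intro tendsto_intros T)+
  then have "norm (poly q a) \<le> norm (poly p a)" using le by (intro tendsto_le[of sequentially]) auto
  then show False using pa no_common_root[of a] by simp
qed

lemma base_equation:
  "j < N \<Longrightarrow> Re t \<ge> 0 \<Longrightarrow> (\<Sum>i<N. phi t i * E t $$ (i,j)) = t * u j"
  using stationary_equation[OF Fp_nonneg L] by (simp add: E_def lst_rational u_def)

lemma phi_det:
  "l < N \<Longrightarrow> Re t \<ge> 0 \<Longrightarrow> phi t l * det (E t) = t * (\<Sum>j<N. u j * adjE t j l)"
  using row_times_adj[OF E_carrier, of "phi t" t "\<lambda>j. t * u j" l] base_equation
  by (simp add: sum_distrib_left mult.assoc)

lemma u_pos: assumes "j < N" obtains a where "a > 0" "u j = complex_of_real a"
  using empty_vec_pos[OF Fp_nonneg L Fp assms] by (auto simp: u_def)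

lemma u_nonzero: assumes "j < N" shows "u j \<noteq> 0"
proof -
  obtain a where "a > 0" "u j = complex_of_real a" by (rule u_pos[OF assms])
  then show ?thesis by simp
qed

text \<open>The normalising equation of the system that characterises \<open>u\<close>; the other equations are \<open>phi_det\<close> at the roots.\<close>

lemma u_drift: "(\<Sum>j<N. u j / clam j) = complex_of_real (drift D1 D2 \<pi> (mean Fp \<cdot>\<^sub>m hadamard (Q2 D1 D2) (trans_mat D1 D2)))"
proof -
  have "(\<Sum>j<N. empty_vec Fp L j / clam j)
    = complex_of_real (\<Sum>i<N. \<pi> $ i / lam i) - complex_of_real (mean Fp) * complex_of_real (\<Sum>i<N. \<Sum>j<N. \<pi> $ i * jw i j True)"
  proof (rule empty_vec_drift[OF Fp_nonneg L], rule lst_difference_quotient[OF Fp])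
    show "complex_of_real (inverse (real (Suc n))) \<noteq> 0" for n unfolding of_real_eq_0_iff by simp
    show "(\<lambda>n. complex_of_real (inverse (real (Suc n)))) \<longlonglongrightarrow> 0"
      using tendsto_of_real[OF LIMSEQ_inverse_real_of_nat] by (simp only: of_real_0)
  qed simp
  then show ?thesis by (simp add: u_def drift_eq)
qed

subsection \<open>The weights \<open>\<omega>\<close>\<close>

definition rho :: real where "rho = (\<Sum>i<N. \<pi> $ i * (\<Sum>j<N. jw i j True))"

lemma rho_pos: "rho > 0"
proof -
  obtain i j where ij: "i < N" "j < N" "D2 $$ (i,j) > 0" using real_customers by blast
  have nn: "0 \<le> \<pi> $ i * (\<Sum>j<N. jw i j True)" if "i < N" for i
    using pi_props(2)[OF that] jw_nonneg[OF that] by (intro mult_nonneg_nonneg sum_nonneg) auto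
  have "0 < jw i j True" using ij rate_pos[OF ij(1)] by (simp add: jw_def)
  also have "\<dots> \<le> (\<Sum>j<N. jw i j True)" by (rule member_le_sum) (use ij jw_nonneg in auto)
  finally have "0 < \<pi> $ i * (\<Sum>j<N. jw i j True)" using pi_pos[OF ij(1)] by simp
  also have "\<dots> \<le> rho" unfolding rho_def by (rule member_le_sum) (use ij nn in auto)
  finally show ?thesis .
qed

lemma om_eq: assumes "l < N" shows "om l = complex_of_real ((\<Sum>j<N. jw l j True) / rho)"
proof -
  have D2c: "D2 \<in> carrier_mat N N" by (rule carrier_matI) auto
  have v: "(Lam_inv D1 D2 *\<^sub>v (D2 *\<^sub>v ones (dim_row D1))) $ i = (\<Sum>j<N. jw i j True)" if "i < N" for i
  proof -
    have "(D2 *\<^sub>v ones N) $ k = (\<Sum>j<N. D2 $$ (k,j))" if "k < N" for k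
      using that by (auto simp: ones_def scalar_prod_def lessThan_atLeast0 intro!: sum.cong)
    then have "(Lam_inv D1 D2 *\<^sub>v (D2 *\<^sub>v ones (dim_row D1))) $ i = (\<Sum>k<N. (if i = k then 1 / lam i else 0) * (\<Sum>j<N. D2 $$ (k,j)))"
      using that by (auto simp: Lam_inv_def mat_diag_def scalar_prod_def lessThan_atLeast0 intro!: sum.cong)
    also have "\<dots> = 1 / lam i * (\<Sum>j<N. D2 $$ (i,j))" using that by (simp add: if_distrib[of "\<lambda>x. x * _"] cong: if_cong)
    finally show ?thesis by (simp add: jw_def sum_divide_distrib)
  qed
  have dv: "dim_vec (Lam_inv D1 D2 *\<^sub>v (D2 *\<^sub>v ones (dim_row D1))) = N" by (simp add: Lam_inv_def mat_diag_def)
  have "\<pi> \<bullet> (Lam_inv D1 D2 *\<^sub>v (D2 *\<^sub>v ones (dim_row D1))) = rho"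
    unfolding scalar_prod_def dv rho_def lessThan_atLeast0
    by (intro sum.cong refl) (simp add: v lessThan_atLeast0 del: dims index_mult_mat_vec)
  then show ?thesis using assms v[OF assms] dv
    by (simp add: om_def omega_def del: dims index_mult_mat_vec)
qed

lemma pi_om: "(\<Sum>l<N. complex_of_real (\<pi> $ l) * om l) = 1"
proof -
  have "(\<Sum>l<N. complex_of_real (\<pi> $ l) * om l) = complex_of_real ((\<Sum>l<N. \<pi> $ l * (\<Sum>j<N. jw l j True)) / rho)"
    by (simp add: om_eq flip: sum_divide_distrib)
  then show ?thesis using rho_pos by (simp add: rho_def[symmetric])
qed

definition uom :: complex where "uom = (\<Sum>l<N. u l * om l)"

text \<open>All entries of \<open>u\<close> are positive and \<open>\<omega>\<close> is nonnegative and not zero.\<close>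

lemma uom_nonzero: "uom \<noteq> 0"
proof -
  have "\<exists>a>0. u l = complex_of_real a" if "l < N" for l using u_pos[OF that] by blast
  then obtain a where a: "\<And>l. l < N \<Longrightarrow> a l > 0 \<and> u l = complex_of_real (a l)" by metis
  let ?o = "\<lambda>l. (\<Sum>j<N. jw l j True) / rho"
  have nn: "0 \<le> ?o l" if "l < N" for l
    using rho_pos jw_nonneg[OF that] by (intro divide_nonneg_nonneg sum_nonneg) auto
  have "uom = complex_of_real (\<Sum>l<N. a l * ?o l)" by (simp add: uom_def om_eq a)
  moreover have "(\<Sum>l<N. a l * ?o l) \<noteq> 0"
  proof
    assume "(\<Sum>l<N. a l * ?o l) = 0"
    moreover have "0 \<le> a l * ?o l" if "l \<in> {..<N}" for l
      using mult_nonneg_nonneg[OF less_imp_le[OF conjunct1[OF a[of l]]] nn[of l]] that by simp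
    ultimately have "\<forall>l\<in>{..<N}. a l * ?o l = 0"
      using sum_nonneg_eq_0_iff[of "{..<N}" "\<lambda>l. a l * ?o l"] by blast
    then have z: "a l * ?o l = 0" if "l < N" for l using that by blast
    have "om l = 0" if l: "l < N" for l
    proof -
      have "a l \<noteq> 0" using a[OF l] by simp
      then have "?o l = 0" using z[OF l] by (simp only: mult_eq_0_iff simp_thms)
      then show ?thesis by (simp only: om_eq[OF l] of_real_0)
    qed
    then have "(\<Sum>l<N. complex_of_real (\<pi> $ l) * om l) = 0" by simp
    then show False using pi_om by simp
  qed
  ultimately show ?thesis by (simp only: of_real_eq_0_iff not_False_eq_True)
qed

subsection \<open>Bilinear quantities of the adjugate\<close>

text \<open>With the common denominator \<open>Z u\<close>, the numerators of the three sums in the expansion are \<open>Z z\<close>, \<open>t V\<close> and \<open>T\<close>.\<close>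

definition Z :: "(nat \<Rightarrow> complex) \<Rightarrow> complex \<Rightarrow> complex" where
  "Z v t = (\<Sum>j<N. \<Sum>l<N. v j * adjE t j l * om l)"
definition T :: "complex \<Rightarrow> complex" where "T t = det_dir (E t) R"
definition V :: "complex \<Rightarrow> complex" where
  "V t = (\<Sum>j<N. \<Sum>l<N. u j * adj_dir (E t) R $$ (j,l) * om l)"
definition w :: "complex \<Rightarrow> complex" where "w t = (\<Sum>l<N. phi t l * om l)"

lemma w_det: "Re t \<ge> 0 \<Longrightarrow> w t * det (E t) = t * Z u t"
proof -
  assume t: "Re t \<ge> 0"
  have "w t * det (E t) = (\<Sum>l<N. t * (\<Sum>j<N. u j * adjE t j l) * om l)"
    unfolding w_def sum_distrib_right by (intro sum.cong refl) (simp add: phi_det t mult_ac flip: mult.assoc)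
  also have "\<dots> = t * Z u t"
    unfolding Z_def by (subst sum.swap) (simp add: sum_distrib_left sum_distrib_right mult.assoc)
  finally show ?thesis .
qed

lemma w_0: "w 0 = 1"
  unfolding w_def using pi_om by (simp add: phi_0[OF Fp_nonneg L])

text \<open>Since \<open>\<Phi> = t u adj(E) / det E\<close>, the left-hand side is \<open>t u adj(E) R adj(E) \<omega> / det E\<close>, and
  \<open>adj_mult_adj_dir\<close> replaces the quadratic expression by linear ones.\<close>

lemma phi_R_adj:
  assumes t: "Re t \<ge> 0" "det (E t) \<noteq> 0"
  shows "(\<Sum>l<N. (\<Sum>j<N. (\<Sum>i<N. phi t i * R $$ (i,j)) * adjE t j l) * om l) = w t * T t - t * V t"
proof -
  let ?d = "det (E t)" and ?Wl = "\<lambda>i l. \<Sum>j<N. R $$ (i,j) * adjE t j l"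
  have lhs: "(\<Sum>j<N. (\<Sum>i<N. phi t i * R $$ (i,j)) * adjE t j l) = (\<Sum>i<N. phi t i * ?Wl i l)" for l
    unfolding sum_distrib_left sum_distrib_right by (subst sum.swap) (simp add: mult.assoc)
  have col: "?d * (\<Sum>i<N. phi t i * ?Wl i l) = t * (\<Sum>n<N. u n * (T t * adjE t n l - ?d * adj_dir (E t) R $$ (n,l)))"
    if l: "l < N" for l
  proof -
    have "?d * (\<Sum>i<N. phi t i * ?Wl i l) = (\<Sum>i<N. t * (\<Sum>n<N. u n * adjE t n i) * ?Wl i l)"
      unfolding sum_distrib_left[of ?d]
    proof (intro sum.cong refl)
      fix i assume "i \<in> {..<N}"
      then have "phi t i * ?d = t * (\<Sum>n<N. u n * adjE t n i)" using phi_det t by simp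
      then show "?d * (phi t i * ?Wl i l) = t * (\<Sum>n<N. u n * adjE t n i) * ?Wl i l"
        by (simp only: mult.assoc[symmetric] mult.commute[of ?d])
    qed
    also have "\<dots> = t * (\<Sum>i<N. \<Sum>n<N. u n * (adjE t n i * ?Wl i l))"
      by (simp only: sum_distrib_left[of t] sum_distrib_right mult.assoc)
    also have "(\<Sum>i<N. \<Sum>n<N. u n * (adjE t n i * ?Wl i l)) = (\<Sum>n<N. u n * (\<Sum>i<N. adjE t n i * ?Wl i l))"
      by (subst sum.swap) (simp only: sum_distrib_left[of "u _"])
    also have "\<dots> = (\<Sum>n<N. u n * (T t * adjE t n l - ?d * adj_dir (E t) R $$ (n,l)))"
    proof (intro sum.cong refl)
      fix n assume "n \<in> {..<N}"
      then have "(\<Sum>i<N. adjE t n i * ?Wl i l) + ?d * adj_dir (E t) R $$ (n,l) = T t * adjE t n l"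
        unfolding T_def using adj_mult_adj_dir[OF E_carrier R_mat_carrier _ l, of n t] by simp
      then have "(\<Sum>i<N. adjE t n i * ?Wl i l) = T t * adjE t n l - ?d * adj_dir (E t) R $$ (n,l)"
        by (simp only: eq_diff_eq)
      then show "u n * (\<Sum>i<N. adjE t n i * ?Wl i l) = u n * (T t * adjE t n l - ?d * adj_dir (E t) R $$ (n,l))"
        by (rule arg_cong)
    qed
    finally show ?thesis .
  qed
  have "?d * (\<Sum>l<N. (\<Sum>i<N. phi t i * ?Wl i l) * om l)
      = (\<Sum>l<N. t * (\<Sum>n<N. u n * (T t * adjE t n l - ?d * adj_dir (E t) R $$ (n,l))) * om l)"
    unfolding sum_distrib_left[of ?d] by (intro sum.cong refl) (simp only: mult.assoc[symmetric] col lessThan_iff)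
  also have "\<dots> = t * (\<Sum>n<N. \<Sum>l<N. u n * (T t * adjE t n l - ?d * adj_dir (E t) R $$ (n,l)) * om l)"
    unfolding sum_distrib_left sum_distrib_right by (subst sum.swap) (simp only: mult.assoc)
  also have "(\<Sum>n<N. \<Sum>l<N. u n * (T t * adjE t n l - ?d * adj_dir (E t) R $$ (n,l)) * om l) = T t * Z u t - ?d * V t"
    unfolding Z_def V_def sum_distrib_left sum_subtractf[symmetric]
    by (intro sum.cong refl) (simp add: algebra_simps)
  also have "t * (T t * Z u t - ?d * V t) = T t * (t * Z u t) - t * ?d * V t" by (simp add: algebra_simps)
  also have "\<dots> = ?d * (w t * T t - t * V t)" unfolding w_det[OF t(1), symmetric] by (simp add: algebra_simps)
  finally show ?thesis unfolding lhs using t(2) by (simp only: mult_cancel_left simp_thms)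
qed

subsection \<open>Clearing denominators\<close>

lemma E_formal_carrier: "E_formal D1 D2 \<in> carrier_mat N N" by (simp add: E_formal_def)

lemma map_E_formal: "map_mat (\<lambda>G. bipoly G f t) (E_formal D1 D2) = E_mat D1 D2 f t"
proof (rule eq_matI)
  fix i j assume "i < dim_row (E_mat D1 D2 f t)" "j < dim_col (E_mat D1 D2 f t)"
  then have ij: "i < N" "j < N" using carrier_matD[OF E_mat_carrier[of f t]] by auto
  then show "map_mat (\<lambda>G. bipoly G f t) (E_formal D1 D2) $$ (i,j) = E_mat D1 D2 f t $$ (i,j)"
    by (simp add: E_formal_def E_mat_index R_mat_index algebra_simps)
qed (use carrier_matD[OF E_mat_carrier[of f t]] in \<open>auto simp: E_formal_def\<close>)

lemma adj_formal: "j < N \<Longrightarrow> l < N \<Longrightarrow> adj_mat (E_mat D1 D2 f t) $$ (j,l) = bipoly (adj_mat (E_formal D1 D2) $$ (j,l)) f t"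
  using adj_mat_hom[OF E_formal_carrier] by (simp add: map_E_formal)

lemma det_formal: "det (E_mat D1 D2 f t) = bipoly (det (E_formal D1 D2)) f t"
  using bipoly_hom.hom_det[of f t "E_formal D1 D2"] by (simp add: map_E_formal)

lemma E_mat_deriv:
  "i < N \<Longrightarrow> j < N \<Longrightarrow> ((\<lambda>f. E_mat D1 D2 f t $$ (i,j)) has_field_derivative R $$ (i,j)) (at f)"
  by (auto simp: E_mat_index R_mat_index intro!: derivative_eq_intros)

text \<open>
  The argument enters \<open>E\<close> also explicitly, but \<open>R\<close> is the derivative of \<open>E\<close> with respect to the service time
  transform alone; so \<open>T\<close>, and likewise \<open>V\<close>, is a derivative in the outer indeterminate, which does not raise
  the power of \<open>p\<close> in the denominator.
\<close>

lemma T_formal: "T t = bipoly (pderiv (det (E_formal D1 D2))) (F t) t"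
proof -
  have "((\<lambda>f. det (E_mat D1 D2 f t)) has_field_derivative det_dir (E_mat D1 D2 (F t) t) R) (at (F t))"
    by (rule has_field_derivative_det[OF E_mat_carrier R_mat_carrier E_mat_deriv])
  from DERIV_unique[OF this[unfolded det_formal] bipoly_deriv] show ?thesis by (simp add: T_def E_def)
qed

definition Z_formal :: "(nat \<Rightarrow> complex) \<Rightarrow> complex poly poly" where
  "Z_formal v = (\<Sum>j<N. \<Sum>l<N. Polynomial.smult [: v j * om l :] (adj_mat (E_formal D1 D2) $$ (j,l)))"

lemma Z_formal_eval: "bipoly (Z_formal v) f t = (\<Sum>j<N. \<Sum>l<N. v j * adj_mat (E_mat D1 D2 f t) $$ (j,l) * om l)"
  unfolding Z_formal_def bipoly_sum by (intro sum.cong refl) (simp add: adj_formal mult_ac)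

lemma Z_formal: "Z v t = bipoly (Z_formal v) (F t) t"
  by (simp add: Z_formal_eval Z_def E_def)

lemma V_formal: "V t = bipoly (pderiv (Z_formal u)) (F t) t"
proof -
  have "((\<lambda>f. \<Sum>j<N. \<Sum>l<N. u j * adj_mat (E_mat D1 D2 f t) $$ (j,l) * om l) has_field_derivative
      (\<Sum>j<N. \<Sum>l<N. u j * adj_dir (E_mat D1 D2 (F t) t) R $$ (j,l) * om l)) (at (F t))"
    by (intro DERIV_sum DERIV_cmult_right DERIV_cmult has_field_derivative_adj[OF E_mat_carrier R_mat_carrier E_mat_deriv]) auto
  from DERIV_unique[OF this[folded Z_formal_eval] bipoly_deriv] show ?thesis by (simp add: V_def E_def)
qed

definition r :: nat where "r = p_power D1 D2 (vec N u) (vec N om)"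

text \<open>
  In \<^const>\<open>p_power\<close> only entries with \<open>u\<^sub>i \<noteq> 0\<close> count.  As \<open>u\<close> has no zero entry, the bound holds in all rows and
  serves \<open>Z v\<close> for every \<open>v\<close>.
\<close>

lemma degree_bounds:
  shows "degree (det (E_formal D1 D2)) \<le> r"
    and "\<And>j l. j < N \<Longrightarrow> l < N \<Longrightarrow> om l \<noteq> 0 \<Longrightarrow> degree (adj_mat (E_formal D1 D2) $$ (j,l)) \<le> r"
proof -
  let ?A = "{degree (adj_mat (E_formal D1 D2) $$ (i,j)) | i j. i < N \<and> j < N \<and> vec N u $ i \<noteq> 0 \<and> vec N om $ j \<noteq> 0}"
  have r: "r = Max (insert (degree (det (E_formal D1 D2))) ?A)" by (simp add: r_def p_power_def)
  have "?A \<subseteq> (\<lambda>(i,j). degree (adj_mat (E_formal D1 D2) $$ (i,j))) ` ({..<N} \<times> {..<N})" by force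
  then have "finite ?A" by (rule finite_subset) simp
  then have fin: "finite (insert (degree (det (E_formal D1 D2))) ?A)" by simp
  show "degree (det (E_formal D1 D2)) \<le> r" unfolding r by (rule Max_ge[OF fin]) simp
  show "degree (adj_mat (E_formal D1 D2) $$ (j,l)) \<le> r" if "j < N" "l < N" "om l \<noteq> 0" for j l
    unfolding r
  proof (rule Max_ge[OF fin], rule insertI2, rule CollectI, intro exI conjI)
    show "vec N u $ j \<noteq> 0" "vec N om $ l \<noteq> 0" using that u_nonzero by auto
  qed (use that in auto)
qed

lemma degree_Z_formal: "degree (Z_formal v) \<le> r"
  unfolding Z_formal_def
proof (intro degree_sum_le finite_lessThan)
  fix j l assume "j \<in> {..<N}" "l \<in> {..<N}"
  then show "degree (Polynomial.smult [:v j * om l:] (adj_mat (E_formal D1 D2) $$ (j, l))) \<le> r"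
    by (cases "om l = 0") (auto intro: order.trans[OF degree_smult_le] degree_bounds)
qed

text \<open>The degree of the common denominator \<open>\<Prod>(t - s\<^sub>k) \<Prod>(t + y\<^sub>j)\<close>.\<close>

definition tot :: nat where "tot = (N - 1) + r * degree p"

lemma F_tendsto: "(F \<longlongrightarrow> 0) at_infinity" and p_tendsto: "((\<lambda>t. poly p t / t ^ degree p) \<longlongrightarrow> 1) at_infinity"
proof -
  show p: "((\<lambda>t. poly p t / t ^ degree p) \<longlongrightarrow> 1) at_infinity"
    using tendsto_poly_quotient[of p "degree p"] monic by simp
  have q: "((\<lambda>t. poly q t / t ^ degree p) \<longlongrightarrow> 0) at_infinity"
    using tendsto_poly_quotient[of q "degree p"] degree_less by (simp add: coeff_eq_0)
  have "((\<lambda>t. (poly q t / t ^ degree p) / (poly p t / t ^ degree p)) \<longlongrightarrow> 0 / 1) at_infinity"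
    by (rule tendsto_divide[OF q p]) simp
  moreover have "eventually (\<lambda>t. (poly q t / t ^ degree p) / (poly p t / t ^ degree p) = F t) at_infinity"
    using eventually_not_equal_at_infinity[of 0] by eventually_elim simp
  ultimately have "(F \<longlongrightarrow> 0 / 1) at_infinity" by (rule Lim_transform_eventually)
  then show "(F \<longlongrightarrow> 0) at_infinity" by simp
qed

lemma eventually_p: "eventually (\<lambda>t. poly p t \<noteq> 0) at_infinity"
proof -
  have "eventually (\<lambda>t. poly p t / t ^ degree p \<noteq> 0) at_infinity"
    by (rule tendsto_imp_eventually_ne[OF p_tendsto]) simp
  then show ?thesis by eventually_elim auto
qed

lemma E_scaled:
  "i < N \<Longrightarrow> j < N \<Longrightarrow> ((\<lambda>t. (inverse t \<cdot>\<^sub>m E t) $$ (i,j)) \<longlongrightarrow> 1\<^sub>m N $$ (i,j)) at_infinity"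
proof -
  assume ij: "i < N" "j < N"
  have "((\<lambda>t. inverse t * (clam j * (cw i j False + F t * cw i j True) - (if i = j then clam j else 0)) + (if i = j then 1 else 0))
      \<longlongrightarrow> 0 * (clam j * (cw i j False + 0 * cw i j True) - (if i = j then clam j else 0)) + (if i = j then 1 else 0)) at_infinity"
    by (intro tendsto_add tendsto_mult tendsto_diff tendsto_const tendsto_inverse_0 F_tendsto)
  moreover have "eventually (\<lambda>t. inverse t * (clam j * (cw i j False + F t * cw i j True) - (if i = j then clam j else 0)) + (if i = j then 1 else 0)
      = (inverse t \<cdot>\<^sub>m E t) $$ (i,j)) at_infinity"
    using eventually_not_equal_at_infinity[of 0]
  proof eventually_elim
    case (elim t)
    have "(inverse t \<cdot>\<^sub>m E t) $$ (i,j) = inverse t * E_mat D1 D2 (F t) t $$ (i,j)"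
      using ij carrier_matD[OF E_carrier[of t]] by (simp add: E_def)
    then show ?case using elim by (auto simp: E_mat_index[OF ij] algebra_simps)
  qed
  ultimately have "((\<lambda>t. (inverse t \<cdot>\<^sub>m E t) $$ (i,j)) \<longlongrightarrow>
      0 * (clam j * (cw i j False + 0 * cw i j True) - (if i = j then clam j else 0)) + (if i = j then 1 else 0)) at_infinity"
    by (rule Lim_transform_eventually)
  then show ?thesis using ij by simp
qed

lemma adjE_tendsto:
  assumes "i < N" "j < N"
  shows "((\<lambda>t. adjE t i j * inverse t ^ (N - 1)) \<longlongrightarrow> (if i = j then 1 else 0)) at_infinity"
proof -
  have "((\<lambda>t. adj_mat (inverse t \<cdot>\<^sub>m E t) $$ (i,j)) \<longlongrightarrow> adj_mat (1\<^sub>m N) $$ (i,j)) at_infinity"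
    by (rule tendsto_adj[OF _ _ E_scaled assms]) auto
  then show ?thesis using assms by (simp add: adj_mat_smult[OF E_carrier assms] adj_mat_one mult.commute)
qed

lemma det_tendsto: "((\<lambda>t. det (E t) * inverse t ^ N) \<longlongrightarrow> 1) at_infinity"
proof -
  have "((\<lambda>t. det (inverse t \<cdot>\<^sub>m E t)) \<longlongrightarrow> det (1\<^sub>m N)) at_infinity"
    by (rule tendsto_det[OF _ _ E_scaled]) auto
  moreover have "det (inverse t \<cdot>\<^sub>m E t) = det (E t) * inverse t ^ N" for t
    using carrier_matD[OF E_carrier[of t]] by (simp add: det_smult mult.commute)
  ultimately show ?thesis by (simp only: det_one)
qed

lemma T_tendsto: "\<exists>c. ((\<lambda>t. T t * inverse t ^ (N - 1)) \<longlongrightarrow> c) at_infinity"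
proof -
  have "T t * inverse t ^ (N - 1) = (\<Sum>j<N. \<Sum>i<N. R $$ (i,j) * (adjE t j i * inverse t ^ (N - 1)))" for t
    unfolding T_def det_dir_cofactor[OF E_carrier R_mat_carrier] sum_distrib_right
    using carrier_matD[OF E_carrier[of t]] by (intro sum.cong refl) (simp add: adj_mat_def)
  moreover have "((\<lambda>t. \<Sum>j<N. \<Sum>i<N. R $$ (i,j) * (adjE t j i * inverse t ^ (N - 1)))
      \<longlongrightarrow> (\<Sum>j<N. \<Sum>i<N. R $$ (i,j) * (if j = i then 1 else 0))) at_infinity"
    by (intro tendsto_sum tendsto_mult tendsto_const adjE_tendsto) auto
  ultimately show ?thesis by auto
qed

text \<open>
  The directional derivative of the adjugate consists of minors of order \<open>N - 2\<close>, so \<open>V\<close> loses one power of \<open>t\<close>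
  against the adjugate.  The limit is computed by solving \<open>adj_mult_adj_dir\<close> for that derivative, since the
  adjugate and \<open>det E\<close> have known limits.
\<close>

lemma V_tendsto: "\<exists>c. ((\<lambda>t. t * V t * inverse t ^ (N - 1)) \<longlongrightarrow> c) at_infinity"
proof -
  obtain c where c: "((\<lambda>t. T t * inverse t ^ (N - 1)) \<longlongrightarrow> c) at_infinity" using T_tendsto by blast
  let ?a = "\<lambda>t i j. adjE t i j * inverse t ^ (N - 1)"
  let ?g = "\<lambda>t. (\<Sum>j<N. \<Sum>l<N. u j * ((T t * inverse t ^ (N - 1) * ?a t j l
      - (\<Sum>n<N. ?a t j n * (\<Sum>i<N. R $$ (n,i) * ?a t i l))) / (det (E t) * inverse t ^ N)) * om l)"
  have lim: "(?g \<longlongrightarrow> (\<Sum>j<N. \<Sum>l<N. u j * ((c * (if j = l then 1 else 0)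
      - (\<Sum>n<N. (if j = n then 1 else 0) * (\<Sum>i<N. R $$ (n,i) * (if i = l then 1 else 0)))) / 1) * om l)) at_infinity"
    by (intro tendsto_sum tendsto_mult tendsto_divide tendsto_diff tendsto_const c adjE_tendsto det_tendsto) auto
  have "eventually (\<lambda>t. det (E t) * inverse t ^ N \<noteq> 0) at_infinity"
    by (rule tendsto_imp_eventually_ne[OF det_tendsto]) simp
  then have "eventually (\<lambda>t. ?g t = t * V t * inverse t ^ (N - 1)) at_infinity"
  proof eventually_elim
    case (elim t)
    then have d: "det (E t) \<noteq> 0" and t: "t \<noteq> 0" using N_pos by auto
    define i where "i = inverse t ^ (N - 1)"
    have i0: "i \<noteq> 0" using t by (simp add: i_def)
    have iN: "inverse t ^ N = i * inverse t" unfolding i_def by (rule power_minus_mult[OF N_pos, symmetric])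
    have e: "(T t * i * (adjE t j l * i) - (\<Sum>n<N. adjE t j n * i * (\<Sum>k<N. R $$ (n,k) * (adjE t k l * i)))) / (det (E t) * inverse t ^ N)
        = t * adj_dir (E t) R $$ (j,l) * i" if jl: "j < N" "l < N" for j l
    proof -
      have "(\<Sum>n<N. adjE t j n * i * (\<Sum>k<N. R $$ (n,k) * (adjE t k l * i)))
          = i * i * (\<Sum>n<N. adjE t j n * (\<Sum>k<N. R $$ (n,k) * adjE t k l))"
        by (simp add: sum_distrib_left sum_distrib_right mult_ac)
      also have "\<dots> = i * i * (T t * adjE t j l - det (E t) * adj_dir (E t) R $$ (j,l))"
        unfolding T_def using adj_mult_adj_dir[OF E_carrier R_mat_carrier jl, of t] by (simp add: eq_diff_eq)
      finally have eq: "T t * i * (adjE t j l * i) - (\<Sum>n<N. adjE t j n * i * (\<Sum>k<N. R $$ (n,k) * (adjE t k l * i)))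
          = i * i * det (E t) * adj_dir (E t) R $$ (j,l)" by (simp add: algebra_simps)
      show ?thesis unfolding eq iN using d t i0 by (simp add: field_simps)
    qed
    have "?g t = (\<Sum>j<N. \<Sum>l<N. u j * (t * adj_dir (E t) R $$ (j,l) * i) * om l)"
      unfolding i_def[symmetric] by (intro sum.cong refl) (simp only: e lessThan_iff)
    also have "\<dots> = t * V t * i"
      unfolding V_def sum_distrib_left sum_distrib_right by (intro sum.cong refl) (simp add: mult_ac)
    finally show ?case unfolding i_def .
  qed
  with lim have "((\<lambda>t. t * V t * inverse t ^ (N - 1)) \<longlongrightarrow>
      (\<Sum>j<N. \<Sum>l<N. u j * ((c * (if j = l then 1 else 0)
      - (\<Sum>n<N. (if j = n then 1 else 0) * (\<Sum>i<N. R $$ (n,i) * (if i = l then 1 else 0)))) / 1) * om l)) at_infinity"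
    by (rule Lim_transform_eventually)
  then show ?thesis by blast
qed

lemma cleared_poly:
  assumes P: "\<And>t. poly p t \<noteq> 0 \<Longrightarrow> poly p t ^ r * g t = poly P t"
    and lim: "((\<lambda>t. g t * inverse t ^ (N - 1)) \<longlongrightarrow> c) at_infinity"
  shows "degree P \<le> tot" "coeff P tot = c"
proof -
  have "((\<lambda>t. (poly p t / t ^ degree p) ^ r * (g t * inverse t ^ (N - 1))) \<longlongrightarrow> 1 ^ r * c) at_infinity"
    by (intro tendsto_mult tendsto_power p_tendsto lim)
  moreover have "eventually (\<lambda>t. (poly p t / t ^ degree p) ^ r * (g t * inverse t ^ (N - 1)) = poly P t / t ^ tot) at_infinity"
    using eventually_p eventually_not_equal_at_infinity[of 0]
  proof eventually_elim
    case (elim t)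
    have "t ^ tot = t ^ (N - 1) * (t ^ degree p) ^ r" by (simp add: tot_def power_add power_mult mult.commute)
    then show ?case using elim by (simp add: P[symmetric] power_divide power_inverse field_simps)
  qed
  ultimately have "((\<lambda>t. poly P t / t ^ tot) \<longlongrightarrow> 1 ^ r * c) at_infinity" by (rule Lim_transform_eventually)
  then have "((\<lambda>t. poly P t / t ^ tot) \<longlongrightarrow> c) at_infinity" by simp
  from poly_degree_from_limit[OF this] show "degree P \<le> tot" "coeff P tot = c" .
qed

lemma Z_poly:
  obtains P where "degree P \<le> tot" "coeff P tot = (\<Sum>l<N. v l * om l)"
    "\<And>t. poly p t \<noteq> 0 \<Longrightarrow> poly p t ^ r * Z v t = poly P t"
proof -
  obtain P where P: "\<And>t. poly p t \<noteq> 0 \<Longrightarrow> poly p t ^ r * Z v t = poly P t"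
    using bipoly_homogenize[OF degree_Z_formal[of v], of p q] unfolding Z_formal by blast
  have "((\<lambda>t. Z v t * inverse t ^ (N - 1)) \<longlongrightarrow> (\<Sum>j<N. \<Sum>l<N. v j * (if j = l then 1 else 0) * om l)) at_infinity"
  proof -
    have "Z v t * inverse t ^ (N - 1) = (\<Sum>j<N. \<Sum>l<N. v j * (adjE t j l * inverse t ^ (N - 1)) * om l)" for t
      unfolding Z_def sum_distrib_right by (intro sum.cong refl) (simp add: mult_ac)
    then show ?thesis by (simp only:) (intro tendsto_sum tendsto_mult tendsto_const adjE_tendsto, auto)
  qed
  moreover have "(\<Sum>j<N. \<Sum>l<N. v j * (if j = l then 1 else 0) * om l) = (\<Sum>l<N. v l * om l)"
    by (intro sum.cong refl) (simp add: if_distrib[of "\<lambda>x. _ * x * _"] cong: if_cong)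
  ultimately show ?thesis using that[of P] cleared_poly[OF P] P by simp
qed

lemma T_poly:
  obtains P where "degree P \<le> tot" "\<And>t. poly p t \<noteq> 0 \<Longrightarrow> poly p t ^ r * T t = poly P t"
proof -
  have "degree (pderiv (det (E_formal D1 D2))) \<le> r" using degree_bounds(1) by (simp add: degree_pderiv)
  then obtain P where P: "\<And>t. poly p t \<noteq> 0 \<Longrightarrow> poly p t ^ r * T t = poly P t"
    using bipoly_homogenize[of "pderiv (det (E_formal D1 D2))" r p q] unfolding T_formal by blast
  then show ?thesis using that[of P] T_tendsto cleared_poly(1)[OF P] by blast
qed

lemma V_poly:
  obtains P where "degree P \<le> tot" "\<And>t. poly p t \<noteq> 0 \<Longrightarrow> poly p t ^ r * (t * V t) = poly P t"
proof -
  have "degree (pderiv (Z_formal u)) \<le> r" using degree_Z_formal[of u] by (simp add: degree_pderiv)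
  then obtain P where P: "\<And>t. poly p t \<noteq> 0 \<Longrightarrow> poly p t ^ r * V t = poly P t"
    using bipoly_homogenize[of "pderiv (Z_formal u)" r p q] unfolding V_formal by blast
  have P': "poly p t ^ r * (t * V t) = poly ([:0,1:] * P) t" if "poly p t \<noteq> 0" for t
    using P[OF that] by (simp add: mult.left_commute)
  then show ?thesis using that[of "[:0,1:] * P"] V_tendsto cleared_poly(1)[OF P'] by blast
qed

subsection \<open>The adjugate at the origin\<close>

lemma F_0: "F 0 = 1" using lst_rational[of 0] lst_0[OF Fp] by simp

lemma E_0: "i < N \<Longrightarrow> j < N \<Longrightarrow> E 0 $$ (i,j) = clam j * (complex_of_real (trans_mat D1 D2 $$ (i,j)) - (if i = j then 1 else 0))"
  unfolding E_def F_0 by (simp add: E_mat_index trans_mat_jw algebra_simps)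

text \<open>
  \<open>E(0) = (P - I) \<Lambda>\<close> is singular, so the rows of its adjugate are invariant under \<open>P\<close> and, after scaling by \<open>\<Lambda>\<close>,
  its columns are harmonic.  Irreducibility leaves only multiples of \<open>\<Lambda>\<^sup>-\<^sup>1 e \<pi>\<close>.
\<close>

lemma adj_0:
  assumes d: "det (E 0) = 0"
  obtains c where "\<And>j l. j < N \<Longrightarrow> l < N \<Longrightarrow> adjE 0 j l = c / clam j * complex_of_real (\<pi> $ l)"
proof -
  have cl: "clam j \<noteq> 0" if "j < N" for j using rate_pos[OF that] by simp
  have "\<exists>a. \<forall>l<N. adjE 0 j l = a * complex_of_real (\<pi> $ l)" if j: "j < N" for j
  proof (rule left_multiple_pi)
    fix l assume l: "l < N"
    have "0 = (\<Sum>i<N. adjE 0 j i * E 0 $$ (i,l))" using adj_mat_index_left[OF E_carrier j l, of 0] d by simp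
    also have "\<dots> = clam l * ((\<Sum>i<N. adjE 0 j i * complex_of_real (trans_mat D1 D2 $$ (i,l))) - adjE 0 j l)"
    proof -
      have "(\<Sum>i<N. adjE 0 j i * E 0 $$ (i,l))
        = (\<Sum>i<N. clam l * (adjE 0 j i * complex_of_real (trans_mat D1 D2 $$ (i,l))) - (if i = l then clam l * adjE 0 j i else 0))"
        using l by (intro sum.cong refl) (simp add: E_0 algebra_simps)
      then show ?thesis using l by (simp add: sum_subtractf right_diff_distrib sum_distrib_left)
    qed
    finally show "(\<Sum>i<N. adjE 0 j i * complex_of_real (trans_mat D1 D2 $$ (i,l))) = adjE 0 j l"
      using cl[OF l] by simp
  qed
  then obtain a where a: "\<And>j l. j < N \<Longrightarrow> l < N \<Longrightarrow> adjE 0 j l = a j * complex_of_real (\<pi> $ l)" by metis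
  have "\<exists>c. \<forall>i<N. clam i * a i = c"
  proof (rule right_const_complex[OF _ N_pos])
    fix i assume i: "i < N"
    have p0: "complex_of_real (\<pi> $ 0) \<noteq> 0" using pi_pos[OF N_pos] by simp
    have "0 = (\<Sum>j<N. E 0 $$ (i,j) * adjE 0 j 0)" using adj_mat_index_right[OF E_carrier i N_pos, of 0] d by simp
    also have "\<dots> = ((\<Sum>j<N. complex_of_real (trans_mat D1 D2 $$ (i,j)) * (clam j * a j)) - clam i * a i) * complex_of_real (\<pi> $ 0)"
    proof -
      have "(\<Sum>j<N. E 0 $$ (i,j) * adjE 0 j 0) = (\<Sum>j<N. complex_of_real (trans_mat D1 D2 $$ (i,j)) * (clam j * a j) * complex_of_real (\<pi> $ 0)
          - (if i = j then clam j * a j * complex_of_real (\<pi> $ 0) else 0))"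
        using i N_pos by (intro sum.cong refl) (simp add: E_0 a algebra_simps)
      then show ?thesis using i by (simp add: sum_subtractf left_diff_distrib sum_distrib_right)
    qed
    finally show "(\<Sum>j<N. complex_of_real (trans_mat D1 D2 $$ (i,j)) * (clam j * a j)) = clam i * a i"
      using p0 by simp
  qed
  then obtain c where "\<And>i. i < N \<Longrightarrow> clam i * a i = c" by blast
  then have "a j = c / clam j" if "j < N" for j using that cl[OF that] by (auto simp: field_simps)
  then show ?thesis using a by (intro that[of c]) simp
qed

text \<open>
  The bracket of the expansion vanishes at the origin because \<open>z\<close> satisfies the normalising equation assumed here
  for \<open>v\<close>.
\<close>

lemma Z_T_0:
  assumes d: "det (E 0) = 0" and v: "(\<Sum>j<N. v j / clam j) = h * complex_of_real (\<Sum>i<N. \<Sum>j<N. \<pi> $ i * jw i j True)"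
  shows "Z v 0 = h * T 0"
proof -
  obtain c where c: "\<And>j l. j < N \<Longrightarrow> l < N \<Longrightarrow> adjE 0 j l = c / clam j * complex_of_real (\<pi> $ l)" using adj_0[OF d] by blast
  have cl: "clam j \<noteq> 0" if "j < N" for j using rate_pos[OF that] by simp
  have "Z v 0 = (\<Sum>j<N. c * (v j / clam j) * (\<Sum>l<N. complex_of_real (\<pi> $ l) * om l))"
    unfolding Z_def sum_distrib_left by (intro sum.cong refl) (simp add: c)
  also have "\<dots> = c * (\<Sum>j<N. v j / clam j)" by (simp add: pi_om sum_distrib_left)
  also have "\<dots> = h * (c * complex_of_real (\<Sum>i<N. \<Sum>j<N. \<pi> $ i * jw i j True))" by (simp add: v)
  also have "c * complex_of_real (\<Sum>i<N. \<Sum>j<N. \<pi> $ i * jw i j True) = T 0"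
  proof -
    have "T 0 = (\<Sum>j<N. \<Sum>i<N. R $$ (i,j) * adjE 0 j i)"
      unfolding T_def det_dir_cofactor[OF E_carrier R_mat_carrier]
      using carrier_matD[OF E_carrier[of 0]] by (intro sum.cong refl) (simp add: adj_mat_def)
    also have "\<dots> = (\<Sum>j<N. \<Sum>i<N. c * (complex_of_real (\<pi> $ i) * cw i j True))"
      by (intro sum.cong refl) (use cl in \<open>simp add: c R_mat_index\<close>)
    also have "\<dots> = (\<Sum>i<N. \<Sum>j<N. c * (complex_of_real (\<pi> $ i) * cw i j True))" by (rule sum.swap)
    finally show ?thesis by (simp add: sum_distrib_left)
  qed
  finally show ?thesis .
qed

end

section \<open>The mixture model\<close>

lemma eps_bigo_eps2_zero:
  assumes "(\<lambda>\<epsilon>. complex_of_real \<epsilon> * c) \<in> O[at_right 0](\<lambda>\<epsilon>. complex_of_real (\<epsilon>\<^sup>2))" shows "c = 0"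
proof -
  obtain C where C: "C > 0" "eventually (\<lambda>\<epsilon>. norm (complex_of_real \<epsilon> * c) \<le> C * norm (complex_of_real (\<epsilon>\<^sup>2))) (at_right 0)"
    using landau_o.bigE[OF assms] by blast
  have "eventually (\<lambda>\<epsilon>::real. norm c \<le> C * \<epsilon>) (at_right 0)"
    using C(2) eventually_at_right_less[of 0]
  proof eventually_elim
    case (elim \<epsilon>)
    then have "\<epsilon> * norm c \<le> \<epsilon> * (C * \<epsilon>)" by (simp add: norm_mult norm_power power2_eq_square mult_ac)
    then show ?case using elim by simp
  qed
  moreover have "((\<lambda>\<epsilon>::real. C * \<epsilon>) \<longlongrightarrow> C * 0) (at_right 0)" by (intro tendsto_intros)
  ultimately have "norm c \<le> C * 0" by (intro tendsto_lowerbound) auto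
  then show ?thesis by simp
qed

text \<open>Passing from the roots listed with repetition to the distinct ones with multiplicities.\<close>

lemma prod_over_values:
  fixes f :: "'b \<Rightarrow> complex"
  assumes "finite A" "inj_on y' B" "y' ` B = y ` A" and \<rho>: "\<And>j. j \<in> B \<Longrightarrow> \<rho> j = card {i \<in> A. y i = y' j}"
  shows "(\<Prod>i\<in>A. f (y i)) = (\<Prod>j\<in>B. f (y' j) ^ \<rho> j)"
proof -
  have "(\<Prod>i\<in>A. f (y i)) = (\<Prod>v\<in>y ` A. \<Prod>i\<in>{i \<in> A. y i = v}. f (y i))"
    by (rule prod.group[symmetric]) (use assms in auto)
  also have "\<dots> = (\<Prod>v\<in>y ` A. f v ^ card {i \<in> A. y i = v})" by (intro prod.cong refl) simp
  also have "\<dots> = (\<Prod>j\<in>B. f (y' j) ^ card {i \<in> A. y i = y' j})"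
    unfolding assms(3)[symmetric] using assms(2) by (subst prod.reindex) auto
  finally show ?thesis using \<rho> by (simp cong: prod.cong)
qed

lemma sum_over_values:
  assumes "finite A" "inj_on y' B" "y' ` B = y ` A" and \<rho>: "\<And>j. j \<in> B \<Longrightarrow> \<rho> j = card {i \<in> A. y i = y' j}"
  shows "(\<Sum>j\<in>B. \<rho> j) = card A"
proof -
  have "card A = (\<Sum>v\<in>y ` A. \<Sum>i\<in>{i \<in> A. y i = v}. 1)"
    using assms by (subst sum.group) auto
  also have "\<dots> = (\<Sum>j\<in>B. card {i \<in> A. y i = y' j})"
    unfolding assms(3)[symmetric] using assms(2) by (subst sum.reindex) auto
  finally show ?thesis using \<rho> by simp
qed

text \<open>The hypotheses of the proposition in terms of index functions; \<open>Ai\<close> stands for the inverse of \<open>A\<close>.\<close>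

locale replace_model = base_queue +
  fixes Fh :: "real measure" and Le :: "real \<Rightarrow> (real \<times> nat) measure"
    and s x y y' :: "nat \<Rightarrow> complex" and m \<rho> :: "nat \<Rightarrow> nat" and \<sigma> :: nat
    and Ai :: "nat \<Rightarrow> nat \<Rightarrow> complex"
  assumes Fh: "service_dist Fh" and heavy: "heavy_tailed Fh"
    and stable: "drift D1 D2 \<pi> (mean Fp \<cdot>\<^sub>m hadamard (Q2 D1 D2) (trans_mat D1 D2)) > 0"
    and Le: "\<And>\<epsilon>. 0 < \<epsilon> \<Longrightarrow> \<epsilon> < 1 \<Longrightarrow>
       drift D1 D2 \<pi> ((mean Fp + \<epsilon> * (mean Fh - mean Fp)) \<cdot>\<^sub>m hadamard (Q2 D1 D2) (trans_mat D1 D2)) > 0 \<Longrightarrow>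
       steady_state D1 D2 (mixture \<epsilon> Fp Fh) (Le \<epsilon>)"
    and roots: "{t. Re t \<ge> 0 \<and> det (E t) = 0} = s ` {..<N}" and inj_s: "inj_on s {..<N}" and s_0: "s 0 = 0"
    and simple_roots: "\<And>i. i \<in> {1..<N} \<Longrightarrow> Re (s i) > 0 \<and> deriv (\<lambda>t. det (E t)) (s i) \<noteq> 0"
    and m: "\<And>i. i \<in> {1..<N} \<Longrightarrow> m i < N"
    and Ai_right: "\<And>j l. j < N \<Longrightarrow> l < N \<Longrightarrow>
      1 / clam j * Ai 0 l + (\<Sum>i\<in>{1..<N}. adjE (s i) j (m i) * Ai i l) = (if j = l then 1 else 0)"
    and Ai_left: "\<And>i. i < N \<Longrightarrow> (\<Sum>l<N. Ai i l / clam l) = (if i = 0 then 1 else 0)"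
    and det_factors: "\<And>t. poly p t \<noteq> 0 \<Longrightarrow> poly p t ^ r * det (E t)
           = t * (\<Prod>k\<in>{1..<N}. t - s k) * (\<Prod>j<r * degree p. t + x j)"
    and Z_factors: "\<And>t. poly p t \<noteq> 0 \<Longrightarrow> poly p t ^ r * (t * Z u t)
           = uom * t * (\<Prod>k\<in>{1..<N}. t - s k) * (\<Prod>j<r * degree p. t + y j)"
    and xy_pos: "\<And>j. j < r * degree p \<Longrightarrow> Re (x j) > 0 \<and> Re (y j) > 0"
    and inj_y': "inj_on y' {..<\<sigma>}" and y'_image: "y' ` {..<\<sigma>} = y ` {..<r * degree p}"
    and mult_y': "\<And>j. j < \<sigma> \<Longrightarrow> \<rho> j = card {i. i < r * degree p \<and> y i = y' j}"
begin

definition h :: "complex \<Rightarrow> complex" where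
  "h t = complex_of_real (mean Fp) * excess_lst Fp t - complex_of_real (mean Fh) * excess_lst Fh t"
definition k :: "complex \<Rightarrow> complex" where "k t = lst Fh t - lst Fp t"
definition we :: "real \<Rightarrow> complex \<Rightarrow> complex" where "we \<epsilon> t = (\<Sum>l<N. workload_lt N (Le \<epsilon>) t $ l * om l)"
abbreviation D :: "complex set" where "D \<equiv> {t. Re t \<ge> 0} - s ` {1..<N}"

definition load :: real where "load = (\<Sum>i<N. \<Sum>j<N. \<pi> $ i * jw i j True)"
abbreviation d0 :: complex where "d0 \<equiv> complex_of_real ((mean Fp - mean Fh) * load)"

definition \<delta> :: "nat \<Rightarrow> complex" where
  "\<delta> i = det_dir (E (s i)) (k (s i) \<cdot>\<^sub>m R) / det_dir (E (s i)) (mat_deriv E (s i))"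
definition zz :: "nat \<Rightarrow> complex" where
  "zz l = d0 * Ai 0 l + (\<Sum>i\<in>{1..<N}. (\<Sum>j<N. u j * (\<delta> i * adj_dir (E (s i)) (mat_deriv E (s i)) $$ (j, m i)
    - adj_dir (E (s i)) (k (s i) \<cdot>\<^sub>m R) $$ (j, m i))) * Ai i l)"

lemma k_eq: "Re t \<ge> 0 \<Longrightarrow> k t = t * h t"
  using mean_excess_lst[OF Fp, of t] mean_excess_lst[OF Fh, of t] by (simp add: k_def h_def right_diff_distrib)

lemma h_0: "h 0 = complex_of_real (mean Fp - mean Fh)" by (simp add: h_def excess_lst_def)

text \<open>The columns \<open>a\<^sub>i\<close> do not contribute: by \<open>A\<^sup>-\<^sup>1 A = I\<close>, rows \<open>i \<ge> 1\<close> of \<open>A\<^sup>-\<^sup>1\<close> annihilate \<open>\<Lambda>\<^sup>-\<^sup>1 e\<close>.\<close>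

lemma zz_drift: "(\<Sum>l<N. zz l / clam l) = h 0 * complex_of_real load"
proof -
  let ?b = "\<lambda>i. (\<Sum>j<N. u j * (\<delta> i * adj_dir (E (s i)) (mat_deriv E (s i)) $$ (j, m i)
    - adj_dir (E (s i)) (k (s i) \<cdot>\<^sub>m R) $$ (j, m i)))"
  have "(\<Sum>l<N. zz l / clam l) = d0 * (\<Sum>l<N. Ai 0 l / clam l) + (\<Sum>l<N. \<Sum>i\<in>{1..<N}. ?b i * (Ai i l / clam l))"
    unfolding zz_def
    by (simp only: add_divide_distrib sum.distrib sum_distrib_left[of d0] sum_divide_distrib times_divide_eq_right)
  also have "(\<Sum>l<N. \<Sum>i\<in>{1..<N}. ?b i * (Ai i l / clam l)) = (\<Sum>i\<in>{1..<N}. ?b i * (\<Sum>l<N. Ai i l / clam l))"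
    by (subst sum.swap) (simp only: sum_distrib_left)
  also have "\<dots> = 0" by (intro sum.neutral ballI) (simp add: Ai_left)
  finally show ?thesis using Ai_left[OF N_pos] by (simp add: h_0)
qed

lemma E_holomorphic:
  assumes ij: "i < N" "j < N" shows "(\<lambda>t. E t $$ (i,j)) holomorphic_on {t. Re t > 0}"
proof -
  have nz: "poly p t \<noteq> 0" if "t \<in> {t. Re t > 0}" for t using that p_nonzero by simp
  show ?thesis
  proof (cases "i = j")
    case True
    show ?thesis unfolding E_def E_mat_index[OF ij] if_P[OF True] by (intro holomorphic_intros nz)
  next
    case False
    show ?thesis unfolding E_def E_mat_index[OF ij] if_not_P[OF False] by (intro holomorphic_intros nz)
  qed
qed

text \<open>The drift is continuous in \<open>\<epsilon>\<close>, so stability of the base model makes the mixture stable for small \<open>\<epsilon>\<close>.\<close>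

lemma eventually_stable:
  obtains e0 where "e0 > 0" "\<And>\<epsilon>. 0 < \<epsilon> \<Longrightarrow> \<epsilon> < e0 \<Longrightarrow> \<epsilon> < 1 \<and> steady_state D1 D2 (mixture \<epsilon> Fp Fh) (Le \<epsilon>)"
proof -
  let ?f = "\<lambda>\<epsilon>::real. (\<Sum>i<N. \<pi> $ i / lam i) - (mean Fp + \<epsilon> * (mean Fh - mean Fp)) * (\<Sum>i<N. \<Sum>j<N. \<pi> $ i * jw i j True)"
  have "(?f \<longlongrightarrow> ?f 0) (at_right 0)" by (intro tendsto_intros)
  moreover have "?f 0 > 0" using stable by (simp add: drift_eq)
  ultimately have "eventually (\<lambda>\<epsilon>. ?f \<epsilon> > 0) (at_right 0)" by (rule order_tendstoD(1))
  then obtain b where b: "b > 0" "\<And>\<epsilon>. 0 < \<epsilon> \<Longrightarrow> \<epsilon> < b \<Longrightarrow> ?f \<epsilon> > 0"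
    unfolding eventually_at_right_field by auto
  show ?thesis
  proof (rule that[of "min b 1"])
    fix \<epsilon> :: real assume e: "0 < \<epsilon>" "\<epsilon> < min b 1"
    then show "\<epsilon> < 1 \<and> steady_state D1 D2 (mixture \<epsilon> Fp Fh) (Le \<epsilon>)"
      using Le[of \<epsilon>] b(2)[of \<epsilon>] by (simp add: drift_eq)
  qed (use b in simp)
qed

lemma delay_expansion:
  shows "\<And>t. Re t \<ge> 0 \<Longrightarrow> det (E t) \<noteq> 0 \<Longrightarrow>
      (\<lambda>\<epsilon>. we \<epsilon> t - (w t + complex_of_real \<epsilon> * ((t * Z zz t - t * h t * (w t * T t - t * V t)) / det (E t))))
        \<in> O[at_right 0](\<lambda>\<epsilon>. complex_of_real (\<epsilon>\<^sup>2))" (is "\<And>t. ?A t \<Longrightarrow> ?B t \<Longrightarrow> ?P t")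
    and "eventually (\<lambda>\<epsilon>. we \<epsilon> 0 = 1) (at_right 0)"
proof -
  obtain e0 where e0: "e0 > 0"
    and ss: "\<And>\<epsilon>. 0 < \<epsilon> \<Longrightarrow> \<epsilon> < e0 \<Longrightarrow> \<epsilon> < 1 \<and> steady_state D1 D2 (mixture \<epsilon> Fp Fh) (Le \<epsilon>)"
    using eventually_stable by blast
  note mixn = nonneg_dist_mixture[OF Fp_nonneg service_dist_nonneg[OF Fh]]
  \<comment> \<open>A steady state of the mixture is given only for positive \<open>\<epsilon>\<close>; at \<open>\<epsilon> = 0\<close> the family continues with the base
    model.\<close>
  define \<Phi> where "\<Phi> \<epsilon> t i = (if \<epsilon> = 0 then phi t i else workload_lt N (Le \<epsilon>) t $ i)" for \<epsilon> :: real and t i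
  define \<nu> where "\<nu> \<epsilon> j = (if \<epsilon> = 0 then u j else empty_vec (mixture \<epsilon> Fp Fh) (Le \<epsilon>) j)" for \<epsilon> :: real and j
  define c0 where "c0 = complex_of_real (drift D1 D2 \<pi> (mean Fp \<cdot>\<^sub>m hadamard (Q2 D1 D2) (trans_mat D1 D2)))"
  have mix: "lst (mixture \<epsilon> Fp Fh) t = lst Fp t + complex_of_real \<epsilon> * k t"
    if "0 < \<epsilon>" "\<epsilon> < e0" "Re t \<ge> 0" for \<epsilon> t
    using lst_mixture[OF Fp_nonneg service_dist_nonneg[OF Fh], of \<epsilon> t] ss[of \<epsilon>] that by (simp add: k_def algebra_simps)
  interpret PF: perturbed_family N E R k \<Phi> \<nu> e0 s m "\<lambda>j. 1 / clam j" c0 d0 Ai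
  proof
    show "E t \<in> carrier_mat N N" for t by simp
    show "R \<in> carrier_mat N N" by simp
    show "0 < e0" by fact
    fix \<epsilon> :: real assume e: "0 \<le> \<epsilon>" "\<epsilon> < e0"
    show "(\<Sum>i<N. \<Phi> \<epsilon> t i * (E t $$ (i,j) + complex_of_real \<epsilon> * k t * R $$ (i,j))) = t * \<nu> \<epsilon> j"
      if t: "Re t \<ge> 0" and j: "j < N" for t j
    proof (cases "\<epsilon> = 0")
      case True then show ?thesis using base_equation[OF j t] by (simp add: \<Phi>_def \<nu>_def)
    next
      case False
      with e have e': "0 < \<epsilon>" by simp
      have "(\<Sum>i<N. workload_lt N (Le \<epsilon>) t $ i * E_mat D1 D2 (lst (mixture \<epsilon> Fp Fh) t) t $$ (i,j))
          = t * empty_vec (mixture \<epsilon> Fp Fh) (Le \<epsilon>) j"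
        by (rule stationary_equation[OF mixn _ j t]) (use ss[OF e' e(2)] in simp)
      moreover have "E_mat D1 D2 (lst (mixture \<epsilon> Fp Fh) t) t $$ (i,j) = E t $$ (i,j) + complex_of_real \<epsilon> * k t * R $$ (i,j)" if "i < N" for i
        using that j t by (simp add: mix[OF e' e(2) t] lst_rational E_def E_mat_index R_mat_index algebra_simps)
      ultimately show ?thesis using False by (simp add: \<Phi>_def \<nu>_def)
    qed
    show "norm (\<Phi> \<epsilon> t i) \<le> 1" if "Re t \<ge> 0" "i < N" for t i
      using norm_phi_le[OF Fp_nonneg L] norm_phi_le[OF mixn, of \<epsilon> "Le \<epsilon>"] ss[of \<epsilon>] e that by (auto simp: \<Phi>_def)
    show "(\<lambda>t. \<Phi> \<epsilon> t i) holomorphic_on {t. Re t > 0}" if "i < N" for i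
      using phi_holomorphic[OF Fp_nonneg L] phi_holomorphic[OF mixn, of \<epsilon> "Le \<epsilon>"] ss[of \<epsilon>] e that
      by (cases "\<epsilon> = 0") (auto simp: \<Phi>_def)
    show "(\<Sum>j<N. \<nu> \<epsilon> j * (1 / clam j)) = c0 + complex_of_real \<epsilon> * d0"
    proof (cases "\<epsilon> = 0")
      case True then show ?thesis using u_drift by (simp add: \<nu>_def c0_def)
    next
      case False
      with e have e': "0 < \<epsilon>" by simp
      let ?T = "\<lambda>n. complex_of_real (inverse (real (Suc n)))"
      have T: "Re (?T n) \<ge> 0" "?T n \<noteq> 0" for n by simp (simp only: of_real_eq_0_iff, simp)
      have TL: "?T \<longlonglongrightarrow> 0" using tendsto_of_real[OF LIMSEQ_inverse_real_of_nat] by (simp only: of_real_0)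
      have "(1 - lst (mixture \<epsilon> Fp Fh) (?T n)) / ?T n
          = (1 - complex_of_real \<epsilon>) * ((1 - lst Fp (?T n)) / ?T n) + complex_of_real \<epsilon> * ((1 - lst Fh (?T n)) / ?T n)" for n
        unfolding mix[OF e' e(2) T(1)] k_def by (simp only: times_divide_eq_right add_divide_distrib[symmetric]) (simp add: algebra_simps)
      moreover have "(\<lambda>n. (1 - complex_of_real \<epsilon>) * ((1 - lst Fp (?T n)) / ?T n) + complex_of_real \<epsilon> * ((1 - lst Fh (?T n)) / ?T n))
         \<longlonglongrightarrow> (1 - complex_of_real \<epsilon>) * complex_of_real (mean Fp) + complex_of_real \<epsilon> * complex_of_real (mean Fh)"
        by (intro tendsto_intros lst_difference_quotient[OF Fp] lst_difference_quotient[OF Fh] T TL)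
      ultimately have lim: "(\<lambda>n. (1 - lst (mixture \<epsilon> Fp Fh) (?T n)) / ?T n)
         \<longlonglongrightarrow> (1 - complex_of_real \<epsilon>) * complex_of_real (mean Fp) + complex_of_real \<epsilon> * complex_of_real (mean Fh)" by (simp only:)
      have "(\<Sum>j<N. empty_vec (mixture \<epsilon> Fp Fh) (Le \<epsilon>) j / clam j) = complex_of_real (\<Sum>i<N. \<pi> $ i / lam i)
          - ((1 - complex_of_real \<epsilon>) * complex_of_real (mean Fp) + complex_of_real \<epsilon> * complex_of_real (mean Fh)) * complex_of_real load"
        unfolding load_def by (rule empty_vec_drift[OF mixn _ lim]) (use ss[OF e' e(2)] in simp)
      then show ?thesis using False by (simp add: \<nu>_def c0_def drift_eq load_def[symmetric] algebra_simps)
    qed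
  next
    show "k holomorphic_on {t. Re t > 0}"
      unfolding k_def by (intro holomorphic_intros lst_holomorphic Fp Fh)
    show "(\<lambda>t. E t $$ (i,j)) holomorphic_on {t. Re t > 0}" if "i < N" "j < N" for i j
      using E_holomorphic that .
    show "Re (s i) > 0 \<and> det (E (s i)) = 0 \<and> deriv (\<lambda>t. det (E t)) (s i) \<noteq> 0 \<and> m i < N" if "i \<in> {1..<N}" for i
    proof -
      have "s i \<in> {t. Re t \<ge> 0 \<and> det (E t) = 0}" unfolding roots using that by auto
      then show ?thesis using simple_roots[OF that] m[OF that] by simp
    qed
  qed (use Ai_right in auto)
  have nu0: "\<nu> 0 = u" and Phi0: "\<Phi> 0 t = phi t" for t by (auto simp: \<nu>_def \<Phi>_def)
  have z: "PF.z l = zz l" if "l < N" for l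
    unfolding PF.z_def zz_def \<delta>_def nu0[symmetric]
    by (intro arg_cong2[of _ _ _ _ "(+)"] refl sum.cong arg_cong2[of _ _ _ _ "(*)"] PF.kappa_0_eq m) auto
  show "?P t" if t: "Re t \<ge> 0" "det (E t) \<noteq> 0" for t
  proof (rule bigo_eventually_cong)
    have one: "(\<Sum>l<N. PF.\<Phi>1 t l * om l) = (t * Z zz t - t * h t * (w t * T t - t * V t)) / det (E t)"
    proof -
      have "(\<Sum>l<N. PF.\<Phi>1 t l * om l)
          = (\<Sum>l<N. \<Sum>j<N. (t * zz j - k t * (\<Sum>i<N. phi t i * R $$ (i,j))) * adjE t j l * om l) / det (E t)"
      proof -
        have "(\<Sum>j<N. (t * PF.z j - k t * PF.\<Phi>R 0 t j) * adjE t j l)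
            = (\<Sum>j<N. (t * zz j - k t * (\<Sum>i<N. phi t i * R $$ (i,j))) * adjE t j l)" for l
          by (intro sum.cong refl) (simp only: z lessThan_iff PF.\<Phi>R_def Phi0)
        then have "PF.\<Phi>1 t l * om l
            = (\<Sum>j<N. (t * zz j - k t * (\<Sum>i<N. phi t i * R $$ (i,j))) * adjE t j l * om l) / det (E t)" for l
          by (simp only: PF.\<Phi>1_def sum_distrib_right times_divide_eq_left)
        then show ?thesis by (simp only: sum_divide_distrib)
      qed
      also have "(\<Sum>l<N. \<Sum>j<N. (t * zz j - k t * (\<Sum>i<N. phi t i * R $$ (i,j))) * adjE t j l * om l)
          = t * (\<Sum>l<N. \<Sum>j<N. zz j * adjE t j l * om l)
            - k t * (\<Sum>l<N. (\<Sum>j<N. (\<Sum>i<N. phi t i * R $$ (i,j)) * adjE t j l) * om l)"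
      proof -
        have "(\<Sum>l<N. \<Sum>j<N. (t * zz j - k t * X j) * adjE t j l * om l)
          = t * (\<Sum>l<N. \<Sum>j<N. zz j * adjE t j l * om l) - k t * (\<Sum>l<N. (\<Sum>j<N. X j * adjE t j l) * om l)" for X
          by (simp only: sum_distrib_left sum_distrib_right sum_subtractf[symmetric] left_diff_distrib mult.assoc)
        then show ?thesis .
      qed
      also have "(\<Sum>l<N. \<Sum>j<N. zz j * adjE t j l * om l) = Z zz t" unfolding Z_def by (rule sum.swap)
      finally show ?thesis by (simp only: phi_R_adj[OF t] k_eq[OF t(1)])
    qed
    show "eventually (\<lambda>\<epsilon>. we \<epsilon> t - (w t + complex_of_real \<epsilon> * ((t * Z zz t - t * h t * (w t * T t - t * V t)) / det (E t)))
        = (\<Sum>l<N. (\<Phi> \<epsilon> t l - \<Phi> 0 t l - complex_of_real \<epsilon> * PF.\<Phi>1 t l) * om l)) (at_right 0)"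
      using eventually_at_right_less[of 0]
    proof eventually_elim
      case (elim \<epsilon>)
      have "(\<Sum>l<N. (\<Phi> \<epsilon> t l - \<Phi> 0 t l - complex_of_real \<epsilon> * PF.\<Phi>1 t l) * om l)
          = we \<epsilon> t - w t - complex_of_real \<epsilon> * (\<Sum>l<N. PF.\<Phi>1 t l * om l)"
        using elim by (simp add: we_def w_def \<Phi>_def left_diff_distrib sum_subtractf sum_distrib_left mult.assoc)
      then show ?case unfolding one by simp
    qed
    show "(\<lambda>\<epsilon>. \<Sum>l<N. (\<Phi> \<epsilon> t l - \<Phi> 0 t l - complex_of_real \<epsilon> * PF.\<Phi>1 t l) * om l) \<in> O[at_right 0](\<lambda>\<epsilon>. complex_of_real (\<epsilon>\<^sup>2))"
      by (intro big_sum_in_bigo bigo_mult_const PF.Phi_expansion t) auto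
  qed
  show "eventually (\<lambda>\<epsilon>. we \<epsilon> 0 = 1) (at_right 0)"
    using eventually_at_right_real[OF e0]
  proof eventually_elim
    case (elim \<epsilon>)
    then have "workload_lt N (Le \<epsilon>) 0 $ l = complex_of_real (\<pi> $ l)" if "l < N" for l
      using phi_0[OF mixn, of \<epsilon> "Le \<epsilon>" l] ss[of \<epsilon>] that by simp
    then show ?case using pi_om by (simp add: we_def)
  qed
qed

sublocale FS: fraction_shape N s \<sigma> y' \<rho>
proof
  show "inj_on s {1..<N}" by (rule inj_on_subset[OF inj_s]) auto
  show "inj_on y' {..<\<sigma>}" by (rule inj_y')
  have "Re (y' j) > 0" if "j < \<sigma>" for j
  proof -
    have "y' j \<in> y ` {..<r * degree p}" using that unfolding y'_image[symmetric] by auto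
    then show ?thesis using xy_pos by auto
  qed
  then show "y' j \<noteq> 0" if "j < \<sigma>" for j using that by fastforce
  show "s k \<noteq> - y' j" if "k \<in> {1..<N}" "j < \<sigma>" for k j
  proof
    assume "s k = - y' j"
    then have "Re (s k) = - Re (y' j)" by simp
    then show False using simple_roots[OF that(1)] \<open>\<And>j. j < \<sigma> \<Longrightarrow> Re (y' j) > 0\<close>[OF that(2)] by simp
  qed
qed

lemma prod_y: "(\<Prod>j<r * degree p. t + y j) = (\<Prod>j<\<sigma>. (t + y' j) ^ \<rho> j)"
  by (rule prod_over_values[where f = "\<lambda>v. t + v"]) (use inj_y' y'_image mult_y' in auto)

lemma total_tot: "FS.total = tot"
proof -
  have "(\<Sum>j<\<sigma>. \<rho> j) = card {..<r * degree p}"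
    by (rule sum_over_values[where y = y and y' = y']) (use inj_y' y'_image mult_y' in auto)
  then show ?thesis by (simp add: FS.total_def tot_def)
qed

lemma y'_pos: "j < \<sigma> \<Longrightarrow> Re (y' j) > 0"
proof -
  assume "j < \<sigma>"
  then have "y' j \<in> y ` {..<r * degree p}" unfolding y'_image[symmetric] by auto
  then show ?thesis using xy_pos by auto
qed

lemma D_poles: "t \<in> D \<Longrightarrow> t \<notin> FS.poles"
  using y'_pos by (force simp: FS.poles_def)

text \<open>
  The factor \<open>t\<close> in the given factorisation of \<open>t Z u\<close> can be cancelled also at \<open>t = 0\<close>, since both sides are
  polynomials.
\<close>

lemma Z_u_denom: assumes "poly p t \<noteq> 0" shows "poly p t ^ r * Z u t = uom * FS.denom t"
proof -
  obtain P where P: "\<And>t. poly p t \<noteq> 0 \<Longrightarrow> poly p t ^ r * Z u t = poly P t" using Z_poly[of u] by blast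
  let ?Q = "Polynomial.smult uom (pf_denom FS.K FS.pole FS.ord_at)"
  have Q: "poly ?Q t = uom * FS.denom t" for t by (simp only: FS.denom_eq poly_smult)
  have eq: "poly P t = poly ?Q t" if "t \<noteq> 0" "poly p t \<noteq> 0" for t
  proof -
    have "t * poly P t = t * poly ?Q t"
      using Z_factors[OF that(2)] P[OF that(2)] unfolding Q FS.denom_def prod_y by (simp add: mult_ac)
    then show ?thesis using that by simp
  qed
  have "infinite (UNIV - insert 0 {t. poly p t = 0})"
    using poly_roots_finite[OF p_nz] infinite_UNIV_char_0 by (intro Diff_infinite_finite) auto
  moreover have "UNIV - insert 0 {t. poly p t = 0} \<subseteq> {t. poly (P - ?Q) t = 0}" using eq by auto
  ultimately have "infinite {t. poly (P - ?Q) t = 0}" using finite_subset by blast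
  then have "P - ?Q = 0" using poly_roots_finite by blast
  then show ?thesis using P[OF assms] Q by simp
qed

lemma det_nonzero: "t \<in> D \<Longrightarrow> t \<noteq> 0 \<Longrightarrow> det (E t) \<noteq> 0"
proof
  assume t: "t \<in> D" "t \<noteq> 0" and "det (E t) = 0"
  then have "t \<in> s ` {..<N}" unfolding roots[symmetric] by simp
  then obtain i where i: "i < N" "t = s i" by auto
  then show False using t s_0 by (cases "i = 0") auto
qed

lemma det_E_0: "det (E 0) = 0"
proof -
  have "s 0 \<in> s ` {..<N}" using N_pos by simp
  then show ?thesis unfolding roots[symmetric] s_0 by simp
qed

lemma w_factors: assumes t: "t \<in> D" "t \<noteq> 0"
  shows "w t * (\<Prod>j<r * degree p. t + x j) = uom * (\<Prod>j<r * degree p. t + y j)"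
proof -
  have p: "poly p t \<noteq> 0" using t p_nonzero by simp
  let ?s = "\<Prod>k\<in>{1..<N}. t - s k"
  have s: "t * ?s \<noteq> 0" using t by auto
  have "(t * ?s) * (w t * (\<Prod>j<r * degree p. t + x j)) = w t * (poly p t ^ r * det (E t))"
    unfolding det_factors[OF p] by (simp add: mult_ac)
  also have "\<dots> = poly p t ^ r * (t * Z u t)" using w_det[of t] t by (simp add: mult_ac)
  also have "\<dots> = (t * ?s) * (uom * (\<Prod>j<r * degree p. t + y j))" unfolding Z_factors[OF p] by (simp add: mult_ac)
  finally show ?thesis using s by (simp only: mult_cancel_left simp_thms)
qed

lemma prod_pos_nonzero: "Re t \<ge> 0 \<Longrightarrow> (\<And>j. j < n \<Longrightarrow> Re (v j) > 0) \<Longrightarrow> (\<Prod>j<n. t + v j) \<noteq> 0" for n :: nat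
proof -
  assume a: "Re t \<ge> 0" "\<And>j. j < n \<Longrightarrow> Re (v j) > 0"
  have "t + v j \<noteq> 0" if "j < n" for j
  proof
    assume "t + v j = 0"
    then have "Re t + Re (v j) = 0" by (metis plus_complex.sel(1) zero_complex.sel(1))
    then show False using a(1) a(2)[OF that] by simp
  qed
  then show ?thesis by (subst prod_zero_iff) auto
qed

lemma w_nonzero: assumes t: "t \<in> D" "t \<noteq> 0" shows "w t \<noteq> 0"
proof -
  have "(\<Prod>j<r * degree p. t + y j) \<noteq> 0" by (rule prod_pos_nonzero) (use t xy_pos in auto)
  then show ?thesis using w_factors[OF t] uom_nonzero by auto
qed

lemma Z_u_nonzero: assumes t: "t \<in> D" shows "Z u t \<noteq> 0"
proof -
  have "FS.denom t \<noteq> 0" by (rule FS.denom_nonzero[OF D_poles[OF t]])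
  then show ?thesis using Z_u_denom[of t] p_nonzero t uom_nonzero by auto
qed

lemma quotient_denom:
  assumes t: "t \<in> D" and P: "poly p t ^ r * g = poly P t"
  shows "poly P t / FS.denom t = uom * g / Z u t"
proof -
  have p: "poly p t ^ r \<noteq> 0" using p_nonzero t by simp
  have d: "FS.denom t = poly p t ^ r * Z u t / uom" using Z_u_denom[of t] p_nonzero t uom_nonzero by simp
  have "c * g / (c * v / uom) = uom * g / v" if "c \<noteq> 0" for c v using that by simp
  then show ?thesis unfolding d P[symmetric] using p by blast
qed

text \<open>A relation with \<open>b \<noteq> 0\<close> would make \<open>h\<close> rational, and with it the transform of the heavy-tailed distribution, which
  is \<open>q/p + t h\<close>.\<close>

lemma h_not_rational:
  assumes z: "\<And>t. Re t > 0 \<Longrightarrow> t \<notin> X \<Longrightarrow> poly a t + h t * poly b t = 0" and X: "finite X"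
  shows "b = 0"
proof (rule ccontr)
  assume "b \<noteq> 0"
  then have ne: "p * b \<noteq> 0" using p_nz by simp
  show False
  proof (rule heavy_tailed_lst_not_rational[OF Fh heavy X ne])
    fix t assume t: "Re t > 0" "t \<notin> X"
    have p: "poly p t \<noteq> 0" using t p_nonzero by simp
    have "lst Fh t = lst Fp t + t * h t" using k_eq[of t] t by (simp add: k_def algebra_simps)
    then have "poly (p * b) t * lst Fh t = poly p t * (poly b t * (poly q t / poly p t) + t * (h t * poly b t))"
      using lst_rational[of t] t by (simp add: algebra_simps)
    also have "h t * poly b t = - poly a t" using z[OF t] by (simp add: add_eq_0_iff)
    also have "poly p t * (poly b t * (poly q t / poly p t) + t * - poly a t) = poly (q * b - [:0,1:] * p * a) t"
      using p by (simp add: algebra_simps)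
    finally show "poly (p * b) t * lst Fh t = poly (q * b - [:0,1:] * p * a) t" .
  qed
qed

subsection \<open>The expansion and its coefficients\<close>

abbreviation "U \<equiv> {t. Re t > 0} - s ` {1..<N}"

lemma infinite_U: "infinite U"
proof -
  have "infinite {t::complex. Re t > 0}"
  proof
    assume f: "finite {t::complex. Re t > 0}"
    have "inj (\<lambda>n. complex_of_real (real (Suc n)))" by (auto intro: injI)
    moreover have "range (\<lambda>n. complex_of_real (real (Suc n))) \<subseteq> {t. Re t > 0}" by auto
    ultimately show False using f finite_subset range_inj_infinite by blast
  qed
  then show ?thesis by (intro Diff_infinite_finite) auto
qed

lemma U_D: "t \<in> U \<Longrightarrow> t \<in> D" "t \<in> U \<Longrightarrow> t \<noteq> 0" by auto

lemma U_poles: "U \<inter> FS.poles = {}" using D_poles U_D(1) by blast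

text \<open>
  The first-order coefficient of the delay transform.  At the origin \<open>det E\<close> vanishes, but there both delay
  transforms are \<open>1\<close>.
\<close>

definition slope :: "complex \<Rightarrow> complex" where
  "slope t = (if t = 0 then 0 else (t * Z zz t - t * h t * (w t * T t - t * V t)) / det (E t))"

abbreviation zom :: complex where "zom \<equiv> \<Sum>l<N. zz l * om l"

definition bracket :: "coeffs \<Rightarrow> complex \<Rightarrow> complex" where
  "bracket = (\<lambda>((\<alpha>,\<alpha>''),(\<beta>0,\<beta>,\<beta>''),(\<gamma>0,\<gamma>,\<gamma>'')) t.
     FS.SF zom \<alpha> \<alpha>'' t + h t * FS.SF \<beta>0 \<beta> \<beta>'' t - h t * w t * FS.SF \<gamma>0 \<gamma> \<gamma>'' t)"

lemma slope_expansion: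
  assumes t: "t \<in> D"
  shows "(\<lambda>\<epsilon>. we \<epsilon> t - (w t + complex_of_real \<epsilon> * slope t)) \<in> O[at_right 0](\<lambda>\<epsilon>. complex_of_real (\<epsilon>\<^sup>2))"
proof (cases "t = 0")
  case True
  show ?thesis
  proof (rule bigo_eventually_cong)
    show "eventually (\<lambda>\<epsilon>. we \<epsilon> t - (w t + complex_of_real \<epsilon> * slope t) = 0) (at_right 0)"
      using delay_expansion(2) by eventually_elim (simp add: True w_0 slope_def)
  qed simp
next
  case False
  then show ?thesis using delay_expansion(1)[of t] t det_nonzero[OF t False] by (simp add: slope_def)
qed

text \<open>
  A first-order coefficient is determined by the expansion.  Hence the coefficient families matter only through the
  values of \<open>slope\<close>.
\<close>

lemma expansion_iff:
  assumes t: "t \<in> D"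
  shows "(\<lambda>\<epsilon>. we \<epsilon> t - (w t + complex_of_real \<epsilon> * c)) \<in> O[at_right 0](\<lambda>\<epsilon>. complex_of_real (\<epsilon>\<^sup>2)) \<longleftrightarrow> c = slope t"
proof
  assume "(\<lambda>\<epsilon>. we \<epsilon> t - (w t + complex_of_real \<epsilon> * c)) \<in> O[at_right 0](\<lambda>\<epsilon>. complex_of_real (\<epsilon>\<^sup>2))"
  from sum_in_bigo(2)[OF this slope_expansion[OF t]]
  have "(\<lambda>\<epsilon>. complex_of_real \<epsilon> * (slope t - c)) \<in> O[at_right 0](\<lambda>\<epsilon>. complex_of_real (\<epsilon>\<^sup>2))"
    by (simp add: algebra_simps)
  then show "c = slope t" using eps_bigo_eps2_zero by fastforce
qed (use slope_expansion[OF t] in simp)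

text \<open>
  Partial fractions of \<open>Z z\<close>, \<open>t V\<close> and \<open>T\<close> over \<open>Z u\<close>; the powers of \<open>p\<close> cancel in the quotients.  The third quotient is
  the one that expresses the relative change of \<open>det E\<close>.
\<close>

lemma coefficients_exist:
  obtains C where "C \<in> coefficients N \<sigma> \<rho>"
    and "\<And>t. t \<in> D \<Longrightarrow> 1 / uom * w t * bracket C t = slope t"
    and "case C of (_, _, (\<gamma>0, \<gamma>, \<gamma>'')) \<Rightarrow> \<forall>t\<in>D. h t * w t * FS.SF \<gamma>0 \<gamma> \<gamma>'' t * det (E t) = uom * (t * h t * T t)"
proof -
  obtain PZ where PZ: "degree PZ \<le> tot" "coeff PZ tot = zom" "\<And>t. poly p t \<noteq> 0 \<Longrightarrow> poly p t ^ r * Z zz t = poly PZ t"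
    using Z_poly[of zz] by blast
  obtain PT where PT: "degree PT \<le> tot" "\<And>t. poly p t \<noteq> 0 \<Longrightarrow> poly p t ^ r * T t = poly PT t"
    using T_poly by blast
  obtain PV where PV: "degree PV \<le> tot" "\<And>t. poly p t \<noteq> 0 \<Longrightarrow> poly p t ^ r * (t * V t) = poly PV t"
    using V_poly by blast
  obtain \<alpha> \<alpha>'' where a: "\<alpha> \<in> FS.I1" "\<alpha>'' \<in> FS.I2" "\<And>t. t \<notin> FS.poles \<Longrightarrow> FS.SF (coeff PZ FS.total) \<alpha> \<alpha>'' t = poly PZ t / FS.denom t"
    by (rule FS.SF_exists[of PZ]) (use PZ(1) in \<open>auto simp: total_tot\<close>)
  obtain \<beta> \<beta>'' where b: "\<beta> \<in> FS.I1" "\<beta>'' \<in> FS.I2" "\<And>t. t \<notin> FS.poles \<Longrightarrow> FS.SF (coeff PV FS.total) \<beta> \<beta>'' t = poly PV t / FS.denom t"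
    by (rule FS.SF_exists[of PV]) (use PV(1) in \<open>auto simp: total_tot\<close>)
  obtain \<gamma> \<gamma>'' where g: "\<gamma> \<in> FS.I1" "\<gamma>'' \<in> FS.I2" "\<And>t. t \<notin> FS.poles \<Longrightarrow> FS.SF (coeff PT FS.total) \<gamma> \<gamma>'' t = poly PT t / FS.denom t"
    by (rule FS.SF_exists[of PT]) (use PT(1) in \<open>auto simp: total_tot\<close>)
  let ?C = "((\<alpha>,\<alpha>''),(coeff PV FS.total,\<beta>,\<beta>''),(coeff PT FS.total,\<gamma>,\<gamma>''))"
  have pD: "poly p t \<noteq> 0" if "t \<in> D" for t using that p_nonzero by simp
  have Sa: "FS.SF zom \<alpha> \<alpha>'' t = uom * Z zz t / Z u t" if "t \<in> D" for t
    using a(3)[OF D_poles[OF that]] quotient_denom[OF that PZ(3)[OF pD[OF that]]] by (simp add: total_tot PZ(2))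
  have Sb: "FS.SF (coeff PV FS.total) \<beta> \<beta>'' t = uom * (t * V t) / Z u t" if "t \<in> D" for t
    using b(3)[OF D_poles[OF that]] quotient_denom[OF that PV(2)[OF pD[OF that]]] by simp
  have Sg: "FS.SF (coeff PT FS.total) \<gamma> \<gamma>'' t = uom * T t / Z u t" if "t \<in> D" for t
    using g(3)[OF D_poles[OF that]] quotient_denom[OF that PT(2)[OF pD[OF that]]] by simp
  show thesis
  proof (rule that[of ?C])
    show "?C \<in> coefficients N \<sigma> \<rho>" using a b g by (simp add: coefficients_def Let_def)
    fix t assume t: "t \<in> D"
    note zu = Z_u_nonzero[OF t]
    have br: "bracket ?C t = uom / Z u t * (Z zz t + h t * (t * V t) - h t * (w t * T t))"
      unfolding bracket_def prod.case Sa[OF t] Sb[OF t] Sg[OF t] by (simp add: diff_divide_distrib add_divide_distrib algebra_simps)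
    show "1 / uom * w t * bracket ?C t = slope t"
    proof (cases "t = 0")
      case True
      have "Z zz 0 = h 0 * T 0" by (rule Z_T_0[OF det_E_0]) (use zz_drift in \<open>simp add: load_def\<close>)
      then show ?thesis unfolding br by (simp add: True slope_def w_0)
    next
      case False
      note d = det_nonzero[OF t False]
      have "w t / Z u t = t / det (E t)" using w_det[of t] t d zu by (simp add: frac_eq_eq)
      moreover have "1 / uom * w t * (uom / Z u t * X) = w t / Z u t * X" for X using uom_nonzero by simp
      ultimately have "1 / uom * w t * bracket ?C t = t / det (E t) * (Z zz t + h t * (t * V t) - h t * (w t * T t))"
        by (simp only: br)
      also have "\<dots> = slope t"
      proof -
        have "t * (Z zz t + h t * (t * V t) - h t * (w t * T t)) = t * Z zz t - t * h t * (w t * T t - t * V t)"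
          by (simp add: algebra_simps)
        then show ?thesis using False by (simp only: slope_def if_False times_divide_eq_left)
      qed
      finally show ?thesis .
    qed
  next
    show "case ?C of (_, _, (\<gamma>0, \<gamma>, \<gamma>'')) \<Rightarrow> \<forall>t\<in>D. h t * w t * FS.SF \<gamma>0 \<gamma> \<gamma>'' t * det (E t) = uom * (t * h t * T t)"
      unfolding prod.case
    proof
      fix t assume t: "t \<in> D"
      have "h t * w t * (uom * T t / Z u t) * det (E t) = h t * uom * T t * (w t * det (E t)) / Z u t" by simp
      also have "w t * det (E t) = t * Z u t" using w_det[of t] t by simp
      also have "h t * uom * T t * (t * Z u t) / Z u t = uom * (t * h t * T t)" using Z_u_nonzero[OF t] by simp
      finally show "h t * w t * FS.SF (coeff PT FS.total) \<gamma> \<gamma>'' t * det (E t) = uom * (t * h t * T t)" unfolding Sg[OF t] .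
    qed
  qed
qed

text \<open>
  Since \<open>w\<close> is rational, the relation has the form \<open>a + h b = 0\<close> with rational \<open>a\<close> and \<open>b\<close>; as \<open>h\<close> is not rational,
  \<open>b\<close> vanishes, and then \<open>a\<close>.
\<close>

lemma fractions_independent:
  assumes z: "\<And>t. t \<in> U \<Longrightarrow> FS.SF a0 a a'' t + h t * FS.SF b0 b b'' t - h t * w t * FS.SF g0 g g'' t = 0"
  shows "\<And>t. t \<in> U \<Longrightarrow> FS.SF a0 a a'' t = 0"
    and "\<And>t. t \<in> U \<Longrightarrow> FS.SF b0 b b'' t = w t * FS.SF g0 g g'' t"
proof -
  obtain Wa where Wa: "\<And>t. t \<notin> FS.poles \<Longrightarrow> FS.SF a0 a a'' t = poly Wa t / FS.denom t"
    using FS.SF_numerator[of a0 a a''] by blast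
  obtain Wb where Wb: "\<And>t. t \<notin> FS.poles \<Longrightarrow> FS.SF b0 b b'' t = poly Wb t / FS.denom t"
    using FS.SF_numerator[of b0 b b''] by blast
  obtain Wg where Wg: "\<And>t. t \<notin> FS.poles \<Longrightarrow> FS.SF g0 g g'' t = poly Wg t / FS.denom t"
    using FS.SF_numerator[of g0 g g''] by blast
  define X where "X = (\<Prod>j<r * degree p. [:x j, 1:])"
  define Y where "Y = (\<Prod>j<r * degree p. [:y j, 1:])"
  have X: "poly X t = (\<Prod>j<r * degree p. t + x j)" and Y: "poly Y t = (\<Prod>j<r * degree p. t + y j)" for t
    by (simp_all add: X_def Y_def poly_prod add.commute)
  have X0: "poly X t \<noteq> 0" if "t \<in> U" for t
    unfolding X by (rule prod_pos_nonzero) (use that xy_pos in auto)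
  have wX: "w t * poly X t = uom * poly Y t" if "t \<in> U" for t
    unfolding X Y using w_factors U_D that by blast
  have den: "FS.denom t \<noteq> 0" if "t \<in> U" for t
    by (rule FS.denom_nonzero) (use that U_poles in auto)
  have np: "t \<notin> FS.poles" if "t \<in> U" for t using that U_poles by auto
  have eq: "poly (Wa * X) t + h t * poly (Wb * X - Polynomial.smult uom (Y * Wg)) t = 0" if t: "t \<in> U" for t
  proof -
    have "(poly Wa t + h t * poly Wb t - h t * w t * poly Wg t) / FS.denom t = 0"
      using z[OF t] unfolding Wa[OF np[OF t]] Wb[OF np[OF t]] Wg[OF np[OF t]]
      by (simp add: add_divide_distrib diff_divide_distrib)
    then have "(poly Wa t + h t * poly Wb t - h t * w t * poly Wg t) * poly X t = 0" using den[OF t] by simp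
    then show ?thesis using wX[OF t] by (simp add: algebra_simps)
  qed
  have b0: "Wb * X - Polynomial.smult uom (Y * Wg) = 0"
    by (rule h_not_rational[of "s ` {1..<N}" "Wa * X"]) (use eq in auto)
  show "FS.SF a0 a a'' t = 0" if t: "t \<in> U" for t
    using eq[OF t] X0[OF t] unfolding b0 Wa[OF np[OF t]] by simp
  show "FS.SF b0 b b'' t = w t * FS.SF g0 g g'' t" if t: "t \<in> U" for t
  proof -
    have "poly (Wb * X) t = poly (Polynomial.smult uom (Y * Wg)) t" using b0 by simp
    then have "poly Wb t * poly X t = w t * poly Wg t * poly X t" using wX[OF t] by (simp add: mult_ac)
    then show ?thesis using X0[OF t] unfolding Wb[OF np[OF t]] Wg[OF np[OF t]] by simp
  qed
qed

lemma coefficients_unique: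
  assumes C: "((\<alpha>,\<alpha>''),(\<beta>0,\<beta>,\<beta>''),(\<gamma>0,\<gamma>,\<gamma>'')) \<in> coefficients N \<sigma> \<rho>"
    and C': "((a,a''),(b0,b,b''),(g0,g,g'')) \<in> coefficients N \<sigma> \<rho>"
    and eq: "\<And>t. t \<in> U \<Longrightarrow> bracket ((\<alpha>,\<alpha>''),(\<beta>0,\<beta>,\<beta>''),(\<gamma>0,\<gamma>,\<gamma>'')) t = bracket ((a,a''),(b0,b,b''),(g0,g,g'')) t"
  shows "(\<alpha>,\<alpha>'') = (a,a'')" and "(\<beta>0,\<beta>,\<beta>'') = (b0,b,b'') \<longleftrightarrow> (\<gamma>0,\<gamma>,\<gamma>'') = (g0,g,g'')"
proof -
  have ext: "\<alpha> \<in> FS.I1" "\<alpha>'' \<in> FS.I2" "\<beta> \<in> FS.I1" "\<beta>'' \<in> FS.I2" "\<gamma> \<in> FS.I1" "\<gamma>'' \<in> FS.I2"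
    "a \<in> FS.I1" "a'' \<in> FS.I2" "b \<in> FS.I1" "b'' \<in> FS.I2" "g \<in> FS.I1" "g'' \<in> FS.I2"
    using C C' by (auto simp: coefficients_def Let_def)
  have z: "FS.SF (zom - zom) (\<lambda>k. \<alpha> k - a k) (\<lambda>x. \<alpha>'' x - a'' x) t
      + h t * FS.SF (\<beta>0 - b0) (\<lambda>k. \<beta> k - b k) (\<lambda>x. \<beta>'' x - b'' x) t
      - h t * w t * FS.SF (\<gamma>0 - g0) (\<lambda>k. \<gamma> k - g k) (\<lambda>x. \<gamma>'' x - g'' x) t = 0" if "t \<in> U" for t
    using eq[OF that] unfolding bracket_def FS.SF_diff[symmetric] by (simp add: algebra_simps)
  have ind1: "FS.SF (zom - zom) (\<lambda>k. \<alpha> k - a k) (\<lambda>x. \<alpha>'' x - a'' x) t = 0" if "t \<in> U" for t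
    by (rule fractions_independent(1)[OF _ that]) (rule z)
  have ind2: "FS.SF (\<beta>0 - b0) (\<lambda>k. \<beta> k - b k) (\<lambda>x. \<beta>'' x - b'' x) t
      = w t * FS.SF (\<gamma>0 - g0) (\<lambda>k. \<gamma> k - g k) (\<lambda>x. \<gamma>'' x - g'' x) t" if "t \<in> U" for t
    by (rule fractions_independent(2)[OF _ that]) (rule z)
  show "(\<alpha>,\<alpha>'') = (a,a'')"
  proof -
    have "FS.SF zom \<alpha> \<alpha>'' t = FS.SF zom a a'' t" if "t \<in> U" for t
      using ind1[OF that] FS.SF_diff[of zom \<alpha> \<alpha>'' t zom a a''] by simp
    from FS.SF_unique(2,3)[OF infinite_U U_poles this] ext show ?thesis by simp
  qed
  have D: "FS.SF \<beta>0 \<beta> \<beta>'' t - FS.SF b0 b b'' t = w t * (FS.SF \<gamma>0 \<gamma> \<gamma>'' t - FS.SF g0 g g'' t)" if "t \<in> U" for t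
    unfolding FS.SF_diff by (rule ind2[OF that])
  show "(\<beta>0,\<beta>,\<beta>'') = (b0,b,b'') \<longleftrightarrow> (\<gamma>0,\<gamma>,\<gamma>'') = (g0,g,g'')"
  proof
    assume "(\<beta>0,\<beta>,\<beta>'') = (b0,b,b'')"
    then have "FS.SF \<gamma>0 \<gamma> \<gamma>'' t = FS.SF g0 g g'' t" if "t \<in> U" for t
      using D[OF that] w_nonzero[OF U_D[OF that]] by simp
    from FS.SF_unique[OF infinite_U U_poles this] ext show "(\<gamma>0,\<gamma>,\<gamma>'') = (g0,g,g'')" by simp
  next
    assume "(\<gamma>0,\<gamma>,\<gamma>'') = (g0,g,g'')"
    then have "FS.SF \<beta>0 \<beta> \<beta>'' t = FS.SF b0 b b'' t" if "t \<in> U" for t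
      using D[OF that] by simp
    from FS.SF_unique[OF infinite_U U_poles this] ext show "(\<beta>0,\<beta>,\<beta>'') = (b0,b,b'')" by simp
  qed
qed

text \<open>
  The difference of two solutions of the determinant condition is a rational function whose product with \<open>h\<close> vanishes.
  That \<open>h\<close> is not rational settles this without any knowledge of the zeros of \<open>h\<close>.
\<close>

lemma gamma_unique:
  assumes C: "((\<alpha>,\<alpha>''),(\<beta>0,\<beta>,\<beta>''),(\<gamma>0,\<gamma>,\<gamma>'')) \<in> coefficients N \<sigma> \<rho>"
    and C': "((a,a''),(b0,b,b''),(g0,g,g'')) \<in> coefficients N \<sigma> \<rho>"
    and eq: "\<And>t. t \<in> U \<Longrightarrow> h t * w t * FS.SF \<gamma>0 \<gamma> \<gamma>'' t * det (E t) = h t * w t * FS.SF g0 g g'' t * det (E t)"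
  shows "(\<gamma>0,\<gamma>,\<gamma>'') = (g0,g,g'')"
proof -
  have ext: "\<gamma> \<in> FS.I1" "\<gamma>'' \<in> FS.I2" "g \<in> FS.I1" "g'' \<in> FS.I2"
    using C C' by (auto simp: coefficients_def Let_def)
  obtain Wg where Wg: "\<And>t. t \<notin> FS.poles \<Longrightarrow>
      FS.SF (\<gamma>0 - g0) (\<lambda>k. \<gamma> k - g k) (\<lambda>x. \<gamma>'' x - g'' x) t = poly Wg t / FS.denom t"
    using FS.SF_numerator by blast
  have np: "t \<notin> FS.poles" if "t \<in> U" for t using that U_poles by auto
  have "poly 0 t + h t * poly Wg t = 0" if t: "t \<in> U" for t
  proof -
    have "h t * (FS.SF \<gamma>0 \<gamma> \<gamma>'' t - FS.SF g0 g g'' t) = 0"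
      using eq[OF t] w_nonzero[OF U_D[OF t]] det_nonzero[OF U_D[OF t]] by auto
    then show ?thesis unfolding FS.SF_diff Wg[OF np[OF t]] using FS.denom_nonzero[OF np[OF t]] by simp
  qed
  then have "Wg = 0" by (intro h_not_rational[of "s ` {1..<N}" 0]) auto
  then have "FS.SF \<gamma>0 \<gamma> \<gamma>'' t = FS.SF g0 g g'' t" if "t \<in> U" for t
    using Wg[OF np[OF that]] FS.SF_diff[of \<gamma>0 \<gamma> \<gamma>'' t g0 g g''] by simp
  from FS.SF_unique[OF infinite_U U_poles this] ext show ?thesis by simp
qed

lemma expansion_coefficients:
  defines "expansion \<equiv> (\<lambda>((\<alpha>,\<alpha>''),(\<beta>\<^sub>0,\<beta>,\<beta>''),(\<gamma>\<^sub>0,\<gamma>,\<gamma>'')). \<forall>t\<in>D.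
         (\<lambda>\<epsilon>. we \<epsilon> t - (w t + complex_of_real \<epsilon> * (1 / uom) * w t *
                (FS.SF zom \<alpha> \<alpha>'' t + h t * FS.SF \<beta>\<^sub>0 \<beta> \<beta>'' t - h t * w t * FS.SF \<gamma>\<^sub>0 \<gamma> \<gamma>'' t)))
         \<in> O[at_right 0](\<lambda>\<epsilon>. complex_of_real (\<epsilon>\<^sup>2)))"
    and "from_det \<equiv> (\<lambda>((\<alpha>::nat \<Rightarrow> complex,\<alpha>''::nat \<times> nat \<Rightarrow> complex),(\<beta>\<^sub>0::complex,\<beta>::nat \<Rightarrow> complex,\<beta>''::nat \<times> nat \<Rightarrow> complex),(\<gamma>\<^sub>0,\<gamma>,\<gamma>'')). \<forall>t\<in>D.
         h t * w t * FS.SF \<gamma>\<^sub>0 \<gamma> \<gamma>'' t * det (E t) = uom * det_dir (E t) ((t * h t) \<cdot>\<^sub>m R))"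
  shows "(\<exists>!C. C \<in> coefficients N \<sigma> \<rho> \<and> expansion C \<and> from_det C) \<and>
       (\<forall>a b c a' b' c'.
          (a,b,c) \<in> coefficients N \<sigma> \<rho> \<and> expansion (a,b,c) \<and>
          (a',b',c') \<in> coefficients N \<sigma> \<rho> \<and> expansion (a',b',c')
          \<longrightarrow> a = a' \<and> (b = b' \<longleftrightarrow> c = c'))"
proof -
  have exp: "expansion C \<longleftrightarrow> (\<forall>t\<in>D. 1 / uom * w t * bracket C t = slope t)" for C
  proof -
    obtain \<alpha> \<alpha>'' \<beta>0 \<beta> \<beta>'' \<gamma>0 \<gamma> \<gamma>'' where C: "C = ((\<alpha>,\<alpha>''),(\<beta>0,\<beta>,\<beta>''),(\<gamma>0,\<gamma>,\<gamma>''))" by (metis surj_pair)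
    show ?thesis
      unfolding C expansion_def prod.case bracket_def
      by (rule ball_cong[OF refl]) (simp only: mult.assoc expansion_iff)
  qed
  have det: "from_det C \<longleftrightarrow> (case C of (_, _, (\<gamma>0, \<gamma>, \<gamma>'')) \<Rightarrow> \<forall>t\<in>D. h t * w t * FS.SF \<gamma>0 \<gamma> \<gamma>'' t * det (E t) = uom * (t * h t * T t))" for C
    unfolding from_det_def T_def det_dir_smult[OF E_carrier R_mat_carrier] by (simp add: case_prod_beta)
  have brU: "bracket C t = bracket C' t" if "expansion C" "expansion C'" "t \<in> U" for C C' t
  proof -
    have "1 / uom * w t * bracket C t = 1 / uom * w t * bracket C' t"
      using that(1,2) U_D(1)[OF that(3)] unfolding exp by simp
    then show ?thesis using uom_nonzero w_nonzero[OF U_D[OF that(3)]] by simp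
  qed
  have second: "a = a' \<and> (b = b' \<longleftrightarrow> c = c')"
    if "(a,b,c) \<in> coefficients N \<sigma> \<rho>" "expansion (a,b,c)" "(a',b',c') \<in> coefficients N \<sigma> \<rho>" "expansion (a',b',c')"
    for a b c a' b' c'
  proof -
    obtain \<alpha> \<alpha>'' \<beta>0 \<beta> \<beta>'' \<gamma>0 \<gamma> \<gamma>'' where 1: "a = (\<alpha>,\<alpha>'')" "b = (\<beta>0,\<beta>,\<beta>'')" "c = (\<gamma>0,\<gamma>,\<gamma>'')" by (metis surj_pair)
    obtain a1 a2 b0 b1 b2 g0 g1 g2 where 2: "a' = (a1,a2)" "b' = (b0,b1,b2)" "c' = (g0,g1,g2)" by (metis surj_pair)
    show ?thesis using coefficients_unique[of \<alpha> \<alpha>'' \<beta>0 \<beta> \<beta>'' \<gamma>0 \<gamma> \<gamma>'' a1 a2 b0 b1 b2 g0 g1 g2]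
      brU[OF that(2,4)] that unfolding 1 2 by blast
  qed
  obtain C where C: "C \<in> coefficients N \<sigma> \<rho>" "\<And>t. t \<in> D \<Longrightarrow> 1 / uom * w t * bracket C t = slope t"
    "case C of (_, _, (\<gamma>0, \<gamma>, \<gamma>'')) \<Rightarrow> \<forall>t\<in>D. h t * w t * FS.SF \<gamma>0 \<gamma> \<gamma>'' t * det (E t) = uom * (t * h t * T t)"
    using coefficients_exist by blast
  have "\<exists>!C. C \<in> coefficients N \<sigma> \<rho> \<and> expansion C \<and> from_det C"
  proof (rule ex1I[of _ C])
    show "C \<in> coefficients N \<sigma> \<rho> \<and> expansion C \<and> from_det C"
      unfolding exp det using C by blast
    fix C' assume C': "C' \<in> coefficients N \<sigma> \<rho> \<and> expansion C' \<and> from_det C'"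
    obtain \<alpha> \<alpha>'' \<beta>0 \<beta> \<beta>'' \<gamma>0 \<gamma> \<gamma>'' where 1: "C = ((\<alpha>,\<alpha>''),(\<beta>0,\<beta>,\<beta>''),(\<gamma>0,\<gamma>,\<gamma>''))" by (metis surj_pair)
    obtain a1 a2 b0 b1 b2 g0 g1 g2 where 2: "C' = ((a1,a2),(b0,b1,b2),(g0,g1,g2))" by (metis surj_pair)
    have eC: "expansion C" unfolding exp using C by blast
    have "(g0,g1,g2) = (\<gamma>0,\<gamma>,\<gamma>'')"
    proof (rule gamma_unique)
      show "((a1,a2),(b0,b1,b2),(g0,g1,g2)) \<in> coefficients N \<sigma> \<rho>" "((\<alpha>,\<alpha>''),(\<beta>0,\<beta>,\<beta>''),(\<gamma>0,\<gamma>,\<gamma>'')) \<in> coefficients N \<sigma> \<rho>"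
        using C(1) C' 1 2 by auto
      fix t assume t: "t \<in> U"
      have "from_det C'" using C' by blast
      then have "h t * w t * FS.SF g0 g1 g2 t * det (E t) = uom * (t * h t * T t)"
        unfolding det 2 prod.case using U_D(1)[OF t] by blast
      moreover have "h t * w t * FS.SF \<gamma>0 \<gamma> \<gamma>'' t * det (E t) = uom * (t * h t * T t)"
        using C(3) U_D(1)[OF t] unfolding 1 prod.case by blast
      ultimately show "h t * w t * FS.SF g0 g1 g2 t * det (E t) = h t * w t * FS.SF \<gamma>0 \<gamma> \<gamma>'' t * det (E t)" by (simp only:)
    qed
    then show "C' = C" using second[of "(a1,a2)" "(b0,b1,b2)" "(g0,g1,g2)" "(\<alpha>,\<alpha>'')" "(\<beta>0,\<beta>,\<beta>'')" "(\<gamma>0,\<gamma>,\<gamma>'')"] C C' eC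
      unfolding 1 2 by blast
  qed
  then show ?thesis using second by blast
qed

lemma adjE_deriv:
  assumes "Re t > 0" "i < N" "j < N"
  shows "deriv (\<lambda>t. adjE t i j) t = adj_dir (E t) (mat_deriv E t) $$ (i,j)"
proof (rule DERIV_imp_deriv, rule has_field_derivative_adj[OF E_carrier _ _ assms(2,3)])
  show "mat_deriv E t \<in> carrier_mat N N" using carrier_matD[OF E_carrier[of t]] by (auto simp: mat_deriv_def)
  fix i j assume "i < N" "j < N"
  then show "((\<lambda>t. E t $$ (i,j)) has_field_derivative mat_deriv E t $$ (i,j)) (at t)"
    using carrier_matD[OF E_carrier[of t]] holomorphic_derivI[OF E_holomorphic, of i j t] assms(1)
    by (simp add: mat_deriv_def open_halfspace_Re_gt)
qed

end

section \<open>The expansion of the delay transform\<close>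

lemma scalar_prod_sum: "dim_vec v = n \<Longrightarrow> x \<bullet> v = (\<Sum>i<n. x $ i * v $ i)"
  by (simp add: scalar_prod_def lessThan_atLeast0)

lemma bilinear_sum:
  assumes "dim_vec x = n" "X \<in> carrier_mat n n" "dim_vec v = n"
  shows "x \<bullet> (X *\<^sub>v v) = (\<Sum>j<n. \<Sum>l<n. x $ j * X $$ (j,l) * v $ l :: 'a :: comm_ring_1)"
proof -
  have "(X *\<^sub>v v) $ j = (\<Sum>l<n. X $$ (j,l) * v $ l)" if "j < n" for j
    using that assms by (auto simp: scalar_prod_def lessThan_atLeast0 intro!: sum.cong)
  then show ?thesis using assms
    by (subst scalar_prod_sum[of _ n]) (auto simp: sum_distrib_left mult.assoc intro!: sum.cong)
qed

text \<open>
  The invertibility of \<open>A\<close> is part of the requirement that its equations determine \<open>u\<close>: a vector in the kernel of the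
  transpose could be added to \<open>u\<close>.
\<close>

lemma invertible_of_unique_row_solution:
  fixes A :: "'a :: field mat"
  assumes A: "A \<in> carrier_mat n n" and u: "u \<in> carrier_vec n"
    and unique: "\<And>v. v \<in> carrier_vec n \<Longrightarrow> transpose_mat A *\<^sub>v v = transpose_mat A *\<^sub>v u \<Longrightarrow> v = u"
  obtains B where "mat_inverse A = Some B" "A * B = 1\<^sub>m n" "B * A = 1\<^sub>m n" "B \<in> carrier_mat n n"
proof -
  have AT: "transpose_mat A \<in> carrier_mat n n" using A by simp
  have "det (transpose_mat A) \<noteq> 0"
  proof
    assume "det (transpose_mat A) = 0"
    then obtain v where v: "v \<in> carrier_vec n" "v \<noteq> 0\<^sub>v n" "transpose_mat A *\<^sub>v v = 0\<^sub>v n"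
      unfolding det_0_iff_vec_prod_zero_field[OF AT] by blast
    have "transpose_mat A *\<^sub>v (u + v) = transpose_mat A *\<^sub>v u"
      using mult_add_distrib_mat_vec[OF AT u v(1)] v(3) AT u by auto
    then have "u + v = u" using unique[of "u + v"] u v(1) by simp
    moreover have "v = (u + v) - u" using u v(1) by (intro eq_vecI) auto
    ultimately have "v = 0\<^sub>v n" using u by simp
    then show False using v(2) by simp
  qed
  then have "det A \<noteq> 0" using det_transpose[OF A] by simp
  then have "mat_inverse A \<noteq> None"
    using mat_inverse(1)[OF A, where b = "()"] det_non_zero_imp_unit[OF A, where b = "()"] by blast
  then obtain B where B: "mat_inverse A = Some B" by blast
  from mat_inverse(2)[OF A B] show ?thesis using B by (intro that[of B]) blast+
qed

theorem proposition3p6: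
  fixes N :: nat and D1 D2 :: "real mat" and \<pi> :: "real vec"
    and Fp Fh :: "real measure" and p q :: "complex poly"
    and L :: "(real \<times> nat) measure" and L\<epsilon> :: "real \<Rightarrow> (real \<times> nat) measure"
    and P\<^sub>2 M :: "real mat" and \<omega> u z :: "complex vec"
    and E K :: "complex \<Rightarrow> complex mat" and h w :: "complex \<Rightarrow> complex"
    and w\<epsilon> :: "real \<Rightarrow> complex \<Rightarrow> complex"
    and s x y \<delta> y' :: "nat \<Rightarrow> complex" and m \<rho> :: "nat \<Rightarrow> nat" and r \<sigma> :: nat
    and D :: "complex set"
    and S :: "complex \<Rightarrow> (nat \<Rightarrow> complex) \<Rightarrow> (nat \<times> nat \<Rightarrow> complex) \<Rightarrow> complex \<Rightarrow> complex"
    and a a1 kv :: "nat \<Rightarrow> complex vec" and A B :: "complex mat"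
  assumes
    \<comment> \<open>arrivals\<close>
    "arrival_process N D1 D2" and "\<forall>i<N. rate D1 D2 i > 0"
    and "\<exists>i<N. \<exists>j<N. D2 $$ (i,j) > 0"
    and "irreducible_mat (trans_mat D1 D2)" and "stationary_vec (trans_mat D1 D2) \<pi>"
    and "\<omega> = cvec (omega D1 D2 \<pi>)"
    \<comment> \<open>service times\<close>
    and "service_dist Fp" and "phase_type Fp"
    and "\<forall>t. Re t \<ge> 0 \<longrightarrow> lst Fp t = poly q t / poly p t"
    and "\<forall>t. \<not> (poly p t = 0 \<and> poly q t = 0)"
    and "lead_coeff p = 1" and "degree q < degree p"
    and "service_dist Fh" and "heavy_tailed Fh"
    and "h = (\<lambda>t. complex_of_real (mean Fp) * excess_lst Fp t - complex_of_real (mean Fh) * excess_lst Fh t)"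
    \<comment> \<open>stability and steady state of both models\<close>
    and "P\<^sub>2 = hadamard (Q2 D1 D2) (trans_mat D1 D2)" and "M = mean Fp \<cdot>\<^sub>m P\<^sub>2"
    and "drift D1 D2 \<pi> M > 0"
    and "steady_state D1 D2 Fp L"
    and "\<forall>\<epsilon>. 0 < \<epsilon> \<and> \<epsilon> < 1 \<and> drift D1 D2 \<pi> (M + (\<epsilon> * (mean Fh - mean Fp)) \<cdot>\<^sub>m P\<^sub>2) > 0
           \<longrightarrow> steady_state D1 D2 (mixture \<epsilon> Fp Fh) (L\<epsilon> \<epsilon>)"
    and "w = delay_lt D1 D2 \<pi> L" and "w\<epsilon> = (\<lambda>\<epsilon>. delay_lt D1 D2 \<pi> (L\<epsilon> \<epsilon>))"
    \<comment> \<open>base-model quantities\<close>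
    and "E = (\<lambda>t. E_mat D1 D2 (poly q t / poly p t) t)"
    and "{t. Re t \<ge> 0 \<and> det (E t) = 0} = s ` {..<N}" and "inj_on s {..<N}" and "s 0 = 0"
    and "\<forall>i\<in>{1..<N}. Re (s i) > 0 \<and> deriv (\<lambda>t. det (E t)) (s i) \<noteq> 0"
    and "\<forall>i\<in>{1..<N}. m i < N \<and> col (adj_mat (E (s i))) (m i) \<noteq> 0\<^sub>v N"
    and "a = (\<lambda>i. col (adj_mat (E (s i))) (m i))"
    and "a1 = (\<lambda>i. col (mat_deriv (\<lambda>t. adj_mat (E t)) (s i)) (m i))"
    and "\<forall>v. v = u \<longleftrightarrow> v \<in> carrier_vec N
           \<and> v \<bullet> (cmat (Lam_inv D1 D2) *\<^sub>v ones N) = complex_of_real (drift D1 D2 \<pi> M) \<and> (\<forall>i\<in>{1..<N}. v \<bullet> a i = 0)"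
    and "r = p_power D1 D2 u \<omega>"
    and "\<forall>t. poly p t \<noteq> 0 \<longrightarrow> poly p t ^ r * det (E t)
           = t * (\<Prod>k\<in>{1..<N}. t - s k) * (\<Prod>j<r * degree p. t + x j)"
    and "\<forall>t. poly p t \<noteq> 0 \<longrightarrow> poly p t ^ r * (t * (u \<bullet> (adj_mat (E t) *\<^sub>v \<omega>)))
           = (u \<bullet> \<omega>) * t * (\<Prod>k\<in>{1..<N}. t - s k) * (\<Prod>j<r * degree p. t + y j)"
    and "\<forall>j<r * degree p. Re (x j) > 0 \<and> Re (y j) > 0"
    \<comment> \<open>the vector \<open>z\<close>\<close>
    and "K = (\<lambda>t. (t * h t) \<cdot>\<^sub>m R_mat D1 D2)"
    and "\<delta> = (\<lambda>i. det_dir (E (s i)) (K (s i)) / det_dir (E (s i)) (mat_deriv E (s i)))"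
    and "kv = (\<lambda>i. vec N (\<lambda>j. (- 1) ^ (m i + j) *
           det_dir (mat_delete (E (s i)) (m i) j) (mat_delete (K (s i)) (m i) j)))"
    and "A = mat_of_cols N ((cmat (Lam_inv D1 D2) *\<^sub>v ones N) # map a [1..<N])"
    and "B = mat_of_cols N (0\<^sub>v N # map (\<lambda>i. \<delta> i \<cdot>\<^sub>v a1 i - kv i) [1..<N])"
    and "z = transpose_mat (mat_inv A) *\<^sub>v
           (transpose_mat B *\<^sub>v (transpose_mat (mat_inv A) *\<^sub>v
               (complex_of_real (drift D1 D2 \<pi> M) \<cdot>\<^sub>v unit_vec N 0))
            + complex_of_real ((mean Fp - mean Fh) * (\<pi> \<bullet> (P\<^sub>2 *\<^sub>v ones N))) \<cdot>\<^sub>v unit_vec N 0)"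
    \<comment> \<open>the distinct numbers \<open>- y' j\<close> among the \<open>- y j\<close>, with multiplicities \<open>\<rho> j\<close>\<close>
    and "inj_on y' {..<\<sigma>}" and "y' ` {..<\<sigma>} = y ` {..<r * degree p}"
    and "\<forall>j<\<sigma>. \<rho> j = card {i. i < r * degree p \<and> y i = y' j}"
    \<comment> \<open>domain of the transforms without the \<open>s\<^sub>k\<close>, and the shape of the three sums\<close>
    and "D = {t. Re t \<ge> 0} - s ` {1..<N}" and "S = simple_fractions N s \<sigma> y' \<rho>"
  shows
    "let
       expansion = (\<lambda>((\<alpha>,\<alpha>''),(\<beta>\<^sub>0,\<beta>,\<beta>''),(\<gamma>\<^sub>0,\<gamma>,\<gamma>'')). \<forall>t\<in>D.
         (\<lambda>\<epsilon>. w\<epsilon> \<epsilon> t - (w t + complex_of_real \<epsilon> * (1 / (u \<bullet> \<omega>)) * w t *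
                (S (z \<bullet> \<omega>) \<alpha> \<alpha>'' t + h t * S \<beta>\<^sub>0 \<beta> \<beta>'' t - h t * w t * S \<gamma>\<^sub>0 \<gamma> \<gamma>'' t)))
         \<in> O[at_right 0](\<lambda>\<epsilon>. complex_of_real (\<epsilon>\<^sup>2)));
       from_det = (\<lambda>((\<alpha>,\<alpha>''),(\<beta>\<^sub>0,\<beta>,\<beta>''),(\<gamma>\<^sub>0,\<gamma>,\<gamma>'')). \<forall>t\<in>D.
         h t * w t * S \<gamma>\<^sub>0 \<gamma> \<gamma>'' t * det (E t) = (u \<bullet> \<omega>) * det_dir (E t) (K t))
     in
       (\<exists>!C. C \<in> coefficients N \<sigma> \<rho> \<and> expansion C \<and> from_det C) \<and>
       (\<forall>a b c a' b' c'.
          (a,b,c) \<in> coefficients N \<sigma> \<rho> \<and> expansion (a,b,c) \<and>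
          (a',b',c') \<in> coefficients N \<sigma> \<rho> \<and> expansion (a',b',c')
          \<longrightarrow> a = a' \<and> (b = b' \<longleftrightarrow> c = c'))"
proof -
  note h_def = assms(15) and P2_def = assms(16) and M_def = assms(17) and w_def = assms(21) and we_def = assms(22)
    and E_def = assms(23) and a_def = assms(29) and a1_def = assms(30) and K_def = assms(36) and \<delta>_def = assms(37)
    and kv_def = assms(38) and A_def = assms(39) and B_def = assms(40) and z_def = assms(41)
  interpret BQ: base_queue N D1 D2 \<pi> Fp p q L
  proof
    show "steady_state D1 D2 Fp L" by (rule assms(19))
  qed (use assms(1-5,7,9-12) in auto)
  let ?H = "hadamard (Q2 D1 D2) (trans_mat D1 D2)"
  let ?c = "complex_of_real (drift D1 D2 \<pi> M)"
  let ?l = "cmat (Lam_inv D1 D2) *\<^sub>v ones N"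
  have N: "N > 0" by (rule BQ.N_pos)
  have E: "E = BQ.E" unfolding E_def by (rule ext) (simp add: BQ.E_def)
  have \<omega>: "\<omega> = vec N BQ.om"
    unfolding assms(6) BQ.om_def by (intro eq_vecI) (auto simp: omega_def Lam_inv_def mat_diag_def)
  have \<omega>i: "\<omega> $ l = BQ.om l" if "l < N" for l using that by (simp add: \<omega>)
  have d\<omega>: "dim_vec \<omega> = N" by (simp add: \<omega>)
  have li: "?l $ j = 1 / BQ.clam j" if "j < N" for j
  proof -
    have "?l $ j = (\<Sum>k<N. complex_of_real (if j = k then 1 / BQ.lam j else 0))"
      using that by (auto simp: Lam_inv_def mat_diag_def ones_def scalar_prod_def lessThan_atLeast0 intro!: sum.cong)
    also have "\<dots> = complex_of_real (\<Sum>k<N. if j = k then 1 / BQ.lam j else 0)" by (rule of_real_sum[symmetric])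
    finally show ?thesis using that by simp
  qed
  have ldim: "dim_vec ?l = N" by (simp add: Lam_inv_def mat_diag_def)
  have si: "Re (s i) > 0" "det (E (s i)) = 0" "m i < N" "deriv (\<lambda>t. det (E t)) (s i) \<noteq> 0" if "i \<in> {1..<N}" for i
  proof -
    have "s i \<in> {t. Re t \<ge> 0 \<and> det (E t) = 0}" unfolding assms(24) using that by auto
    then show "Re (s i) > 0" "det (E (s i)) = 0" "m i < N" "deriv (\<lambda>t. det (E t)) (s i) \<noteq> 0"
      using assms(27,28) that by auto
  qed
  have ai: "a i $ j = BQ.adjE (s i) j (m i)" if "i \<in> {1..<N}" "j < N" for i j
    using that si(3)[OF that(1)] adj_mat(1)[OF BQ.E_carrier[of "s i"]] by (simp add: a_def E)
  have adim: "dim_vec (a i) = N" for i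
    using adj_mat(1)[OF BQ.E_carrier[of "s i"]] by (simp add: a_def E)
  \<comment> \<open>The vector of the probabilities of an empty system solves the equations that characterise \<open>u\<close>.\<close>
  have u: "u = vec N BQ.u"
  proof -
    have "vec N BQ.u \<bullet> ?l = (\<Sum>j<N. BQ.u j / BQ.clam j)"
      by (subst scalar_prod_sum[OF ldim]) (simp add: li)
    then have "vec N BQ.u \<bullet> ?l = ?c" by (simp add: BQ.u_drift M_def P2_def)
    moreover have "vec N BQ.u \<bullet> a i = 0" if i: "i \<in> {1..<N}" for i
    proof -
      have "s i * (\<Sum>j<N. BQ.u j * BQ.adjE (s i) j (m i)) = 0"
        using BQ.phi_det[OF si(3)[OF i], of "s i"] si[OF i] by (simp add: E)
      moreover have "s i \<noteq> 0" using si(1)[OF i] by auto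
      ultimately show ?thesis by (subst scalar_prod_sum[OF adim]) (simp add: ai[OF i])
    qed
    ultimately have "vec N BQ.u = u" using assms(31) vec_carrier[of N BQ.u] by blast
    then show ?thesis by (rule sym)
  qed
  have ui: "u $ j = BQ.u j" if "j < N" for j using that by (simp add: u)
  have uom: "u \<bullet> \<omega> = BQ.uom"
    by (subst scalar_prod_sum[OF d\<omega>]) (simp add: BQ.uom_def ui \<omega>i)
  have uZ: "u \<bullet> (adj_mat (E t) *\<^sub>v \<omega>) = BQ.Z BQ.u t" for t
    using bilinear_sum[of u N "adj_mat (BQ.E t)" \<omega>] adj_mat(1)[OF BQ.E_carrier[of t]]
    by (simp add: E BQ.Z_def u \<omega>)
  have r: "r = BQ.r" unfolding assms(32) BQ.r_def by (simp add: u \<omega>)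
  have Ac: "A \<in> carrier_mat N N" unfolding A_def using N by (auto intro!: carrier_matI)
  have A0: "A $$ (j,0) = 1 / BQ.clam j" if "j < N" for j
    using that N by (simp add: A_def mat_of_cols_def li)
  have Ai: "A $$ (j,i) = BQ.adjE (s i) j (m i)" if "j < N" "i \<in> {1..<N}" for i j
    using that by (cases i) (simp_all add: A_def mat_of_cols_def ai)
  have Acol0: "col A 0 = ?l"
  proof (rule eq_vecI)
    fix i assume "i < dim_vec ?l"
    then have i: "i < N" by (simp only: ldim)
    have "col A 0 $ i = A $$ (i,0)" using Ac N i by auto
    then show "col A 0 $ i = ?l $ i" by (simp only: A0[OF i] li[OF i])
  next
    show "dim_vec (col A 0) = dim_vec ?l" unfolding ldim using Ac by simp
  qed
  have Acol: "col A i = a i" if "i \<in> {1..<N}" for i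
    using that Ac adim by (intro eq_vecI) (auto simp: Ai ai)
  have AT: "(transpose_mat A *\<^sub>v v) $ i = (if i = 0 then v \<bullet> ?l else v \<bullet> a i)" if "i < N" "v \<in> carrier_vec N" for i v
  proof -
    have "(transpose_mat A *\<^sub>v v) $ i = v \<bullet> col A i"
      using that Ac by (simp add: comm_scalar_prod[of _ N])
    then show ?thesis using Acol0 Acol[of i] that by (cases "i = 0") simp_all
  qed
  have uc: "u \<in> carrier_vec N" by (simp add: u)
  have uA: "transpose_mat A *\<^sub>v u = ?c \<cdot>\<^sub>v unit_vec N 0"
  proof (rule eq_vecI)
    fix i assume "i < dim_vec (?c \<cdot>\<^sub>v unit_vec N 0)"
    then have i: "i < N" by simp
    have "u \<bullet> ?l = ?c" "\<forall>i\<in>{1..<N}. u \<bullet> a i = 0" using assms(31) by blast+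
    then show "(transpose_mat A *\<^sub>v u) $ i = (?c \<cdot>\<^sub>v unit_vec N 0) $ i"
      using AT[OF i uc] i by auto
  qed (use Ac in auto)
  obtain Bi where Bi: "mat_inverse A = Some Bi" "A * Bi = 1\<^sub>m N" "Bi * A = 1\<^sub>m N" "Bi \<in> carrier_mat N N"
  proof (rule invertible_of_unique_row_solution[OF Ac uc])
    fix v assume v: "v \<in> carrier_vec N" "transpose_mat A *\<^sub>v v = transpose_mat A *\<^sub>v u"
    have "v \<bullet> ?l = ?c" using AT[OF N v(1)] N unfolding v(2) uA by simp
    moreover have "v \<bullet> a i = 0" if "i \<in> {1..<N}" for i
      using AT[of i v] that v(1) unfolding v(2) uA by simp
    ultimately show "v = u" using assms(31) v(1) by blast
  qed
  define Ai where "Ai i l = Bi $$ (i,l)" for i l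
  have split: "(\<Sum>i<N. f i) = f 0 + (\<Sum>i\<in>{1..<N}. f i)" for f :: "nat \<Rightarrow> complex"
  proof -
    have "{..<N} = insert 0 {1..<N}" using N by auto
    then show ?thesis by simp
  qed
  have prod_index: "(X * Y) $$ (i,j) = (\<Sum>k<N. X $$ (i,k) * Y $$ (k,j))"
    if "X \<in> carrier_mat N N" "Y \<in> carrier_mat N N" "i < N" "j < N" for X Y :: "complex mat" and i j
    by (rule BQ.mat_mult_index[OF that])
  interpret RM: replace_model N D1 D2 \<pi> Fp p q L Fh L\<epsilon> s x y y' m \<rho> \<sigma> Ai
  proof
    show "service_dist Fh" "heavy_tailed Fh" by (rule assms)+
    show "drift D1 D2 \<pi> (mean Fp \<cdot>\<^sub>m ?H) > 0" using assms(18) by (simp add: M_def P2_def)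
    show "steady_state D1 D2 (mixture \<epsilon> Fp Fh) (L\<epsilon> \<epsilon>)"
      if "0 < \<epsilon>" "\<epsilon> < 1" "drift D1 D2 \<pi> ((mean Fp + \<epsilon> * (mean Fh - mean Fp)) \<cdot>\<^sub>m ?H) > 0" for \<epsilon>
    proof -
      have "M + (\<epsilon> * (mean Fh - mean Fp)) \<cdot>\<^sub>m P\<^sub>2 = (mean Fp + \<epsilon> * (mean Fh - mean Fp)) \<cdot>\<^sub>m ?H"
        unfolding M_def P2_def by (rule eq_matI) (auto simp: algebra_simps)
      then show ?thesis using assms(20) that by simp
    qed
    show "{t. 0 \<le> Re t \<and> det (BQ.E t) = 0} = s ` {..<N}" using assms(24) by (simp add: E)
    show "inj_on s {..<N}" "s 0 = 0" by (rule assms)+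
    show "Re (s i) > 0 \<and> deriv (\<lambda>t. det (BQ.E t)) (s i) \<noteq> 0" if "i \<in> {1..<N}" for i
      using si[OF that] by (simp add: E)
    show "m i < N" if "i \<in> {1..<N}" for i using si[OF that] by simp
    show "1 / BQ.clam j * Ai 0 l + (\<Sum>i\<in>{1..<N}. BQ.adjE (s i) j (m i) * Ai i l) = (if j = l then 1 else 0)"
      if "j < N" "l < N" for j l
    proof -
      have "(A * Bi) $$ (j,l) = (\<Sum>i<N. A $$ (j,i) * Ai i l)"
        unfolding Ai_def by (rule prod_index[OF Ac Bi(4) that])
      also have "\<dots> = 1 / BQ.clam j * Ai 0 l + (\<Sum>i\<in>{1..<N}. BQ.adjE (s i) j (m i) * Ai i l)"
        using that by (simp only: split A0) (simp add: Ai)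
      finally show ?thesis unfolding Bi(2) using that by simp
    qed
    show "(\<Sum>l<N. Ai i l / BQ.clam l) = (if i = 0 then 1 else 0)" if "i < N" for i
    proof -
      have "(Bi * A) $$ (i,0) = (\<Sum>l<N. Ai i l * A $$ (l,0))"
        unfolding Ai_def by (rule prod_index[OF Bi(4) Ac that N])
      also have "\<dots> = (\<Sum>l<N. Ai i l / BQ.clam l)" by (intro sum.cong refl) (simp add: A0)
      finally show ?thesis unfolding Bi(3) using that N by simp
    qed
    show "poly p t ^ BQ.r * det (BQ.E t) = t * (\<Prod>k\<in>{1..<N}. t - s k) * (\<Prod>j<BQ.r * degree p. t + x j)"
      if "poly p t \<noteq> 0" for t using assms(33) that by (simp add: r E)
    show "poly p t ^ BQ.r * (t * BQ.Z BQ.u t) = BQ.uom * t * (\<Prod>k\<in>{1..<N}. t - s k) * (\<Prod>j<BQ.r * degree p. t + y j)"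
      if "poly p t \<noteq> 0" for t using assms(34) that by (simp add: r uZ uom)
    show "Re (x j) > 0 \<and> Re (y j) > 0" if "j < BQ.r * degree p" for j using assms(35) that by (simp add: r)
    show "inj_on y' {..<\<sigma>}" by (rule assms)
    show "y' ` {..<\<sigma>} = y ` {..<BQ.r * degree p}" using assms(43) by (simp add: r)
    show "\<rho> j = card {i. i < BQ.r * degree p \<and> y i = y' j}" if "j < \<sigma>" for j using assms(44) that by (simp add: r)
  qed
  have h: "h = RM.h" unfolding h_def by (rule ext) (simp add: RM.h_def)
  have K: "K = (\<lambda>t. (t * RM.h t) \<cdot>\<^sub>m R_mat D1 D2)" by (simp add: K_def h)
  have Ks: "K (s i) = RM.k (s i) \<cdot>\<^sub>m R_mat D1 D2" if "i \<in> {1..<N}" for i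
    using RM.k_eq[of "s i"] si(1)[OF that] by (simp add: K)
  have w: "w = BQ.w"
    unfolding w_def by (rule ext) (simp add: delay_lt_def BQ.w_def scalar_prod_sum[of _ N] \<omega>i[unfolded assms(6)] d\<omega>[unfolded assms(6)] del: index_map_vec)
  have we: "w\<epsilon> = RM.we"
    unfolding we_def by (intro ext) (simp add: delay_lt_def RM.we_def scalar_prod_sum[of _ N] \<omega>i[unfolded assms(6)] d\<omega>[unfolded assms(6)] del: index_map_vec)
  \<comment> \<open>The entries of \<open>B\<close> as derivatives of the adjugate, along \<open>E'\<close> and along \<open>K\<close>.\<close>
  have Bc: "B \<in> carrier_mat N N" unfolding B_def using N by (auto intro!: carrier_matI)
  have B0: "B $$ (j,0) = 0" if "j < N" for j using that N by (simp add: B_def mat_of_cols_def)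
  have Bij: "B $$ (j,i) = RM.\<delta> i * adj_dir (BQ.E (s i)) (mat_deriv BQ.E (s i)) $$ (j, m i)
      - adj_dir (BQ.E (s i)) (RM.k (s i) \<cdot>\<^sub>m R_mat D1 D2) $$ (j, m i)" if "j < N" "i \<in> {1..<N}" for i j
  proof -
    have dE: "dim_row (BQ.E (s i)) = N" "dim_col (BQ.E (s i)) = N" using carrier_matD[OF BQ.E_carrier[of "s i"]] by auto
    have da: "dim_row (adj_mat (BQ.E (s i))) = N" "dim_col (adj_mat (BQ.E (s i))) = N"
      using carrier_matD[OF adj_mat(1)[OF BQ.E_carrier[of "s i"]]] by auto
    have "a1 i $ j = adj_dir (BQ.E (s i)) (mat_deriv BQ.E (s i)) $$ (j, m i)"
      using that si[OF that(2)] RM.adjE_deriv[of "s i" j "m i"]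
      by (simp add: a1_def E mat_deriv_def[of "\<lambda>t. adj_mat (BQ.E t)"] da)
    moreover have "kv i $ j = adj_dir (BQ.E (s i)) (RM.k (s i) \<cdot>\<^sub>m R_mat D1 D2) $$ (j, m i)"
      using that si[OF that(2)] by (simp add: kv_def E adj_dir_def dE Ks[OF that(2)])
    moreover have "\<delta> i = RM.\<delta> i" by (simp add: \<delta>_def RM.\<delta>_def E Ks[OF that(2)])
    moreover have "dim_vec (a1 i) = N" by (simp add: a1_def E mat_deriv_def da)
    moreover have "dim_vec (kv i) = N" by (simp add: kv_def)
    moreover have "(0\<^sub>v N # map (\<lambda>i. \<delta> i \<cdot>\<^sub>v a1 i - kv i) [1..<N]) ! i = \<delta> i \<cdot>\<^sub>v a1 i - kv i"
    proof -
      obtain n where n: "i = Suc n" using \<open>i \<in> {1..<N}\<close> by (cases i) auto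
      then have "[1..<N] ! n = i" "n < length [1..<N]" using \<open>i \<in> {1..<N}\<close> nth_upt[of 1 n N] by auto
      then show ?thesis unfolding n nth_Cons_Suc by (simp only: nth_map)
    qed
    then have "B $$ (j,i) = (\<delta> i \<cdot>\<^sub>v a1 i - kv i) $ j"
      unfolding B_def using that by (subst mat_of_cols_index) auto
    ultimately show ?thesis using that by simp
  qed
  have inv: "mat_inv A = Bi" by (simp add: Bi(1))
  have uBi: "transpose_mat Bi *\<^sub>v (?c \<cdot>\<^sub>v unit_vec N 0) = u"
  proof -
    have "transpose_mat Bi *\<^sub>v (transpose_mat A *\<^sub>v u) = (transpose_mat Bi * transpose_mat A) *\<^sub>v u"
      using Bi(4) Ac uc by (subst assoc_mult_mat_vec[of _ N N _ N]) auto
    also have "transpose_mat Bi * transpose_mat A = transpose_mat (A * Bi)"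
      using transpose_mult[OF Ac Bi(4)] by simp
    also have "transpose_mat (A * Bi) *\<^sub>v u = u" unfolding Bi(2) using uc by simp
    finally show ?thesis unfolding uA .
  qed
  have load: "\<pi> \<bullet> (P\<^sub>2 *\<^sub>v ones N) = RM.load"
    unfolding P2_def RM.load_def by (rule BQ.P2_ones)
  let ?d = "complex_of_real ((mean Fp - mean Fh) * RM.load)"
  have z: "z $ l = RM.zz l" if l: "l < N" for l
  proof -
    let ?v = "transpose_mat B *\<^sub>v u + ?d \<cdot>\<^sub>v unit_vec N 0"
    have z: "z = transpose_mat Bi *\<^sub>v ?v" unfolding z_def inv load uBi ..
    have v: "?v $ i = (\<Sum>j<N. BQ.u j * B $$ (j,i)) + (if i = 0 then ?d else 0)" if "i < N" for i
      using that Bc N by (auto simp: scalar_prod_def u lessThan_atLeast0 mult.commute intro!: sum.cong)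
    have vdim: "dim_vec ?v = N" by (simp del: of_real_mult)
    have "z $ l = col Bi l \<bullet> ?v" unfolding z using l Bi(4) by (simp del: of_real_mult)
    also have "\<dots> = (\<Sum>i<N. Ai i l * ?v $ i)"
      unfolding scalar_prod_sum[OF vdim] Ai_def using l Bi(4)
      by (intro sum.cong refl arg_cong2[of _ _ _ _ "(*)"]) auto
    also have "\<dots> = (\<Sum>i<N. Ai i l * ((\<Sum>j<N. BQ.u j * B $$ (j,i)) + (if i = 0 then ?d else 0)))"
      by (intro sum.cong refl) (simp only: v lessThan_iff)
    also have "\<dots> = Ai 0 l * ?d + (\<Sum>i\<in>{1..<N}. Ai i l * (\<Sum>j<N. BQ.u j * B $$ (j,i)))"
      by (subst split, intro arg_cong2[of _ _ _ _ "(+)"] sum.cong refl) (simp_all add: B0)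
    also have "\<dots> = RM.zz l"
      unfolding RM.zz_def
      by (intro arg_cong2[of _ _ _ _ "(+)"] sum.cong refl) (auto simp: Bij mult.commute)
    finally show ?thesis .
  qed
  have zom: "z \<bullet> \<omega> = RM.zom"
    by (subst scalar_prod_sum[OF d\<omega>]) (simp add: z \<omega>i)
  show ?thesis
    unfolding Let_def assms(45,46) zom uom w we K h E by (rule RM.expansion_coefficients)
qed

end
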